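(* Let $G$ be a finite abelian group and let $A$ be a finite-dimensional $(G,* )$-algebra over a field $F$ of characteristic zero. The following conditions are equivalent: 1) $A_2^*,\ A_2^{\mathsf g},\ C_{2,*},\ C_2^{\mathsf g},\ C_{2,*}^{\mathsf g}\notin\mathrm{var}^{\sharp}(A)$ for all $g\in G\setminus\{1\}$. 2) $A\sim_{T_G^*}C\oplus N$ or $A\sim_{T_G^*}N$, where $N$ is a nilpotent $(G,* )$-algebra and $C$ is a commutative non-nilpotent algebra with trivial involution and trivial $G$-grading. 3) $c_n^{\sharp}(A)\le q$, for some constant $q$. 4) $c_n^{\sharp}(A)\le 1$. 5) $l_n^{\sharp}(A)\le 1$.
   Context: **General setting.** $F$ is a field of characteristic zero and $G$ is a finite abelian group of order $t$ with unit $1$. A $(G,* )$-algebra is an associative $F$-algebra $A=\bigoplus_{g\in G}A_g$ with $A_gA_h\subseteq A_{gh}$, together with an involution $*$ (linear, $(a^* )^*=a$, $(ab)^*=b^*a^*$) such that $A_g^*=A_g$ for all $g$. Put $A_g^{\pm}=\{a\in A_g: a^*=\pm a\}$. The trivial grading is $A_1=A$; the trivial involution (on a commutative algebra) is the identity. Direct sums carry componentwise grading and involution. The free $(G,* )$-algebra is the free associative algebra on variables $x_{i,g}^+$ (symmetric of degree $g$) and $x_{i,g}^-$ (skew of degree $g$), $i\ge1$, $g\in G$. A polynomial is a $(G,* )$-identity of $A$ if it vanishes whenever each $x_{i,g}^{\varepsilon}$ is replaced by an element of $A_g^{\varepsilon}$. $\mathrm{Id}^{\sharp}(A)$ is the ideal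 of all $(G,* )$-identities of $A$; $\mathrm{var}^{\sharp}(A)$ is the class of all $(G,* )$-algebras $B$ with $\mathrm{Id}^{\sharp}(A)\subseteq \mathrm{Id}^{\sharp}(B)$; $A\sim_{T_G^*}B$ means $\mathrm{Id}^{\sharp}(A)=\mathrm{Id}^{\sharp}(B)$. **Codimension and colength.** $P_n^{\sharp}=\mathrm{span}_F\{w_{\sigma(1)}\cdots w_{\sigma(n)}:\sigma\in S_n,\ w_i\in\{x_{i,g}^+,x_{i,g}^-\},\ g\in G\}$ and the $n$th $(G,* )$-codimension is $c_n^{\sharp}(A)=\dim_F P_n^{\sharp}/(P_n^{\sharp}\cap \mathrm{Id}^{\sharp}(A))$, $n\ge1$. Write $G=\{g_1=1,\dots,g_t\}$. For $\langle n\rangle=(n_1,\dots,n_{2t})$ with $n_1+\cdots+n_{2t}=n$, $P_{\langle n\rangle}$ is the space of multilinear polynomials of degree $n$ in $n_{2i-1}$ symmetric variables of degree $g_i$ and $n_{2i}$ skew variables of degree $g_i$, $1\le i\le t$. $S_{\langle n\rangle}=S_{n_1}\times\cdots\times S_{n_{2t}}$ acts by permuting variables of the same type, and $P_{\langle n\rangle}/(P_{\langle n\rangle}\cap \mathrm{Id}^{\sharp}(A))$ is an $S_{\langle n\rangle}$-module with character $\sum_{\langle\lambda\rangle\vdash\langle n\rangle}m_{\langle\lambda\rangle}\chi_{\lambda_1}\otimes\cdots\otimes\chi_{\lambda_{2t}}$. The $n$th $(G,* )$-colength is $l_n^{\sharp}(A)=\sum_{\langle n\rangle}\sum_{\langle\lambda\rangle\vdash\langle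 n\rangle}m_{\langle\lambda\rangle}$. **Algebras.** $e_{ij}$ denote matrix units. $A_2=\mathrm{span}_F\{e_{11}+e_{44},e_{12},e_{34}\}\subset M_4(F)$ with the reflection involution $e_{ij}\mapsto e_{5-j,5-i}$; $A_2^*$ is $A_2$ with this involution and trivial grading; for $g\ne 1$, $A_2^{\mathsf g}$ is $A_2$ with this involution and grading in which $e_{11}+e_{44}$ has degree $1$ and $e_{12},e_{34}$ have degree $g$. $C_2=\mathrm{span}_F\{I_2,e_{12}\}\subset M_2(F)$; $C_{2,*}$ is $C_2$ with trivial grading and involution $\alpha I_2+\beta e_{12}\mapsto\alpha I_2-\beta e_{12}$; for $g\neq1$, $C_2^{\mathsf g}$ is $C_2$ with $I_2$ of degree $1$, $e_{12}$ of degree $g$, and trivial involution; $C_{2,*}^{\mathsf g}$ has the same grading and the involution $\alpha I_2+\beta e_{12}\mapsto\alpha I_2-\beta e_{12}$.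
   Formalization: Conditions 4) and 5) are stated for all sufficiently large n; for every n ≥ 1 the claim fails, e.g. for a zero-multiplication algebra with one symmetric and one skew basis element, where 1)–3) hold but the first codimension and colength equal 2. *)

theory Defs
  imports
    "HOL-Analysis.Finite_Cartesian_Product"
    "HOL-Library.Numeral_Type"
    "HOL-Library.Poly_Mapping"
    "HOL-Library.Product_Plus"
    "HOL-Combinatorics.Permutations"
begin

text \<open>
  The field \<open>F\<close> is a type \<open>'f\<close> of class \<open>field_char_0\<close>; the finite abelian group \<open>G\<close> is a type
  \<open>'g\<close> of classes \<open>finite\<close> and \<open>ab_group_add\<close>, written additively, so that the unit of \<open>G\<close> is
  \<open>0\<close> and the product \<open>g h\<close> is \<open>g + h\<close>.
\<close>

section \<open>Algebras graded by a group, with graded involution\<close>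

text \<open>
  The underlying vector space of an algebra is a subspace of a vector space carried by a type,
  whose addition is used; the algebra need not be unital. \<open>homog A g\<close> is the homogeneous
  component of degree \<open>g\<close>.
\<close>

record ('f, 'g, 'a) gs_alg =
  carrier :: "'a set"
  smul :: "'f \<Rightarrow> 'a \<Rightarrow> 'a"
  mult :: "'a \<Rightarrow> 'a \<Rightarrow> 'a"
  star :: "'a \<Rightarrow> 'a"
  homog :: "'g \<Rightarrow> 'a set"

locale gs_algebra =
  fixes A :: "('f::field_char_0, 'g::{finite,ab_group_add}, 'a::ab_group_add) gs_alg"
  assumes vector_space: "vector_space (smul A)"
    and subspace_carrier: "module.subspace (smul A) (carrier A)"
    and mult_closed: "\<lbrakk>x \<in> carrier A; y \<in> carrier A\<rbrakk> \<Longrightarrow> mult A x y \<in> carrier A"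
    and mult_assoc: "\<lbrakk>x \<in> carrier A; y \<in> carrier A; z \<in> carrier A\<rbrakk>
          \<Longrightarrow> mult A (mult A x y) z = mult A x (mult A y z)"
    and mult_add_left: "\<lbrakk>x \<in> carrier A; y \<in> carrier A; z \<in> carrier A\<rbrakk>
          \<Longrightarrow> mult A (x + y) z = mult A x z + mult A y z"
    and mult_add_right: "\<lbrakk>x \<in> carrier A; y \<in> carrier A; z \<in> carrier A\<rbrakk>
          \<Longrightarrow> mult A x (y + z) = mult A x y + mult A x z"
    and mult_smul_left: "\<lbrakk>x \<in> carrier A; y \<in> carrier A\<rbrakk>
          \<Longrightarrow> mult A (smul A c x) y = smul A c (mult A x y)"
    and mult_smul_right: "\<lbrakk>x \<in> carrier A; y \<in> carrier A\<rbrakk>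
          \<Longrightarrow> mult A x (smul A c y) = smul A c (mult A x y)"
    and subspace_homog: "module.subspace (smul A) (homog A g)"
    and homog_subset: "homog A g \<subseteq> carrier A"
    and direct_sum: "x \<in> carrier A \<Longrightarrow> \<exists>!c. (\<forall>g. c g \<in> homog A g) \<and> x = (\<Sum>g\<in>UNIV. c g)"
    and homog_mult: "\<lbrakk>x \<in> homog A g; y \<in> homog A h\<rbrakk> \<Longrightarrow> mult A x y \<in> homog A (g + h)"
    and star_closed: "x \<in> carrier A \<Longrightarrow> star A x \<in> carrier A"
    and star_add: "\<lbrakk>x \<in> carrier A; y \<in> carrier A\<rbrakk> \<Longrightarrow> star A (x + y) = star A x + star A y"
    and star_smul: "x \<in> carrier A \<Longrightarrow> star A (smul A c x) = smul A c (star A x)"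
    and star_star: "x \<in> carrier A \<Longrightarrow> star A (star A x) = x"
    and star_mult: "\<lbrakk>x \<in> carrier A; y \<in> carrier A\<rbrakk>
          \<Longrightarrow> star A (mult A x y) = mult A (star A y) (star A x)"
    and star_homog: "star A ` homog A g = homog A g"

definition finite_dimensional ::
    "('f::field_char_0, 'g, 'a::ab_group_add) gs_alg \<Rightarrow> bool" where
  "finite_dimensional A \<longleftrightarrow> (\<exists>B. finite B \<and> module.span (smul A) B = carrier A)"

text \<open>Product of a nonempty word; the value on \<open>[]\<close> is a dummy that is never used.\<close>

fun word_prod :: "('f, 'g, 'a::zero) gs_alg \<Rightarrow> 'a list \<Rightarrow> 'a" where
  "word_prod A [] = 0"
| "word_prod A [x] = x"
| "word_prod A (x # y # zs) = mult A x (word_prod A (y # zs))"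

definition nilpotent_alg :: "('f, 'g, 'a::zero) gs_alg \<Rightarrow> bool" where
  "nilpotent_alg A \<longleftrightarrow>
     (\<exists>k\<ge>1. \<forall>xs. length xs = k \<and> set xs \<subseteq> carrier A \<longrightarrow> word_prod A xs = 0)"

definition commutative_alg :: "('f, 'g, 'a) gs_alg \<Rightarrow> bool" where
  "commutative_alg A \<longleftrightarrow> (\<forall>x\<in>carrier A. \<forall>y\<in>carrier A. mult A x y = mult A y x)"

definition trivial_involution :: "('f, 'g, 'a) gs_alg \<Rightarrow> bool" where
  "trivial_involution A \<longleftrightarrow> (\<forall>x\<in>carrier A. star A x = x)"

definition trivial_grading :: "('f, 'g::zero, 'a) gs_alg \<Rightarrow> bool" where
  "trivial_grading A \<longleftrightarrow> homog A 0 = carrier A"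

definition alg_sum :: "('f, 'g, 'a) gs_alg \<Rightarrow> ('f, 'g, 'b) gs_alg \<Rightarrow> ('f, 'g, 'a \<times> 'b) gs_alg" where
  "alg_sum A B =
    \<lparr> carrier = carrier A \<times> carrier B,
      smul = (\<lambda>c (x, y). (smul A c x, smul B c y)),
      mult = (\<lambda>(x, y) (x', y'). (mult A x x', mult B y y')),
      star = (\<lambda>(x, y). (star A x, star B y)),
      homog = (\<lambda>g. homog A g \<times> homog B g) \<rparr>"


section \<open>The free algebra, identities and varieties\<close>

datatype parity = Sym | Skew

instance parity :: finite
proof
  have "(UNIV :: parity set) = {Sym, Skew}"
    using parity.exhaust by auto
  then show "finite (UNIV :: parity set)"
    by (metis finite.emptyI finite.insertI)
qed

text \<open>
  The variable \<open>(i, g, Sym)\<close> is $x_{i,g}^+$ and \<open>(i, g, Skew)\<close> is $x_{i,g}^-$; indices \<open>i\<close> start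
  at \<open>0\<close>. A polynomial is a finitely supported family of coefficients on words in the variables.
  The free algebra has no unit, so its elements are those not involving the empty word.
\<close>

type_synonym 'g var = "nat \<times> 'g \<times> parity"
type_synonym ('f, 'g) gs_poly = "'g var list \<Rightarrow>\<^sub>0 'f"

definition homog_part :: "('f, 'g, 'a::uminus) gs_alg \<Rightarrow> 'g \<times> parity \<Rightarrow> 'a set" where
  "homog_part A v = (case v of
      (g, Sym) \<Rightarrow> {x \<in> homog A g. star A x = x}
    | (g, Skew) \<Rightarrow> {x \<in> homog A g. star A x = - x})"

definition poly_eval ::
    "('f::zero, 'g, 'a::comm_monoid_add) gs_alg \<Rightarrow> ('g var \<Rightarrow> 'a) \<Rightarrow> ('f, 'g) gs_poly \<Rightarrow> 'a" where
  "poly_eval A \<phi> p =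
     (\<Sum>w\<in>Poly_Mapping.keys p. smul A (Poly_Mapping.lookup p w) (word_prod A (map \<phi> w)))"

definition identities ::
    "('f::zero, 'g, 'a::ab_group_add) gs_alg \<Rightarrow> ('f, 'g) gs_poly set" where
  "identities A = {p. [] \<notin> Poly_Mapping.keys p \<and>
     (\<forall>\<phi>. (\<forall>i v. \<phi> (i, v) \<in> homog_part A v) \<longrightarrow> poly_eval A \<phi> p = 0)}"

text \<open>\<open>in_var B A\<close>: \<open>B\<close> belongs to the variety generated by \<open>A\<close>.\<close>

definition in_var ::
    "('f::field_char_0, 'g::{finite,ab_group_add}, 'b::ab_group_add) gs_alg
      \<Rightarrow> ('f, 'g, 'a::ab_group_add) gs_alg \<Rightarrow> bool" where
  "in_var B A \<longleftrightarrow> gs_algebra B \<and> identities A \<subseteq> identities B"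

definition T_equivalent ::
    "('f::field_char_0, 'g, 'a::ab_group_add) gs_alg
      \<Rightarrow> ('f, 'g, 'b::ab_group_add) gs_alg \<Rightarrow> bool" where
  "T_equivalent A B \<longleftrightarrow> identities A = identities B"


section \<open>Dimensions and traces on quotient spaces\<close>

definition pm_scale :: "'f::field \<Rightarrow> ('w \<Rightarrow>\<^sub>0 'f) \<Rightarrow> ('w \<Rightarrow>\<^sub>0 'f)" where
  "pm_scale c = Poly_Mapping.map (\<lambda>x. c * x)"

text \<open>
  \<open>word_span W\<close> is the span of \<open>W\<close>. For an injective \<open>h\<close>, \<open>pm_push h\<close> is the linear map sending
  each basis element \<open>w\<close> to \<open>h w\<close>.
\<close>

definition word_span :: "'w set \<Rightarrow> ('w \<Rightarrow>\<^sub>0 'f::field) set" where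
  "word_span W = {p. Poly_Mapping.keys p \<subseteq> W}"

definition pm_push :: "('w \<Rightarrow> 'u) \<Rightarrow> ('w \<Rightarrow>\<^sub>0 'f::field) \<Rightarrow> ('u \<Rightarrow>\<^sub>0 'f)" where
  "pm_push h p =
     (\<Sum>w\<in>Poly_Mapping.keys p. Poly_Mapping.single (h w) (Poly_Mapping.lookup p w))"

text \<open>
  Let \<open>W\<close> be a subspace of the finite-dimensional space \<open>V\<close>. The coset \<open>v + W\<close> has coordinates
  \<open>c\<close> with respect to the cosets of the elements of \<open>B\<close> iff \<open>is_coords W B v c\<close>, and these cosets
  form a basis of \<open>V / W\<close> iff every \<open>v \<in> V\<close> has unique coordinates.
\<close>

definition is_coords ::
    "('w \<Rightarrow>\<^sub>0 'f::field) set \<Rightarrow> ('w \<Rightarrow>\<^sub>0 'f) set \<Rightarrow> ('w \<Rightarrow>\<^sub>0 'f) \<Rightarrow> (('w \<Rightarrow>\<^sub>0 'f) \<Rightarrow> 'f) \<Rightarrow> bool" where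
  "is_coords W B v c \<longleftrightarrow>
     (\<forall>b. b \<notin> B \<longrightarrow> c b = 0) \<and> v - (\<Sum>b\<in>B. pm_scale (c b) b) \<in> W"

definition quot_basis ::
    "('w \<Rightarrow>\<^sub>0 'f::field) set \<Rightarrow> ('w \<Rightarrow>\<^sub>0 'f) set \<Rightarrow> ('w \<Rightarrow>\<^sub>0 'f) set \<Rightarrow> bool" where
  "quot_basis V W B \<longleftrightarrow> finite B \<and> B \<subseteq> V \<and> (\<forall>v\<in>V. \<exists>!c. is_coords W B v c)"

definition quot_dim :: "('w \<Rightarrow>\<^sub>0 'f::field) set \<Rightarrow> ('w \<Rightarrow>\<^sub>0 'f) set \<Rightarrow> nat" where
  "quot_dim V W = card (SOME B. quot_basis V W B)"

text \<open>Trace of the map induced on \<open>V / W\<close> by a linear map \<open>T\<close> that preserves \<open>V\<close> and \<open>W\<close>.\<close>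

definition quot_trace ::
    "('w \<Rightarrow>\<^sub>0 'f::field) set \<Rightarrow> ('w \<Rightarrow>\<^sub>0 'f) set \<Rightarrow> (('w \<Rightarrow>\<^sub>0 'f) \<Rightarrow> ('w \<Rightarrow>\<^sub>0 'f)) \<Rightarrow> 'f" where
  "quot_trace V W T =
     (let B = (SOME B. quot_basis V W B) in \<Sum>b\<in>B. (THE c. is_coords W B (T b) c) b)"


section \<open>Codimensions\<close>

definition multilinear_polys :: "nat \<Rightarrow> ('f::field, 'g) gs_poly set" where
  "multilinear_polys n =
     word_span {w. distinct (map fst w) \<and> set (map fst w) = {..<n}}"

definition codim :: "('f::field, 'g, 'a::ab_group_add) gs_alg \<Rightarrow> nat \<Rightarrow> nat" where
  "codim A n = quot_dim (multilinear_polys n) (multilinear_polys n \<inter> identities A)"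


section \<open>Irreducible characters of symmetric groups\<close>

definition is_partition :: "nat list \<Rightarrow> nat \<Rightarrow> bool" where
  "is_partition lam n \<longleftrightarrow> sorted_wrt (\<ge>) lam \<and> 0 \<notin> set lam \<and> sum_list lam = n"

text \<open>
  Position of the entry \<open>k < sum_list lam\<close> in the Young tableau of shape \<open>lam\<close> filled with
  \<open>0, 1, 2, \<dots>\<close> row by row.
\<close>

definition tab_row :: "nat list \<Rightarrow> nat \<Rightarrow> nat" where
  "tab_row lam k = (LEAST i. k < sum_list (take (Suc i) lam))"

definition tab_col :: "nat list \<Rightarrow> nat \<Rightarrow> nat" where
  "tab_col lam k = k - sum_list (take (tab_row lam k) lam)"

definition row_stabilizer :: "nat list \<Rightarrow> (nat \<Rightarrow> nat) set" where
  "row_stabilizer lam = {\<sigma>. \<sigma> permutes {..<sum_list lam} \<and>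
     (\<forall>k<sum_list lam. tab_row lam (\<sigma> k) = tab_row lam k)}"

definition col_stabilizer :: "nat list \<Rightarrow> (nat \<Rightarrow> nat) set" where
  "col_stabilizer lam = {\<sigma>. \<sigma> permutes {..<sum_list lam} \<and>
     (\<forall>k<sum_list lam. tab_col lam (\<sigma> k) = tab_col lam k)}"

text \<open>
  Elements of the group algebra \<open>F S\<^sub>n\<close> are finitely supported families on the permutations of
  \<open>{..<n}\<close>. \<open>young_ideal lam\<close> is the minimal left ideal generated by the Young symmetrizer, and
  \<open>irr_char lam\<close> is the character of \<open>S\<^sub>n\<close> that it affords.
\<close>

definition ga_mult ::
    "((nat \<Rightarrow> nat) \<Rightarrow>\<^sub>0 'f::field) \<Rightarrow> ((nat \<Rightarrow> nat) \<Rightarrow>\<^sub>0 'f) \<Rightarrow> ((nat \<Rightarrow> nat) \<Rightarrow>\<^sub>0 'f)" where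
  "ga_mult a b = (\<Sum>\<sigma>\<in>Poly_Mapping.keys a. \<Sum>\<tau>\<in>Poly_Mapping.keys b.
     Poly_Mapping.single (\<sigma> \<circ> \<tau>) (Poly_Mapping.lookup a \<sigma> * Poly_Mapping.lookup b \<tau>))"

definition young_symmetrizer :: "nat list \<Rightarrow> ((nat \<Rightarrow> nat) \<Rightarrow>\<^sub>0 'f::field)" where
  "young_symmetrizer lam = (\<Sum>\<rho>\<in>row_stabilizer lam. \<Sum>\<kappa>\<in>col_stabilizer lam.
     Poly_Mapping.single (\<rho> \<circ> \<kappa>) (of_int (sign \<kappa>)))"

definition young_ideal :: "nat list \<Rightarrow> ((nat \<Rightarrow> nat) \<Rightarrow>\<^sub>0 'f::field) set" where
  "young_ideal lam =
     (\<lambda>a. ga_mult a (young_symmetrizer lam)) ` word_span {\<sigma>. \<sigma> permutes {..<sum_list lam}}"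

definition irr_char :: "nat list \<Rightarrow> (nat \<Rightarrow> nat) \<Rightarrow> 'f::field" where
  "irr_char lam \<sigma> = quot_trace (young_ideal lam) {0} (pm_push (\<lambda>\<tau>. \<sigma> \<circ> \<tau>))"


section \<open>Cocharacters and colengths\<close>

text \<open>
  The tuple $(n_1,\dots,n_{2t})$ is a function \<open>ns\<close> on the types \<open>(g, Sym)\<close>, \<open>(g, Skew)\<close> of
  variables, so no enumeration of the group is chosen; likewise for multipartitions and for
  elements of the product of the symmetric groups.
\<close>

type_synonym 'g multidegree = "'g \<times> parity \<Rightarrow> nat"

definition multidegrees :: "nat \<Rightarrow> ('g::finite) multidegree set" where
  "multidegrees n = {ns. (\<Sum>v\<in>UNIV. ns v) = n}"

definition multipartitions :: "('g::finite) multidegree \<Rightarrow> ('g \<times> parity \<Rightarrow> nat list) set" where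
  "multipartitions ns = {lam. \<forall>v. is_partition (lam v) (ns v)}"

definition multihomog_polys :: "'g multidegree \<Rightarrow> ('f::field, 'g) gs_poly set" where
  "multihomog_polys ns =
     word_span {w. distinct w \<and> set w = {(i, v) | i v. i < ns v}}"

definition young_group :: "'g multidegree \<Rightarrow> ('g \<times> parity \<Rightarrow> nat \<Rightarrow> nat) set" where
  "young_group ns = {\<sigma>. \<forall>v. \<sigma> v permutes {..<ns v}}"

definition cocharacter ::
    "('f::field, 'g, 'a::ab_group_add) gs_alg \<Rightarrow> 'g multidegree
      \<Rightarrow> ('g \<times> parity \<Rightarrow> nat \<Rightarrow> nat) \<Rightarrow> 'f" where
  "cocharacter A ns \<sigma> =
     quot_trace (multihomog_polys ns) (multihomog_polys ns \<inter> identities A)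
       (pm_push (map (\<lambda>(i, v). (\<sigma> v i, v))))"

text \<open>
  \<open>multiplicities A ns m\<close>: the character of the module in multidegree \<open>ns\<close> decomposes into
  irreducible characters with multiplicities \<open>m\<close>. The irreducible characters are linearly
  independent, so \<open>m\<close> is determined on \<open>multipartitions ns\<close>, and the number \<open>l\<close> with
  \<open>has_colength A n l\<close> is unique: it is the \<open>n\<close>th colength of \<open>A\<close>.
\<close>

definition multiplicities ::
    "('f::field, 'g::finite, 'a::ab_group_add) gs_alg \<Rightarrow> 'g multidegree
      \<Rightarrow> (('g \<times> parity \<Rightarrow> nat list) \<Rightarrow> nat) \<Rightarrow> bool" where
  "multiplicities A ns m \<longleftrightarrow>
     (\<forall>\<sigma>\<in>young_group ns. cocharacter A ns \<sigma> =
        (\<Sum>lam\<in>multipartitions ns. of_nat (m lam) * (\<Prod>v\<in>UNIV. irr_char (lam v) (\<sigma> v))))"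

definition has_colength ::
    "('f::field, 'g::finite, 'a::ab_group_add) gs_alg \<Rightarrow> nat \<Rightarrow> nat \<Rightarrow> bool" where
  "has_colength A n l \<longleftrightarrow>
     (\<exists>m. (\<forall>ns\<in>multidegrees n. multiplicities A ns (m ns)) \<and>
        l = (\<Sum>ns\<in>multidegrees n. \<Sum>lam\<in>multipartitions ns. m ns lam))"


section \<open>The algebras $A_2$ and $C_2$\<close>

definition mat_scale :: "'f::field \<Rightarrow> 'f^'n^'m \<Rightarrow> 'f^'n^'m" where
  "mat_scale c M = (\<chi> i j. c * M $ i $ j)"

definition mat_unit :: "'n \<Rightarrow> 'n \<Rightarrow> 'f::field^'n^'n" where
  "mat_unit a b = (\<chi> i j. if i = a \<and> j = b then 1 else 0)"

text \<open>
  The elements of the index type \<open>4\<close> are the integers modulo 4, so \<open>1, 2, 3, 4\<close> are its four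
  elements (with \<open>4 = 0\<close>), and \<open>5 - i\<close> exchanges \<open>1, 4\<close> and \<open>2, 3\<close>.
\<close>

definition reflection :: "'f::field^4^4 \<Rightarrow> 'f^4^4" where
  "reflection M = (\<chi> i j. M $ (5 - j) $ (5 - i))"

definition A2_space :: "('f::field^4^4) set" where
  "A2_space = module.span mat_scale {mat_unit 1 1 + mat_unit 4 4, mat_unit 1 2, mat_unit 3 4}"

definition A2_star :: "('f::field, 'g::zero, 'f^4^4) gs_alg" where
  "A2_star =
    \<lparr> carrier = A2_space, smul = mat_scale, mult = (**), star = reflection,
      homog = (\<lambda>h. if h = 0 then A2_space else {0}) \<rparr>"

definition A2_gr :: "'g::zero \<Rightarrow> ('f::field, 'g, 'f^4^4) gs_alg" where
  "A2_gr g =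
    \<lparr> carrier = A2_space, smul = mat_scale, mult = (**), star = reflection,
      homog = (\<lambda>h. if h = 0 then module.span mat_scale {mat_unit 1 1 + mat_unit 4 4}
                else if h = g then module.span mat_scale {mat_unit 1 2, mat_unit 3 4}
                else {0}) \<rparr>"

definition C2_space :: "('f::field^2^2) set" where
  "C2_space = module.span mat_scale {mat 1, mat_unit 1 2}"

text \<open>On \<open>C2_space\<close> this is $\alpha I_2 + \beta e_{12} \mapsto \alpha I_2 - \beta e_{12}$.\<close>

definition C2_invol :: "'f::field^2^2 \<Rightarrow> 'f^2^2" where
  "C2_invol M = (\<chi> i j. if i = 1 \<and> j = 2 then - M $ i $ j else M $ i $ j)"

definition C2_homog :: "'g::zero \<Rightarrow> 'g \<Rightarrow> ('f::field^2^2) set" where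
  "C2_homog g h =
    (if h = 0 then module.span mat_scale {mat 1}
     else if h = g then module.span mat_scale {mat_unit 1 2}
     else {0})"

definition C2_star :: "('f::field, 'g::zero, 'f^2^2) gs_alg" where
  "C2_star =
    \<lparr> carrier = C2_space, smul = mat_scale, mult = (**), star = C2_invol,
      homog = (\<lambda>h. if h = 0 then C2_space else {0}) \<rparr>"

definition C2_gr :: "'g::zero \<Rightarrow> ('f::field, 'g, 'f^2^2) gs_alg" where
  "C2_gr g =
    \<lparr> carrier = C2_space, smul = mat_scale, mult = (**), star = (\<lambda>M. M),
      homog = C2_homog g \<rparr>"

definition C2_star_gr :: "'g::zero \<Rightarrow> ('f::field, 'g, 'f^2^2) gs_alg" where
  "C2_star_gr g =
    \<lparr> carrier = C2_space, smul = mat_scale, mult = (**), star = C2_invol,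
      homog = C2_homog g \<rparr>"


section \<open>Carriers for arbitrary algebras\<close>

text \<open>
  A quantifier over all algebras has to range over algebras carried by one type. Subspaces of
  \<open>('b + nat) \<Rightarrow>\<^sub>0 'f\<close> are, up to isomorphism, all vector spaces with a basis of cardinality at most
  that of \<open>'b + nat\<close>. In a theorem where \<open>'b\<close> is arbitrary, every algebra is covered by
  a suitable \<open>'b\<close>; and for each \<open>'b\<close> the relatively free algebras of countable rank, hence
  representatives of all classes of T-equivalent algebras, are among those considered.
\<close>

type_synonym ('f, 'g, 'b) any_gs_alg = "('f, 'g, ('b + nat) \<Rightarrow>\<^sub>0 'f) gs_alg"

end

theory Submission
  imports Defs "HOL-Analysis.Cartesian_Space"
begin

text \<open>
  If \<open>x \<mapsto> \<Phi>\<^sub>0 x + s \<Phi>\<^sub>1 x\<close> embeds \<open>X\<close> into \<open>A[s]/(s\<^sup>2)\<close>, then every identity of \<open>A\<close> is one of \<open>X\<close>: substitute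
  \<open>\<Phi>\<^sub>0 + s \<Phi>\<^sub>1\<close> with \<open>s \<in> F\<close> and compare the coefficients of \<open>1\<close> and \<open>s\<close>, as \<open>F\<close> is infinite. Hence, if
  the five algebras are not in the variety of \<open>A\<close> and \<open>e\<close> is a symmetric idempotent of degree \<open>0\<close>,
  then \<open>e A (1 - e) = 0\<close> and \<open>e A e\<close> consists of symmetric elements of degree \<open>0\<close>; so \<open>e\<close> is central,
  \<open>e A\<close> is commutative with trivial involution and grading, and \<open>A = e A \<oplus> (1 - e) A\<close>. For \<open>e\<close> with
  annihilator \<open>(1 - e) A\<close> of least dimension this annihilator contains no such idempotent and is
  therefore nilpotent. The last step needs no Wedderburn theory: if the component of degree \<open>0\<close> is
  nilpotent, so is the algebra, by the pigeonhole principle on degrees of prefixes; otherwise it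
  contains an idempotent \<open>f \<noteq> 0\<close>, and \<open>f + f\<^sup>*\<close> is not nilpotent, so some polynomial in it is a
  symmetric idempotent.

  Conversely, in \<open>C \<oplus> N\<close> all long words vanish or agree up to permutation of letters, which bounds
  codimensions and colengths by \<open>1\<close>, whereas each of the five algebras has a left unit \<open>e\<close> for some
  \<open>y = e z \<noteq> 0\<close>; placing the variable of \<open>z\<close> last in a word gives \<open>n\<close> independent words, and two
  multidegrees with nonzero cocharacter.
\<close>

section \<open>Dimensions of quotient spaces\<close>

text \<open>The five algebras cannot in general be found inside \<open>A\<close>: their radicals
  have square zero, whereas products such as y y or y (star y) in \<open>A\<close> need not vanish.
  Attaching a factor s with s^2 = 0 to the radical part removes these products, and identities do
  not notice the passage to A[s]/(s^2). The involution is the second obstacle. Idempotents come from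
  powers of a non-nilpotent element, but nothing makes that element symmetric; and for an idempotent
  e the sum of e and its image under the involution might a priori be nilpotent. An eigenvalue
  argument for right multiplication excludes this. The thresholds in conditions 4 and 5 are due to
  the nilpotent summand, which disappears only from long words. Colengths are reached through traces
  of operators acting trivially: at the identity permutation the cocharacter is a dimension, which
  gives the lower bound, and in the decomposed case every permutation acts trivially on long words,
  so that one-row characters suffice for the upper bound. The implications proved are 1 to 2, 2 to 4
  and 5, 4 to 3, and 3 or 5 back to 1.\<close>

context vector_space
begin

text \<open>Spaces of polynomials and the types carrying an algebra may be infinite-dimensional. A
  finite \<open>T\<close> with \<open>V \<subseteq> span T\<close> expresses finite dimension in all
  dimension counts below.\<close>

lemma finite_basis_exists:
  assumes "subspace V" "V \<subseteq> span T" "finite T"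
  obtains B where "finite B" "independent B" "span B = V" "card B = dim V"
proof -
  obtain B where B: "B \<subseteq> V" "independent B" "V \<subseteq> span B" "card B = dim V"
    using basis_exists by blast
  moreover have "span B = V"
    using span_subspace[OF B(1,3) assms(1)] .
  moreover have "finite B"
    using independent_span_bound[OF assms(3) B(2)] B(1) assms(2) by blast
  ultimately show ?thesis
    using that by blast
qed

lemma extend_finite_basis:
  assumes "subspace W" "subspace V" "W \<subseteq> V" "V \<subseteq> span T" "finite T"
  obtains D B where "finite D" "finite B" "D \<inter> B = {}" "independent (D \<union> B)"
    "span D = W" "span (D \<union> B) = V" "card D = dim W" "card D + card B = dim V"
proof -
  obtain D where D: "finite D" "independent D" "span D = W" "card D = dim W"
    using finite_basis_exists[of W T] assms by blast
  have "D \<subseteq> V"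
    using D(3) assms(3) span_superset by blast
  then obtain E where E: "D \<subseteq> E" "E \<subseteq> V" "independent E" "V \<subseteq> span E"
    using maximal_independent_subset_extend[OF _ D(2)] by blast
  have fin: "finite E"
    using independent_span_bound[OF assms(5) E(3)] E(2) assms(4) by blast
  have "card E = dim V"
    using E basis_card_eq_dim by blast
  moreover have "card D + card (E - D) = card E"
    using E(1) fin by (metis Un_Diff_cancel card_Un_disjoint Diff_disjoint finite_Diff finite_subset sup.absorb2)
  moreover have "span E = V"
    using span_subspace[OF E(2,4) assms(2)] .
  moreover have "D \<union> (E - D) = E"
    using E(1) by blast
  ultimately show ?thesis
    using that[of D "E - D"] D E fin by auto
qed

text \<open>The source of all minimality arguments: a subspace chosen with least dimension has no
  competitor properly inside it.\<close>

lemma dim_strict_mono: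
  assumes "subspace W" "subspace V" "W \<subset> V" "V \<subseteq> span T" "finite T"
  shows "dim W < dim V"
proof -
  obtain D B where DB: "finite D" "finite B" "D \<inter> B = {}" "independent (D \<union> B)"
      "span D = W" "span (D \<union> B) = V" "card D = dim W" "card D + card B = dim V"
    by (rule extend_finite_basis[OF assms(1,2) psubset_imp_subset[OF assms(3)] assms(4,5)])
  have "B \<noteq> {}"
    using DB(5,6) assms(3) by auto
  then have "card B > 0"
    using DB(2) by (simp add: card_gt_0_iff)
  then show ?thesis
    using DB(7,8) by linarith
qed

lemma subspace_dim_mono:
  assumes "subspace W" "subspace V" "W \<subseteq> V" "V \<subseteq> span T" "finite T"
  shows "dim W \<le> dim V"
  using dim_strict_mono[OF assms(1,2) _ assms(4,5)] assms(3) by (metis less_imp_le order_refl psubsetI)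

text \<open>The last assumption is independence of \<open>B\<close> modulo the span of
  \<open>D\<close>, in the form in which unique coordinates in a quotient supply it.\<close>

lemma independent_Un:
  assumes "finite D" "finite B" "D \<inter> B = {}" "independent D"
    and scalars: "\<And>c b. (\<Sum>b\<in>B. scale (c b) b) \<in> span D \<Longrightarrow> b \<in> B \<Longrightarrow> c b = 0"
  shows "independent (D \<union> B)"
proof (rule independent_if_scalars_zero)
  fix f x
  assume eq: "(\<Sum>x\<in>D \<union> B. scale (f x) x) = 0" and x: "x \<in> D \<union> B"
  have sum: "(\<Sum>x\<in>D. scale (f x) x) + (\<Sum>x\<in>B. scale (f x) x) = 0"
    using eq assms(1-3) by (simp add: sum.union_disjoint)
  then have "(\<Sum>x\<in>B. scale (f x) x) = - (\<Sum>x\<in>D. scale (f x) x)"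
    by (simp add: eq_neg_iff_add_eq_0 add.commute)
  also have "\<dots> \<in> span D"
    by (intro span_neg span_sum span_scale span_base)
  finally have B: "f b = 0" if "b \<in> B" for b
    using scalars that by blast
  then have "(\<Sum>x\<in>D. scale (f x) x) = 0"
    using sum by simp
  then have "f d = 0" if "d \<in> D" for d
    using independentD[OF assms(4,1) order_refl] that by blast
  then show "f x = 0"
    using B x by blast
qed (use assms in auto)

lemma independent_Un_scalars:
  assumes "finite D" "finite B" "D \<inter> B = {}" "independent (D \<union> B)"
    and "(\<Sum>b\<in>B. scale (c b) b) \<in> span D" "b \<in> B"
  shows "c b = 0"
proof -
  obtain u where u: "(\<Sum>b\<in>B. scale (c b) b) = (\<Sum>d\<in>D. scale (u d) d)"
    using assms(5) span_finite[OF assms(1)] by auto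
  define f where "f x = (if x \<in> B then c x else - u x)" for x
  have "(\<Sum>x\<in>D \<union> B. scale (f x) x) = (\<Sum>x\<in>D. scale (f x) x) + (\<Sum>x\<in>B. scale (f x) x)"
    using assms(1-3) by (simp add: sum.union_disjoint)
  also have "(\<Sum>x\<in>D. scale (f x) x) = - (\<Sum>d\<in>D. scale (u d) d)"
    unfolding sum_negf[symmetric] using assms(3) by (intro sum.cong) (auto simp: f_def)
  also have "(\<Sum>x\<in>B. scale (f x) x) = (\<Sum>d\<in>D. scale (u d) d)"
    using u by (auto simp: f_def intro: sum.cong)
  finally have "f b = 0"
    using independentD[OF assms(4) _ order_refl, of f b] assms(1,2,6) by simp
  then show ?thesis
    using assms(6) by (simp add: f_def)
qed

end

section \<open>Quotients of spaces of polynomials: bases, dimension, trace\<close>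

lemma lookup_pm_scale [simp]:
  "Poly_Mapping.lookup (pm_scale c p) w = c * Poly_Mapping.lookup p w"
  by (simp add: pm_scale_def Poly_Mapping.map.rep_eq when_def)

interpretation PM: vector_space "pm_scale :: 'f::field \<Rightarrow> ('w \<Rightarrow>\<^sub>0 'f) \<Rightarrow> ('w \<Rightarrow>\<^sub>0 'f)"
  by standard (auto intro!: poly_mapping_eqI simp: lookup_add algebra_simps)

lemma mem_word_span_iff:
  "p \<in> word_span W \<longleftrightarrow> (\<forall>w. w \<notin> W \<longrightarrow> Poly_Mapping.lookup p w = 0)"
  by (auto simp: word_span_def in_keys_iff)

lemma subspace_word_span: "PM.subspace (word_span W)"
  unfolding PM.subspace_def by (auto simp: mem_word_span_iff lookup_add)

lemma poly_mapping_eq_sum_single: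
  fixes p :: "'w \<Rightarrow>\<^sub>0 'f::field"
  shows "p = (\<Sum>w\<in>Poly_Mapping.keys p. pm_scale (Poly_Mapping.lookup p w) (Poly_Mapping.single w 1))"
  by (rule poly_mapping_eqI)
    (auto simp: lookup_sum lookup_single when_def in_keys_iff if_distrib cong: if_cong)

lemma word_span_eq_span:
  "(word_span W :: ('w \<Rightarrow>\<^sub>0 'f::field) set) = PM.span ((\<lambda>w. Poly_Mapping.single w 1) ` W)"
  (is "?L = ?R")
proof
  show "?L \<subseteq> ?R"
  proof
    fix p :: "'w \<Rightarrow>\<^sub>0 'f"
    assume "p \<in> word_span W"
    then show "p \<in> ?R"
      by (subst poly_mapping_eq_sum_single, intro PM.span_sum PM.span_scale PM.span_base)
        (auto simp: word_span_def)
  qed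
  show "?R \<subseteq> ?L"
    by (rule PM.span_minimal[OF _ subspace_word_span]) (auto simp: word_span_def)
qed

lemma is_coords_diff:
  assumes "PM.subspace W" "is_coords W B v c" "is_coords W B v c'"
  shows "(\<Sum>b\<in>B. pm_scale (c b - c' b) b) \<in> W"
proof -
  have "(v - (\<Sum>b\<in>B. pm_scale (c' b) b)) - (v - (\<Sum>b\<in>B. pm_scale (c b) b)) \<in> W"
    using assms PM.subspace_diff unfolding is_coords_def by blast
  then show ?thesis
    by (simp add: PM.scale_left_diff_distrib sum_subtractf)
qed

context
  fixes V W :: "('w \<Rightarrow>\<^sub>0 'f::field) set" and T
  assumes VW: "PM.subspace V" "PM.subspace W" "W \<subseteq> V" "V \<subseteq> PM.span T" "finite T"
begin

lemma quot_basis_exists: "\<exists>B. quot_basis V W B"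
proof -
  obtain D B where DB: "finite D" "finite B" "D \<inter> B = {}" "PM.independent (D \<union> B)"
      "PM.span D = W" "PM.span (D \<union> B) = V" "card D = PM.dim W" "card D + card B = PM.dim V"
    by (rule PM.extend_finite_basis[OF VW(2,1,3-5)])
  have "quot_basis V W B"
    unfolding quot_basis_def
  proof (intro conjI ballI)
    show "B \<subseteq> V"
      using DB(6) PM.span_superset by blast
    fix v assume "v \<in> V"
    then obtain x y where xy: "v = x + y" "x \<in> W" "y \<in> PM.span B"
      using DB(5,6) PM.span_Un[of D B] by auto
    obtain u where u: "y = (\<Sum>b\<in>B. pm_scale (u b) b)"
      using xy(3) PM.span_finite[OF DB(2)] by auto
    have "is_coords W B v (\<lambda>b. if b \<in> B then u b else 0)"
      using xy(1,2) u by (simp add: is_coords_def)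
    moreover have "c = c'" if "is_coords W B v c" "is_coords W B v c'" for c c'
    proof
      fix b
      show "c b = c' b"
      proof (cases "b \<in> B")
        case True
        then show ?thesis
          using PM.independent_Un_scalars[OF DB(1-4), of "\<lambda>b. c b - c' b" b]
            is_coords_diff[OF VW(2) that] DB(5) by simp
      next
        case False
        then show ?thesis
          using that by (simp add: is_coords_def)
      qed
    qed
    ultimately show "\<exists>!c. is_coords W B v c"
      by blast
  qed (use DB in auto)
  then show ?thesis
    by blast
qed

text \<open>\<open>quot_dim\<close> is the cardinality of an arbitrarily chosen basis. Every choice
  gives the same number, because a basis of the quotient together with a basis of \<open>W\<close>
  is a basis of \<open>V\<close>.\<close>

lemma card_quot_basis:
  assumes B: "quot_basis V W B"
  shows "card B + PM.dim W = PM.dim V"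
proof -
  obtain D where D: "finite D" "PM.independent D" "PM.span D = W" "card D = PM.dim W"
    using PM.finite_basis_exists[of W T] VW by blast
  have finB: "finite B" and BV: "B \<subseteq> V"
    using B by (auto simp: quot_basis_def)
  \<comment> \<open>Uniqueness of the coordinates of the vector 0 is independence of
    \<open>B\<close> modulo \<open>W\<close>. The coefficients are cut off outside \<open>B\<close>
    because \<open>is_coords\<close> demands it.\<close>
  have scalars: "c b = 0" if "(\<Sum>b\<in>B. pm_scale (c b) b) \<in> W" "b \<in> B" for c b
  proof -
    have "\<exists>!c. is_coords W B 0 c"
      using B PM.subspace_0[OF VW(1)] unfolding quot_basis_def by blast
    moreover have "is_coords W B 0 (\<lambda>b. 0)"
      using VW(2) PM.subspace_0 by (auto simp: is_coords_def)
    moreover have "is_coords W B 0 (\<lambda>b. if b \<in> B then c b else 0)"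
      using that(1) VW(2) PM.subspace_neg by (auto simp: is_coords_def)
    ultimately have "(\<lambda>b. if b \<in> B then c b else 0) = (\<lambda>b. 0)"
      by blast
    then show ?thesis
      using that(2) by metis
  qed
  have disj: "D \<inter> B = {}"
  proof (rule ccontr)
    assume "D \<inter> B \<noteq> {}"
    then obtain b where b: "b \<in> B" "b \<in> W"
      using D(3) PM.span_superset by blast
    have "(\<Sum>b'\<in>B. pm_scale (if b' = b then 1 else 0) b') = (\<Sum>b'\<in>{b}. b')"
      using finB b(1) by (intro sum.mono_neutral_cong_right) auto
    then show False
      using scalars[of "\<lambda>b'. if b' = b then 1 else 0" b] b by simp
  qed
  have "PM.independent (D \<union> B)"
    using PM.independent_Un[OF D(1) finB disj D(2)] scalars D(3) by blast
  moreover have "D \<union> B \<subseteq> V"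
    using D(3) VW(3) BV PM.span_superset by blast
  moreover have "V \<subseteq> PM.span (D \<union> B)"
  proof
    fix v assume "v \<in> V"
    then obtain c where "v - (\<Sum>b\<in>B. pm_scale (c b) b) \<in> W"
      using B by (auto simp: quot_basis_def is_coords_def)
    then have "v - (\<Sum>b\<in>B. pm_scale (c b) b) \<in> PM.span (D \<union> B)"
      using D(3) PM.span_mono by blast
    moreover have "(\<Sum>b\<in>B. pm_scale (c b) b) \<in> PM.span (D \<union> B)"
      by (intro PM.span_sum PM.span_scale PM.span_base) auto
    ultimately show "v \<in> PM.span (D \<union> B)"
      using PM.span_add by fastforce
  qed
  ultimately have "card (D \<union> B) = PM.dim V"
    by (rule PM.basis_card_eq_dim[rotated 2])
  then show ?thesis
    using D finB disj by (simp add: card_Un_disjoint)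
qed

lemma quot_basis_some: "quot_basis V W (SOME B. quot_basis V W B)"
  using quot_basis_exists by (rule someI_ex)

lemma quot_dim_add_dim: "quot_dim V W + PM.dim W = PM.dim V"
  unfolding quot_dim_def by (rule card_quot_basis[OF quot_basis_some])

lemma quot_dim_eq_0_iff: "quot_dim V W = 0 \<longleftrightarrow> W = V"
  using quot_dim_add_dim PM.dim_strict_mono[OF VW(2,1) _ VW(4,5)] VW(3)
  by (metis add_cancel_left_left less_irrefl psubsetI)

lemma quot_dim_le_1:
  assumes "V \<subseteq> PM.span (insert v W)"
  shows "quot_dim V W \<le> 1"
proof -
  obtain D where D: "finite D" "PM.independent D" "PM.span D = W" "card D = PM.dim W"
    using PM.finite_basis_exists[of W T] VW by blast
  have "PM.span (insert v W) \<subseteq> PM.span (insert v D)"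
    using D(3) by (metis PM.span_minimal PM.span_mono PM.span_superset PM.subspace_span
        insert_subset subset_insertI)
  then have "PM.dim V \<le> card (insert v D)"
    using PM.dim_le_card D(1) assms by (meson finite_insert order_trans)
  also have "\<dots> \<le> Suc (PM.dim W)"
    using D by (metis card_insert_le_m1 card_insert_if le_SucI order_refl)
  finally show ?thesis
    using quot_dim_add_dim by simp
qed

text \<open>The vectors form an indexed family, not a set. Their distinctness follows from the
  hypothesis: a coincidence would be a relation with coefficients 1 and -1.\<close>

lemma quot_dim_ge:
  fixes w :: "nat \<Rightarrow> 'w \<Rightarrow>\<^sub>0 'f"
  assumes wV: "\<And>j. j < n \<Longrightarrow> w j \<in> V"
    and scalars: "\<And>c j. (\<Sum>j<n. pm_scale (c j) (w j)) \<in> W \<Longrightarrow> j < n \<Longrightarrow> c j = 0"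
  shows "n \<le> quot_dim V W"
proof -
  obtain D where D: "finite D" "PM.independent D" "PM.span D = W" "card D = PM.dim W"
    using PM.finite_basis_exists[of W T] VW by blast
  have nW: "w j \<notin> W" if "j < n" for j
  proof
    assume "w j \<in> W"
    moreover have "(\<Sum>i<n. pm_scale (if i = j then 1 else 0) (w i)) = (\<Sum>i\<in>{j}. w i)"
      using that by (intro sum.mono_neutral_cong_right) auto
    ultimately show False
      using scalars[of "\<lambda>i. if i = j then 1 else 0" j] that by simp
  qed
  have inj: "inj_on w {..<n}"
  proof (rule inj_onI, rule ccontr)
    fix i j assume ij: "i \<in> {..<n}" "j \<in> {..<n}" "w i = w j" "i \<noteq> j"
    have "(\<Sum>k<n. pm_scale (if k = i then 1 else if k = j then -1 else 0) (w k)) =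
        (\<Sum>k\<in>{i, j}. pm_scale (if k = i then 1 else -1) (w k))"
      using ij by (intro sum.mono_neutral_cong_right) auto
    also have "\<dots> = 0"
      using ij by (simp add: PM.scale_minus_left)
    finally show False
      using scalars[of "\<lambda>k. if k = i then 1 else if k = j then -1 else 0" i] ij PM.subspace_0[OF VW(2)]
      by simp
  qed
  have disj: "D \<inter> w ` {..<n} = {}"
    using nW D(3) PM.span_superset by blast
  have "PM.independent (D \<union> w ` {..<n})"
  proof (rule PM.independent_Un[OF D(1) _ disj D(2)])
    fix c b
    assume "(\<Sum>b\<in>w ` {..<n}. pm_scale (c b) b) \<in> PM.span D" "b \<in> w ` {..<n}"
    then show "c b = 0"
      using scalars[of "\<lambda>j. c (w j)"] D(3) inj by (auto simp: sum.reindex)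
  qed auto
  then have "card (D \<union> w ` {..<n}) = PM.dim (D \<union> w ` {..<n})"
    by (simp add: PM.dim_eq_card_independent)
  also have "\<dots> = PM.dim (PM.span (D \<union> w ` {..<n}))"
    by simp
  also have "\<dots> \<le> PM.dim V"
  proof (rule PM.subspace_dim_mono[OF PM.subspace_span VW(1) _ VW(4,5)])
    show "PM.span (D \<union> w ` {..<n}) \<subseteq> V"
      using D(3) VW(1,3) wV PM.span_superset[of D] by (intro PM.span_minimal) auto
  qed
  finally have "PM.dim W + n \<le> PM.dim V"
    using D disj inj by (simp add: card_Un_disjoint card_image)
  then show ?thesis
    using quot_dim_add_dim by linarith
qed

lemma quot_trace_eq_0:
  assumes "quot_dim V W = 0"
  shows "quot_trace V W T' = 0"
proof -
  have "finite (SOME B. quot_basis V W B)"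
    using quot_basis_some by (simp add: quot_basis_def)
  then have "(SOME B. quot_basis V W B) = {}"
    using assms by (simp add: quot_dim_def)
  then show ?thesis
    by (simp add: quot_trace_def)
qed

text \<open>The trace of the identity is the dimension. Every nonzero trace in this proof is
  computed in this way: one-row characters, cocharacters at the identity permutation, and
  cocharacters of modules with trivial action.\<close>

lemma quot_trace_trivial:
  assumes "\<And>b. b \<in> V \<Longrightarrow> T' b - b \<in> W"
  shows "quot_trace V W T' = of_nat (quot_dim V W)"
proof -
  define B where "B = (SOME B. quot_basis V W B)"
  have B: "quot_basis V W B"
    unfolding B_def by (rule quot_basis_some)
  have "(THE c. is_coords W B (T' b) c) b = 1" if b: "b \<in> B" for b
  proof -
    have bV: "b \<in> V"
      using B b by (auto simp: quot_basis_def)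
    have "(\<Sum>b'\<in>B. pm_scale (if b' = b then 1 else 0) b') = (\<Sum>b'\<in>{b}. b')"
      using B b by (intro sum.mono_neutral_cong_right) (auto simp: quot_basis_def)
    then have "is_coords W B (T' b) (\<lambda>b'. if b' = b then 1 else 0)"
      using b assms[OF bV] by (auto simp: is_coords_def)
    moreover have "T' b \<in> V"
      using assms[OF bV] VW(1,3) bV PM.subspace_add[of V "T' b - b" b] by auto
    then have "\<exists>!c. is_coords W B (T' b) c"
      using B by (auto simp: quot_basis_def)
    ultimately show ?thesis
      by (simp add: the1_equality)
  qed
  then show ?thesis
    by (simp add: quot_trace_def quot_dim_def B_def[symmetric] Let_def)
qed

end

section \<open>Graded algebras with involution\<close>

context gs_algebra
begin

sublocale vs: vector_space "smul A"
  by (rule vector_space)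

lemmas zero_closed [simp] = vs.subspace_0[OF subspace_carrier]
lemmas add_closed [simp] = vs.subspace_add[OF subspace_carrier]
lemmas diff_closed [simp] = vs.subspace_diff[OF subspace_carrier]
lemmas neg_closed [simp] = vs.subspace_neg[OF subspace_carrier]
lemmas smul_closed [simp] = vs.subspace_scale[OF subspace_carrier]
lemmas sum_closed = vs.subspace_sum[OF subspace_carrier]
lemmas zero_homog [simp] = vs.subspace_0[OF subspace_homog]
lemmas add_homog = vs.subspace_add[OF subspace_homog]
lemmas diff_homog = vs.subspace_diff[OF subspace_homog]
lemmas smul_homog = vs.subspace_scale[OF subspace_homog]
declare mult_closed [simp] star_closed [simp]

lemma homog_closed: "x \<in> homog A g \<Longrightarrow> x \<in> carrier A"
  using homog_subset by blast

lemma mult_zero_left [simp]: "x \<in> carrier A \<Longrightarrow> mult A 0 x = 0"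
  using mult_add_left[of 0 0 x] by simp

lemma mult_zero_right [simp]: "x \<in> carrier A \<Longrightarrow> mult A x 0 = 0"
  using mult_add_right[of x 0 0] by simp

lemma mult_diff_left:
  "\<lbrakk>x \<in> carrier A; y \<in> carrier A; z \<in> carrier A\<rbrakk>
    \<Longrightarrow> mult A (x - y) z = mult A x z - mult A y z"
  using mult_add_left[of "x - y" y z] by simp

lemma mult_diff_right:
  "\<lbrakk>x \<in> carrier A; y \<in> carrier A; z \<in> carrier A\<rbrakk>
    \<Longrightarrow> mult A x (y - z) = mult A x y - mult A x z"
  using mult_add_right[of x "y - z" z] by simp

lemma mult_sum_left:
  assumes "finite I" "\<And>i. i \<in> I \<Longrightarrow> f i \<in> carrier A" "x \<in> carrier A"
  shows "mult A (\<Sum>i\<in>I. f i) x = (\<Sum>i\<in>I. mult A (f i) x)"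
  using assms by (induction I rule: finite_induct) (auto simp: mult_add_left sum_closed)

lemma mult_sum_right:
  assumes "finite I" "\<And>i. i \<in> I \<Longrightarrow> f i \<in> carrier A" "x \<in> carrier A"
  shows "mult A x (\<Sum>i\<in>I. f i) = (\<Sum>i\<in>I. mult A x (f i))"
  using assms by (induction I rule: finite_induct) (auto simp: mult_add_right sum_closed)

lemma star_zero [simp]: "star A 0 = 0"
  using star_add[of 0 0] by simp

lemma star_diff: "\<lbrakk>x \<in> carrier A; y \<in> carrier A\<rbrakk> \<Longrightarrow> star A (x - y) = star A x - star A y"
  using star_add[of "x - y" y] by simp

lemma star_in_homog: "x \<in> homog A g \<Longrightarrow> star A x \<in> homog A g"
  using star_homog by blast

lemma homog_sum_unique:
  assumes "\<And>g. c g \<in> homog A g" "\<And>g. d g \<in> homog A g" "(\<Sum>g\<in>UNIV. c g) = (\<Sum>g\<in>UNIV. d g)"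
  shows "c = d"
proof -
  have "(\<Sum>g\<in>UNIV. c g) \<in> carrier A"
    using assms(1) by (intro sum_closed homog_closed)
  then show ?thesis
    using direct_sum assms by blast
qed

lemma homog_sum_zero:
  assumes "\<And>g. c g \<in> homog A g" "(\<Sum>g\<in>UNIV. c g) = 0"
  shows "c g = 0"
  using homog_sum_unique[of c "\<lambda>_. 0"] assms by simp

lemma homog_decomp:
  assumes "x \<in> carrier A"
  obtains c where "\<And>g. c g \<in> homog A g" "x = (\<Sum>g\<in>UNIV. c g)"
  using direct_sum[OF assms] by blast

lemma homog_disjoint:
  assumes "x \<in> homog A g" "x \<in> homog A h" "g \<noteq> h"
  shows "x = 0"
proof -
  have "(\<lambda>k. if k = g then x else 0) = (\<lambda>k. if k = h then x else 0)"
    by (rule homog_sum_unique) (use assms in auto)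
  then show ?thesis
    using assms(3) by metis
qed

lemma homog_part_closed: "x \<in> homog_part A v \<Longrightarrow> x \<in> carrier A"
  by (cases v; cases "snd v") (auto simp: homog_part_def homog_closed)

lemma zero_homog_part [simp]: "0 \<in> homog_part A v"
  by (cases v; cases "snd v") (auto simp: homog_part_def)

lemma add_homog_part: "\<lbrakk>x \<in> homog_part A v; y \<in> homog_part A v\<rbrakk> \<Longrightarrow> x + y \<in> homog_part A v"
  by (cases v; cases "snd v") (auto simp: homog_part_def add_homog star_add homog_closed)

lemma smul_homog_part: "x \<in> homog_part A v \<Longrightarrow> smul A c x \<in> homog_part A v"
  by (cases v; cases "snd v")
    (auto simp: homog_part_def smul_homog star_smul homog_closed vs.scale_minus_right)

lemma word_prod_closed [simp]: "set xs \<subseteq> carrier A \<Longrightarrow> word_prod A xs \<in> carrier A"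
proof (induction xs)
  case (Cons x xs)
  then show ?case
    by (cases xs) auto
qed simp

end

lemma word_prod_Cons: "xs \<noteq> [] \<Longrightarrow> word_prod A (x # xs) = mult A x (word_prod A xs)"
  by (cases xs) auto

context gs_algebra
begin

text \<open>Both words must be nonempty: the value 0 of the empty word is a default, not a
  unit.\<close>

lemma word_prod_append:
  "\<lbrakk>set xs \<subseteq> carrier A; set ys \<subseteq> carrier A; xs \<noteq> []; ys \<noteq> []\<rbrakk>
    \<Longrightarrow> word_prod A (xs @ ys) = mult A (word_prod A xs) (word_prod A ys)"
proof (induction xs)
  case (Cons x xs)
  then show ?case
    by (cases "xs = []") (auto simp: word_prod_Cons mult_assoc)
qed simp

lemma word_prod_eq_0:
  assumes "set xs \<subseteq> carrier A" "0 \<in> set xs"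
  shows "word_prod A xs = 0"
  using assms
proof (induction xs)
  case (Cons x xs)
  then show ?case
    by (cases "xs = []") (auto simp: word_prod_Cons)
qed simp

lemma word_prod_homog:
  assumes "list_all2 (\<lambda>x g. x \<in> homog A g) xs gs"
  shows "word_prod A xs \<in> homog A (sum_list gs)"
  using assms
proof (induction xs gs rule: list_all2_induct)
  case (Cons x xs g gs)
  then show ?case
    by (cases "xs = []") (auto simp: word_prod_Cons homog_mult)
qed simp

lemma word_prod_concat:
  assumes "\<And>b. b \<in> set bs \<Longrightarrow> b \<noteq> [] \<and> set b \<subseteq> carrier A"
  shows "word_prod A (concat bs) = word_prod A (map (word_prod A) bs)"
  using assms
proof (induction bs)
  case (Cons b bs)
  show ?case
  proof (cases "bs = []")
    case False
    then have "concat bs \<noteq> []"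
      using Cons.prems by (cases bs) auto
    then show ?thesis
      using Cons False by (auto simp: word_prod_append word_prod_Cons UN_subset_iff)
  qed simp
qed simp

lemma word_prod_infix_zero:
  assumes "set us \<subseteq> carrier A" "set xs \<subseteq> carrier A" "set ys \<subseteq> carrier A" "word_prod A xs = 0" "xs \<noteq> []"
  shows "word_prod A (us @ xs @ ys) = 0"
proof -
  have "word_prod A (xs @ ys) = 0"
    using assms by (cases "ys = []") (auto simp: word_prod_append)
  then show ?thesis
    using assms by (cases "us = []") (auto simp: word_prod_append)
qed

text \<open>Nilpotency of a subset, so that the component of degree 0 and subalgebras that need not
  be graded or stable under the involution can be treated inside \<open>A\<close>.\<close>

definition nil_set :: "'a set \<Rightarrow> bool" where
  "nil_set S \<longleftrightarrow> (\<exists>k\<ge>1. \<forall>xs. length xs = k \<and> set xs \<subseteq> S \<longrightarrow> word_prod A xs = 0)"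

lemma nilpotent_alg_iff: "nilpotent_alg A \<longleftrightarrow> nil_set (carrier A)"
  by (simp add: nilpotent_alg_def nil_set_def)

lemma nil_set_word_prod:
  assumes "nil_set S" "S \<subseteq> carrier A"
  obtains k where "k \<ge> 1" "\<And>xs. \<lbrakk>length xs \<ge> k; set xs \<subseteq> S\<rbrakk> \<Longrightarrow> word_prod A xs = 0"
proof -
  obtain k where k: "k \<ge> 1" "\<And>xs. length xs = k \<and> set xs \<subseteq> S \<Longrightarrow> word_prod A xs = 0"
    using assms(1) by (auto simp: nil_set_def)
  have "word_prod A xs = 0" if "length xs \<ge> k" "set xs \<subseteq> S" for xs
  proof -
    have "set (take k xs) \<subseteq> S" "set (take k xs) \<subseteq> carrier A" "set (drop k xs) \<subseteq> carrier A"
      using that(2) assms(2) set_take_subset set_drop_subset by fast+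
    moreover have "length (take k xs) = k"
      using that(1) by simp
    ultimately show ?thesis
      using word_prod_infix_zero[of "[]" "take k xs" "drop k xs"] k by force
  qed
  then show ?thesis
    using that k(1) by blast
qed

text \<open>Linearity in one letter, for replacing a letter by its homogeneous components.\<close>

lemma word_prod_sum_slot:
  assumes "set us \<subseteq> carrier A" "set ys \<subseteq> carrier A" "finite I" "\<And>i. i \<in> I \<Longrightarrow> f i \<in> carrier A"
  shows "word_prod A (us @ (\<Sum>i\<in>I. f i) # ys) = (\<Sum>i\<in>I. word_prod A (us @ f i # ys))"
proof -
  have s: "(\<Sum>i\<in>I. f i) \<in> carrier A"
    using assms(4) by (rule sum_closed)
  have 1: "word_prod A ((\<Sum>i\<in>I. f i) # ys) = (\<Sum>i\<in>I. word_prod A (f i # ys))"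
    using assms by (cases "ys = []") (auto simp: word_prod_Cons mult_sum_left)
  have c: "word_prod A (f i # ys) \<in> carrier A" if "i \<in> I" for i
    using that assms by simp
  show ?thesis
  proof (cases "us = []")
    case False
    then have "word_prod A (us @ (\<Sum>i\<in>I. f i) # ys) =
        mult A (word_prod A us) (word_prod A ((\<Sum>i\<in>I. f i) # ys))"
      using assms s by (intro word_prod_append) auto
    also have "\<dots> = (\<Sum>i\<in>I. mult A (word_prod A us) (word_prod A (f i # ys)))"
      unfolding 1 using assms c by (intro mult_sum_right) auto
    also have "\<dots> = (\<Sum>i\<in>I. word_prod A (us @ f i # ys))"
      using assms False by (intro sum.cong) (auto simp: word_prod_append)
    finally show ?thesis .
  qed (use 1 in simp)
qed

section \<open>Evaluation of polynomials and the space of identities\<close>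

lemma poly_eval_superset:
  assumes "finite S" "Poly_Mapping.keys p \<subseteq> S"
  shows "poly_eval A \<phi> p = (\<Sum>w\<in>S. smul A (Poly_Mapping.lookup p w) (word_prod A (map \<phi> w)))"
  unfolding poly_eval_def
  using assms by (intro sum.mono_neutral_left) (auto simp: in_keys_iff)

lemma poly_eval_add: "poly_eval A \<phi> (p + q) = poly_eval A \<phi> p + poly_eval A \<phi> q"
proof -
  let ?S = "Poly_Mapping.keys p \<union> Poly_Mapping.keys q"
  have "Poly_Mapping.keys (p + q) \<subseteq> ?S"
    by (rule Poly_Mapping.keys_add)
  then show ?thesis
    by (simp add: poly_eval_superset[of ?S] lookup_add vs.scale_left_distrib sum.distrib)
qed

lemma poly_eval_scale: "poly_eval A \<phi> (pm_scale c p) = smul A c (poly_eval A \<phi> p)"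
proof -
  have "Poly_Mapping.keys (pm_scale c p) \<subseteq> Poly_Mapping.keys p"
    by (auto simp: in_keys_iff)
  then show ?thesis
    by (simp add: poly_eval_superset[of "Poly_Mapping.keys p"] vs.scale_sum_right)
qed

lemma poly_eval_zero [simp]: "poly_eval A \<phi> 0 = 0"
  by (simp add: poly_eval_def)

lemma poly_eval_sum: "poly_eval A \<phi> (\<Sum>i\<in>I. f i) = (\<Sum>i\<in>I. poly_eval A \<phi> (f i))"
  by (induction I rule: infinite_finite_induct) (auto simp: poly_eval_add)

lemma poly_eval_single [simp]:
  "poly_eval A \<phi> (Poly_Mapping.single w c) = smul A c (word_prod A (map \<phi> w))"
  by (cases "c = 0") (auto simp: poly_eval_def)

lemma poly_eval_diff: "poly_eval A \<phi> (p - q) = poly_eval A \<phi> p - poly_eval A \<phi> q"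
  using poly_eval_add[of \<phi> "p - q" q] by simp

lemma poly_eval_closed:
  assumes "\<And>x. \<phi> x \<in> carrier A"
  shows "poly_eval A \<phi> p \<in> carrier A"
  unfolding poly_eval_def using assms by (intro sum_closed smul_closed word_prod_closed) auto

lemma subspace_identities: "PM.subspace (identities A)"
  unfolding PM.subspace_def identities_def
  by (auto simp: in_keys_iff poly_eval_add poly_eval_scale lookup_add)

end

lemma identities_no_empty_word: "p \<in> identities A \<Longrightarrow> Poly_Mapping.lookup p [] = 0"
  by (simp add: identities_def in_keys_iff)

lemma identitiesD:
  "\<lbrakk>p \<in> identities A; \<And>i v. \<phi> (i, v) \<in> homog_part A v\<rbrakk> \<Longrightarrow> poly_eval A \<phi> p = 0"
  by (simp add: identities_def)

lemma identitiesI: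
  assumes "Poly_Mapping.lookup p [] = 0"
    and "\<And>\<phi>. (\<And>i v. \<phi> (i, v) \<in> homog_part A v) \<Longrightarrow> poly_eval A \<phi> p = 0"
  shows "p \<in> identities A"
  using assms by (simp add: identities_def in_keys_iff del: split_paired_All)

section \<open>Isomorphic copies and subalgebras\<close>

text \<open>Identities see an algebra only through its operations and its homogeneous components, so
  matching these transports them. The two applications are copies carried by another type and the
  Peirce decomposition at a central idempotent.\<close>

locale gs_iso = gs_algebra X
  for X :: "('f::field_char_0, 'g::{finite,ab_group_add}, 'a::ab_group_add) gs_alg" +
  fixes Y :: "('f, 'g, 'b::ab_group_add) gs_alg" and \<theta> :: "'a \<Rightarrow> 'b"
  assumes iso_add: "\<lbrakk>x \<in> carrier X; y \<in> carrier X\<rbrakk> \<Longrightarrow> \<theta> (x + y) = \<theta> x + \<theta> y"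
    and iso_smul: "x \<in> carrier X \<Longrightarrow> \<theta> (smul X c x) = smul Y c (\<theta> x)"
    and iso_mult: "\<lbrakk>x \<in> carrier X; y \<in> carrier X\<rbrakk> \<Longrightarrow> \<theta> (mult X x y) = mult Y (\<theta> x) (\<theta> y)"
    and iso_star: "x \<in> carrier X \<Longrightarrow> \<theta> (star X x) = star Y (\<theta> x)"
    and iso_inj: "inj_on \<theta> (carrier X)"
    and iso_homog: "\<theta> ` homog X g = homog Y g"
begin

lemma iso_zero: "\<theta> 0 = 0"
  using iso_add[of 0 0] by simp

lemma iso_neg: "x \<in> carrier X \<Longrightarrow> \<theta> (- x) = - \<theta> x"
  using iso_add[of x "- x"] by (simp add: iso_zero eq_neg_iff_add_eq_0 add.commute)

lemma iso_sum:
  assumes "finite I" "\<And>i. i \<in> I \<Longrightarrow> f i \<in> carrier X"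
  shows "\<theta> (\<Sum>i\<in>I. f i) = (\<Sum>i\<in>I. \<theta> (f i))"
  using assms by (induction I rule: finite_induct) (auto simp: iso_zero iso_add sum_closed)

lemma iso_word_prod: "set xs \<subseteq> carrier X \<Longrightarrow> \<theta> (word_prod X xs) = word_prod Y (map \<theta> xs)"
proof (induction xs)
  case (Cons x xs)
  then show ?case
    by (cases "xs = []") (auto simp: word_prod_Cons iso_mult)
qed (simp add: iso_zero)

lemma iso_poly_eval:
  assumes "\<And>x. \<phi> x \<in> carrier X"
  shows "\<theta> (poly_eval X \<phi> p) = poly_eval Y (\<lambda>x. \<theta> (\<phi> x)) p"
proof -
  have "word_prod X (map \<phi> w) \<in> carrier X" for w
    using assms by (intro word_prod_closed) auto
  moreover have "\<theta> (word_prod X (map \<phi> w)) = word_prod Y (map (\<lambda>x. \<theta> (\<phi> x)) w)" for w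
    using assms by (subst iso_word_prod) (auto simp: comp_def)
  ultimately show ?thesis
    by (simp add: poly_eval_def iso_sum iso_smul)
qed

lemma iso_homog_part: "homog_part Y v = \<theta> ` homog_part X v"
proof -
  obtain g s where v: "v = (g, s)"
    by (cases v)
  have "star Y (\<theta> x) = \<theta> x \<longleftrightarrow> star X x = x" if "x \<in> homog X g" for x
    using inj_on_eq_iff[OF iso_inj, of "star X x" x] that homog_closed iso_star by simp
  moreover have "star Y (\<theta> x) = - \<theta> x \<longleftrightarrow> star X x = - x" if "x \<in> homog X g" for x
    using inj_on_eq_iff[OF iso_inj, of "star X x" "- x"] that homog_closed iso_star iso_neg by simp
  ultimately show ?thesis
    unfolding v homog_part_def iso_homog[symmetric] by (cases s) auto
qed

lemma iso_identities: "identities X = identities Y"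
proof (intro equalityI subsetI)
  fix p assume p: "p \<in> identities X"
  show "p \<in> identities Y"
  proof (rule identitiesI)
    fix \<phi> :: "'g var \<Rightarrow> 'b"
    assume "\<And>i v. \<phi> (i, v) \<in> homog_part Y v"
    then have "\<forall>i v. \<exists>x. x \<in> homog_part X v \<and> \<theta> x = \<phi> (i, v)"
      unfolding iso_homog_part by (metis imageE)
    then obtain \<psi> :: "nat \<Rightarrow> 'g \<times> parity \<Rightarrow> 'a" where \<psi>: "\<And>i v. \<psi> i v \<in> homog_part X v" "\<And>i v. \<theta> (\<psi> i v) = \<phi> (i, v)"
      by metis
    have "poly_eval Y (\<lambda>x. \<theta> (case x of (i, v) \<Rightarrow> \<psi> i v)) p = \<theta> (poly_eval X (\<lambda>(i, v). \<psi> i v) p)"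
      by (subst iso_poly_eval) (simp_all add: case_prod_unfold homog_part_closed[OF \<psi>(1)])
    also have "\<dots> = 0"
      using identitiesD[OF p, of "\<lambda>(i, v). \<psi> i v"] \<psi>(1) by (simp add: iso_zero)
    finally show "poly_eval Y \<phi> p = 0"
      using \<psi>(2) by (simp add: case_prod_unfold)
  qed (rule identities_no_empty_word[OF p])
next
  fix p assume p: "p \<in> identities Y"
  show "p \<in> identities X"
  proof (rule identitiesI)
    fix \<phi> :: "'g var \<Rightarrow> 'a"
    assume \<phi>: "\<And>i v. \<phi> (i, v) \<in> homog_part X v"
    then have c: "\<phi> x \<in> carrier X" for x
      using homog_part_closed by (cases x) blast
    have "\<theta> (poly_eval X \<phi> p) = poly_eval Y (\<lambda>x. \<theta> (\<phi> x)) p"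
      using c by (rule iso_poly_eval)
    also have "\<dots> = \<theta> 0"
      using identitiesD[OF p, of "\<lambda>x. \<theta> (\<phi> x)"] \<phi> by (simp add: iso_zero iso_homog_part)
    finally show "poly_eval X \<phi> p = 0"
      using iso_inj poly_eval_closed[of \<phi> p] c by (auto simp: inj_on_def)
  qed (rule identities_no_empty_word[OF p])
qed

end

text \<open>\<open>\<psi>\<close> is meant as a left inverse of \<open>\<theta>\<close> on the
  carrier: arguments are pulled back to \<open>A\<close>, where the operation is performed.\<close>

definition image_alg ::
    "('f \<Rightarrow> 'b \<Rightarrow> 'b) \<Rightarrow> ('a \<Rightarrow> 'b) \<Rightarrow> ('b \<Rightarrow> 'a) \<Rightarrow> ('f, 'g, 'a) gs_alg \<Rightarrow> ('f, 'g, 'b) gs_alg" where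
  "image_alg s \<theta> \<psi> A =
    \<lparr> carrier = \<theta> ` carrier A, smul = s, mult = (\<lambda>x y. \<theta> (mult A (\<psi> x) (\<psi> y))),
      star = (\<lambda>x. \<theta> (star A (\<psi> x))), homog = (\<lambda>g. \<theta> ` homog A g) \<rparr>"

lemma gs_iso_image_alg:
  fixes A :: "('f::field_char_0, 'g::{finite,ab_group_add}, 'a::ab_group_add) gs_alg"
    and s :: "'f \<Rightarrow> 'b::ab_group_add \<Rightarrow> 'b"
  assumes "gs_algebra A" and lin: "Vector_Spaces.linear (smul A) s \<theta>"
    and inv: "\<And>x. x \<in> carrier A \<Longrightarrow> \<psi> (\<theta> x) = x"
  shows "gs_algebra (image_alg s \<theta> \<psi> A)" "gs_iso A (image_alg s \<theta> \<psi> A) \<theta>"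
proof -
  interpret gs_algebra A by fact
  interpret \<theta>: Vector_Spaces.linear "smul A" s \<theta> by fact
  have inj: "inj_on \<theta> (carrier A)"
    using inv by (metis inj_onI)
  have inv_homog: "\<psi> (\<theta> x) = x" if "x \<in> homog A g" for x g
    using that inv homog_closed by blast
  show "gs_iso A (image_alg s \<theta> \<psi> A) \<theta>"
    using inj by unfold_locales (auto simp: image_alg_def \<theta>.add \<theta>.scale inv)
  have star_homog': "(\<lambda>x. \<theta> (star A (\<psi> x))) ` \<theta> ` homog A g = \<theta> ` homog A g" for g
  proof -
    have "(\<lambda>x. \<theta> (star A (\<psi> x))) ` \<theta> ` homog A g = \<theta> ` star A ` homog A g"
      by (auto simp: image_image inv_homog cong: image_cong_simp)
    then show ?thesis
      by (simp add: star_homog)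
  qed
  show "gs_algebra (image_alg s \<theta> \<psi> A)"
  proof (rule gs_algebra.intro, goal_cases)
    \<comment> \<open>Goal 11 is \<open>direct_sum\<close>: existence is pushed forward, uniqueness
      pulled back along the injective \<open>\<theta>\<close>. The other axioms transport by
      rewriting.\<close>
    case (11 x)
    then obtain a where a: "a \<in> carrier A" "x = \<theta> a"
      by (auto simp: image_alg_def)
    obtain c where c: "\<And>g. c g \<in> homog A g" "a = (\<Sum>g\<in>UNIV. c g)"
      using homog_decomp[OF a(1)] by blast
    show ?case
    proof (rule ex1I[of _ "\<lambda>g. \<theta> (c g)"])
      show "(\<forall>g. \<theta> (c g) \<in> homog (image_alg s \<theta> \<psi> A) g) \<and> x = (\<Sum>g\<in>UNIV. \<theta> (c g))"
        using a c by (auto simp: image_alg_def \<theta>.sum)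
      fix d assume d: "(\<forall>g. d g \<in> homog (image_alg s \<theta> \<psi> A) g) \<and> x = (\<Sum>g\<in>UNIV. d g)"
      then have "\<forall>g. \<exists>b. b \<in> homog A g \<and> d g = \<theta> b"
        by (auto simp: image_alg_def)
      then obtain b where b: "\<And>g. b g \<in> homog A g" "\<And>g. d g = \<theta> (b g)"
        by metis
      have "\<theta> (\<Sum>g\<in>UNIV. b g) = \<theta> a"
        using a d b(2) by (simp add: \<theta>.sum)
      moreover have "(\<Sum>g\<in>UNIV. b g) \<in> carrier A"
        using b(1) by (intro sum_closed homog_closed)
      ultimately have "(\<Sum>g\<in>UNIV. b g) = a"
        using inj_on_eq_iff[OF inj] a(1) by blast
      then have "b = c"
        using homog_sum_unique[of b c] b c by simp
      then show "d = (\<lambda>g. \<theta> (c g))"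
        using b(2) by auto
    qed
  qed (use \<theta>.vs2.vector_space_axioms subspace_carrier subspace_homog homog_subset star_homog' in
      \<open>auto simp: image_alg_def inv \<theta>.add[symmetric] \<theta>.scale[symmetric] mult_assoc mult_add_left
        mult_add_right mult_smul_left mult_smul_right star_add star_smul star_star star_mult
        inv_homog homog_mult \<theta>.subspace_image\<close>)
qed

definition sub_alg :: "('f, 'g, 'a) gs_alg \<Rightarrow> 'a set \<Rightarrow> ('f, 'g, 'a) gs_alg" where
  "sub_alg A S = A\<lparr>carrier := S, homog := (\<lambda>g. homog A g \<inter> S)\<rparr>"

lemma (in gs_algebra) gs_algebra_sub_alg:
  assumes S: "vs.subspace S" "S \<subseteq> carrier A"
    and mult: "\<And>x y. \<lbrakk>x \<in> S; y \<in> S\<rbrakk> \<Longrightarrow> mult A x y \<in> S"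
    and star: "\<And>x. x \<in> S \<Longrightarrow> star A x \<in> S"
    and decomp: "\<And>x. x \<in> S \<Longrightarrow> \<exists>c. (\<forall>g. c g \<in> homog A g \<inter> S) \<and> x = (\<Sum>g\<in>UNIV. c g)"
  shows "gs_algebra (sub_alg A S)"
proof -
  have [simp]: "x \<in> carrier A" if "x \<in> S" for x
    using that S(2) by blast
  have star_homog': "star A ` (homog A g \<inter> S) = homog A g \<inter> S" for g
  proof
    show "star A ` (homog A g \<inter> S) \<subseteq> homog A g \<inter> S"
      using star star_in_homog by blast
    show "homog A g \<inter> S \<subseteq> star A ` (homog A g \<inter> S)"
    proof
      fix x assume x: "x \<in> homog A g \<inter> S"
      then have "x = star A (star A x)"
        by (simp add: star_star)
      then show "x \<in> star A ` (homog A g \<inter> S)"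
        using x star star_in_homog by blast
    qed
  qed
  show ?thesis
  proof (rule gs_algebra.intro, goal_cases)
    case (11 x)
    then have x: "x \<in> S"
      by (simp add: sub_alg_def)
    then obtain c where "\<forall>g. c g \<in> homog A g \<inter> S" "x = (\<Sum>g\<in>UNIV. c g)"
      using decomp by blast
    moreover have "\<exists>!c. (\<forall>g. c g \<in> homog A g) \<and> x = (\<Sum>g\<in>UNIV. c g)"
      using x by (simp add: direct_sum)
    ultimately show ?case
      by (auto simp: sub_alg_def)
  qed (use assms star_homog' in
      \<open>auto simp: sub_alg_def mult_assoc mult_add_left vs.vector_space_axioms
        mult_add_right mult_smul_left mult_smul_right star_add star_smul star_star star_mult
        homog_mult vs.subspace_inter subspace_homog\<close>)
qed

text \<open>Only finite-dimensional algebras are copied, so the summand \<open>nat\<close> provides enough basis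
  vectors.\<close>

lemma finite_dimensional_copy:
  fixes A :: "('f::field_char_0, 'g::{finite,ab_group_add}, 'a::ab_group_add) gs_alg"
  assumes "gs_algebra A" "finite_dimensional A"
  obtains B :: "('f, 'g, 'b) any_gs_alg"
  where "gs_algebra B" "finite_dimensional B" "identities A = identities B"
proof -
  interpret gs_algebra A by fact
  interpret vp: vector_space_pair "smul A" "pm_scale :: 'f \<Rightarrow> ('b + nat \<Rightarrow>\<^sub>0 'f) \<Rightarrow> _" ..
  obtain T where T: "finite T" "vs.span T = carrier A"
    using assms(2) by (auto simp: finite_dimensional_def)
  obtain E where E: "finite E" "vs.independent E" "vs.span E = carrier A" "card E = vs.dim (carrier A)"
    by (rule vs.finite_basis_exists[OF subspace_carrier _ T(1)]) (use T(2) in auto)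
  obtain k :: "'a \<Rightarrow> nat" where k: "inj_on k E"
    using finite_imp_inj_to_nat_seg[OF E(1)] by blast
  define b :: "'a \<Rightarrow> 'b + nat \<Rightarrow>\<^sub>0 'f" where "b x = Poly_Mapping.single (Inr (k x)) 1" for x
  obtain \<theta> where \<theta>: "Vector_Spaces.linear (smul A) pm_scale \<theta>" "\<And>x. x \<in> E \<Longrightarrow> \<theta> x = b x"
    using vp.linear_independent_extend[OF E(2)] by blast
  interpret \<theta>: Vector_Spaces.linear "smul A" pm_scale \<theta> by fact
  have "inj_on \<theta> (vs.span E)"
  proof (rule \<theta>.inj_on_iff_eq_0[THEN iffD2, OF vs.subspace_span], intro ballI impI)
    fix x assume x: "x \<in> vs.span E" "\<theta> x = 0"
    obtain u where u: "x = (\<Sum>e\<in>E. smul A (u e) e)"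
      using x(1) vs.span_finite[OF E(1)] by auto
    have eq: "(\<Sum>e\<in>E. pm_scale (u e) (b e)) = 0"
      using x(2) \<theta>(2) by (simp add: u \<theta>.sum \<theta>.scale)
    have "(\<Sum>e\<in>E. u e * Poly_Mapping.lookup (b e) (Inr (k e'))) = 0" for e'
      using arg_cong[OF eq, of "\<lambda>p. Poly_Mapping.lookup p (Inr (k e'))"] by (simp add: lookup_sum)
    moreover have "(\<Sum>e\<in>E. u e * Poly_Mapping.lookup (b e) (Inr (k e'))) = (\<Sum>e\<in>{e'}. u e)"
      if "e' \<in> E" for e'
      using E(1) that k by (intro sum.mono_neutral_cong_right)
        (auto simp: b_def lookup_single when_def inj_on_def)
    ultimately have "u e = 0" if "e \<in> E" for e
      using that by simp
    then show "x = 0"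
      by (simp add: u)
  qed
  then have inj: "inj_on \<theta> (carrier A)"
    by (simp add: E(3))
  let ?B = "image_alg pm_scale \<theta> (inv_into (carrier A) \<theta>) A"
  have B: "gs_algebra ?B" "gs_iso A ?B \<theta>"
    using gs_iso_image_alg[OF assms(1) \<theta>(1)] inj by auto
  have "PM.span (\<theta> ` T) = \<theta> ` carrier A"
    by (simp add: \<theta>.span_image T(2))
  then have "finite_dimensional ?B"
    unfolding finite_dimensional_def using T(1) by (auto simp: image_alg_def)
  then show ?thesis
    using that B gs_iso.iso_identities by blast
qed

section \<open>Idempotents and nilpotency\<close>

context gs_algebra
begin

text \<open>Powers in an algebra without unit. By the default value of the empty word,
  \<open>pw x 0 = 0\<close>, so exponents are kept nonzero.\<close>

abbreviation pw :: "'a \<Rightarrow> nat \<Rightarrow> 'a" where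
  "pw x n \<equiv> word_prod A (replicate n x)"

lemma pw_closed: "x \<in> carrier A \<Longrightarrow> pw x n \<in> carrier A"
  by (intro word_prod_closed) auto

lemma pw_Suc: "n \<noteq> 0 \<Longrightarrow> pw x (Suc n) = mult A x (pw x n)"
  by (simp add: word_prod_Cons)

lemma pw_add: "\<lbrakk>x \<in> carrier A; i \<noteq> 0; j \<noteq> 0\<rbrakk> \<Longrightarrow> pw x (i + j) = mult A (pw x i) (pw x j)"
  unfolding replicate_add by (intro word_prod_append) auto

lemma mult_pw:
  assumes "x \<in> carrier A" "t \<in> carrier A" "mult A x t = smul A c x" "n \<noteq> 0"
  shows "mult A x (pw t n) = smul A (c ^ n) x"
  using assms(4)
proof (induction n)
  case (Suc n)
  show ?case
  proof (cases "n = 0")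
    case False
    then have "mult A x (pw t (Suc n)) = mult A (mult A x t) (pw t n)"
      using assms(1,2) by (simp only: pw_Suc[OF False] mult_assoc pw_closed)
    then show ?thesis
      using assms Suc.IH[OF False] by (simp add: mult_smul_left pw_closed)
  qed (use assms in simp)
qed simp

text \<open>Right multiplication by a nilpotent \<open>t\<close> has no eigenvalue other than 0.
  This test for nilpotency is used with eigenvalues 1 and 2.\<close>

lemma mult_nilpotent_eq_0:
  assumes "x \<in> carrier A" "t \<in> carrier A" "mult A x t = smul A c x" "c \<noteq> 0" "n \<noteq> 0" "pw t n = 0"
  shows "x = 0"
  using mult_pw[OF assms(1-3,5)] assms by simp

lemma subspace_mult_image:
  "\<lbrakk>x \<in> carrier A; vs.subspace S; S \<subseteq> carrier A\<rbrakk> \<Longrightarrow> vs.subspace (mult A x ` S)"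
  unfolding vs.subspace_def
  by (auto simp: image_iff subset_iff) (metis mult_zero_right mult_add_right mult_smul_right)+

text \<open>Combined with \<open>span_minimal\<close>, this reduces a condition on products with a
  whole span to the generators.\<close>

lemma subspace_mult_left_preimage:
  "\<lbrakk>x \<in> carrier A; vs.subspace S\<rbrakk> \<Longrightarrow> vs.subspace {y \<in> carrier A. mult A x y \<in> S}"
  unfolding vs.subspace_def by (auto simp: mult_add_right mult_smul_right)

lemma subspace_mult_right_preimage:
  "\<lbrakk>y \<in> carrier A; vs.subspace S\<rbrakk> \<Longrightarrow> vs.subspace {x \<in> carrier A. mult A x y \<in> S}"
  unfolding vs.subspace_def by (auto simp: mult_add_left mult_smul_left)

lemma subspace_mult_right_fixed:
  "y \<in> carrier A \<Longrightarrow> vs.subspace {x \<in> carrier A. mult A x y = x}"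
  unfolding vs.subspace_def by (auto simp: mult_add_left mult_smul_left)

lemma subspace_homog_symmetric: "vs.subspace {x \<in> homog A g. star A x = x}"
  unfolding vs.subspace_def
  by (auto simp: add_homog smul_homog star_add star_smul homog_closed)

lemma word_prod_pairs:
  assumes "length xs = 2 * k" "set xs \<subseteq> S" "S \<subseteq> carrier A"
  shows "\<exists>ys. length ys = k \<and> set ys \<subseteq> {mult A x y | x y. x \<in> S \<and> y \<in> S} \<and>
    word_prod A xs = word_prod A ys"
  using assms(1,2)
proof (induction k arbitrary: xs)
  case (Suc k)
  then obtain x y zs where xs: "xs = x # y # zs" "length zs = 2 * k"
    by (cases xs; cases "tl xs") auto
  then obtain ys where ys: "length ys = k" "set ys \<subseteq> {mult A x y | x y. x \<in> S \<and> y \<in> S}"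
      "word_prod A zs = word_prod A ys"
    using Suc.IH[of zs] Suc.prems by auto
  have c: "x \<in> carrier A" "y \<in> carrier A" "set zs \<subseteq> carrier A"
    using xs(1) Suc.prems(2) assms(3) by auto
  have "word_prod A xs = word_prod A (mult A x y # ys)"
  proof (cases "zs = []")
    case True
    then show ?thesis
      using xs ys(1) by simp
  next
    case False
    then have "ys \<noteq> []"
      using xs(2) ys(1) by auto
    then show ?thesis
      using False c by (simp add: xs(1) word_prod_Cons mult_assoc ys(3)[symmetric])
  qed
  then show ?case
    using ys xs(1) Suc.prems(2) by (intro exI[of _ "mult A x y # ys"]) auto
qed simp

text \<open>A word of length 2k in \<open>S\<close> is a word of length k in products of pairs. Read
  backwards, passing from a non-nilpotent subalgebra to its square keeps it non-nilpotent.\<close>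

lemma nil_set_products:
  assumes "nil_set (vs.span {mult A x y | x y. x \<in> S \<and> y \<in> S})" "S \<subseteq> carrier A"
  shows "nil_set S"
proof -
  obtain k where k: "k \<ge> 1" and 0: "\<And>xs. length xs = k \<and> set xs \<subseteq> vs.span {mult A x y | x y. x \<in> S \<and> y \<in> S}
      \<Longrightarrow> word_prod A xs = 0"
    using assms(1) by (auto simp: nil_set_def)
  have "word_prod A xs = 0" if xs: "length xs = 2 * k" "set xs \<subseteq> S" for xs
  proof -
    obtain ys where "length ys = k" "set ys \<subseteq> {mult A x y | x y. x \<in> S \<and> y \<in> S}"
        "word_prod A xs = word_prod A ys"
      using word_prod_pairs[OF xs assms(2)] by blast
    then show ?thesis
      using 0[of ys] vs.span_superset by fastforce
  qed
  then show ?thesis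
    using k unfolding nil_set_def by (intro exI[of _ "2 * k"]) auto
qed

text \<open>The difference \<open>D\<close> of \<open>et\<close> and \<open>te\<close>, where \<open>t = e + e\<^sup>*\<close>, satisfies \<open>Dt + tD = 2D\<close>; for nilpotent
  \<open>t\<close> this forces \<open>D = 0\<close>, so \<open>e\<close> and \<open>e\<^sup>*\<close> commute.\<close>

lemma idempotent_eq_0_if_nilpotent_trace:
  assumes e: "e \<in> carrier A" "mult A e e = e" and n: "n \<noteq> 0" "pw (e + star A e) n = 0"
  shows "e = 0"
proof -
  define f where "f = star A e"
  define t where "t = e + f"
  have f: "f \<in> carrier A" "mult A f f = f"
    using e star_mult[of e e] by (auto simp: f_def)
  have t: "t \<in> carrier A" "pw t n = 0"
    using e(1) f(1) n(2) by (auto simp: t_def f_def)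
  define D where "D = mult A e t - mult A t e"
  have D: "D = mult A e f - mult A f e"
    using e f by (simp add: D_def t_def mult_add_left mult_add_right)
  have Dc: "D \<in> carrier A"
    using e f by (simp add: D)
  have rel: "mult A D t + mult A t D = D + D"
  proof -
    have a: "mult A e (mult A e x) = mult A e x" "mult A f (mult A f x) = mult A f x"
      if "x \<in> carrier A" for x
      using that e f mult_assoc by metis+
    show ?thesis
      using e f a
      by (simp add: D t_def mult_add_left mult_add_right mult_diff_left mult_diff_right mult_assoc)
  qed
  \<comment> \<open>These are D multiplied i times by t on the left. The relation is inherited, as
    left and right multiplication by t commute. The last nonzero member is killed by t on the left,
    so right multiplication by t doubles it, contradicting nilpotency.\<close>
  define Di where "Di i = ((\<lambda>x. mult A t x) ^^ i) D" for i
  have Di_closed: "Di i \<in> carrier A" for i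
    by (induction i) (auto simp: Di_def Dc t)
  have Di_rel: "mult A (Di i) t + mult A t (Di i) = Di i + Di i" for i
  proof (induction i)
    case (Suc i)
    have S: "Di (Suc i) = mult A t (Di i)"
      by (simp add: Di_def)
    have "mult A (Di (Suc i)) t + mult A t (Di (Suc i)) = mult A t (mult A (Di i) t + mult A t (Di i))"
      using t Di_closed[of i] by (simp add: S mult_add_right mult_assoc)
    also have "\<dots> = Di (Suc i) + Di (Suc i)"
      using t Di_closed[of i] by (simp add: S Suc.IH mult_add_right)
    finally show ?case .
  qed (simp add: Di_def rel)
  have Di_pw: "i \<noteq> 0 \<Longrightarrow> Di i = mult A (pw t i) D" for i
  proof (induction i)
    case (Suc i)
    have S: "Di (Suc i) = mult A t (Di i)"
      by (simp add: Di_def)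
    show ?case
    proof (cases "i = 0")
      case True
      then show ?thesis
        by (simp add: Di_def)
    next
      case False
      then have "Di i = mult A (pw t i) D"
        by (rule Suc.IH)
      then show ?thesis
        using t(1) Dc by (simp only: S pw_Suc[OF False] mult_assoc pw_closed)
    qed
  qed simp
  have two: "x + x = smul A 2 x" for x
    by (metis one_add_one vs.scale_left_distrib vs.scale_one)
  have "D = 0"
  proof (rule ccontr)
    assume "D \<noteq> 0"
    then have D0: "Di 0 \<noteq> 0"
      by (simp add: Di_def)
    have "\<exists>i. Di i = 0"
      using Di_pw[OF n(1)] t(2) Dc by auto
    moreover have "Di i \<noteq> 0" if "\<And>i. Di i \<noteq> 0 \<Longrightarrow> Di (Suc i) \<noteq> 0" for i
      by (induction i) (use D0 that in auto)
    ultimately obtain i where i: "Di i \<noteq> 0" "Di (Suc i) = 0"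
      by blast
    have "mult A t (Di i) = 0"
      using i(2) by (simp add: Di_def)
    then have "mult A (Di i) t = smul A 2 (Di i)"
      using Di_rel[of i] two by simp
    from mult_nilpotent_eq_0[OF Di_closed t(1) this _ n(1) t(2)] i(1) show False
      by simp
  qed
  then have comm: "mult A e f = mult A f e"
    by (simp add: D)
  \<comment> \<open>Now that e and f commute, t doubles e f, hence e f = 0; then e t = e, an
    eigenvector for 1, hence e = 0.\<close>
  have "mult A (mult A e f) t = mult A (mult A e f) e + mult A (mult A e f) f"
    using e f by (simp add: t_def mult_add_right)
  also have "mult A (mult A e f) e = mult A e f"
    using e f comm by (metis mult_assoc)
  also have "mult A (mult A e f) f = mult A e f"
    using e f by (metis mult_assoc)
  finally have "mult A (mult A e f) t = smul A 2 (mult A e f)"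
    using two by simp
  then have "mult A e f = 0"
    using mult_nilpotent_eq_0[OF _ t(1) _ _ n(1) t(2), of "mult A e f" 2] e f by simp
  then have "mult A e t = smul A 1 e"
    using e f by (simp add: t_def mult_add_right)
  then show ?thesis
    using mult_nilpotent_eq_0[OF e(1) t(1) _ _ n(1) t(2), of 1] by simp
qed

text \<open>A minimal non-nilpotent subalgebra S satisfies S^2 = S. A nonzero right ideal x S with x
  in S, of least dimension, then yields a nonzero y with y b = y for some b in S, and the eigenvalue
  1 of right multiplication by b shows that b is not nilpotent.\<close>

lemma non_nilpotent_element:
  assumes fin: "carrier A \<subseteq> vs.span T" "finite T"
    and S0: "vs.subspace S0" "S0 \<subseteq> carrier A" "\<And>x y. \<lbrakk>x \<in> S0; y \<in> S0\<rbrakk> \<Longrightarrow> mult A x y \<in> S0"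
    and "\<not> nil_set S0"
  obtains b where "b \<in> S0" "\<And>n. n \<noteq> 0 \<Longrightarrow> pw b n \<noteq> 0"
proof -
  define P where "P S \<longleftrightarrow> vs.subspace S \<and> S \<subseteq> S0 \<and> (\<forall>x\<in>S. \<forall>y\<in>S. mult A x y \<in> S) \<and> \<not> nil_set S" for S
  have "P S0"
    using assms by (simp add: P_def)
  then obtain S where "P S" and min: "\<And>S'. P S' \<Longrightarrow> vs.dim S \<le> vs.dim S'"
    using ex_has_least_nat[of P S0 vs.dim] by blast
  then have S: "vs.subspace S" "S \<subseteq> S0" "\<And>x y. \<lbrakk>x \<in> S; y \<in> S\<rbrakk> \<Longrightarrow> mult A x y \<in> S" "\<not> nil_set S"
    by (auto simp: P_def)
  have Sc: "S \<subseteq> carrier A"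
    using S(2) S0(2) by blast
  define Q where "Q = {mult A x y | x y. x \<in> S \<and> y \<in> S}"
  have QS: "vs.span Q \<subseteq> S"
    using S(1,3) by (intro vs.span_minimal) (auto simp: Q_def)
  have "P (vs.span Q)"
    unfolding P_def
  proof (intro conjI ballI)
    fix x y assume "x \<in> vs.span Q" "y \<in> vs.span Q"
    then have "mult A x y \<in> Q"
      using QS by (auto simp: Q_def)
    then show "mult A x y \<in> vs.span Q"
      by (rule vs.span_base)
  next
    show "\<not> nil_set (vs.span Q)"
      using nil_set_products[OF _ Sc] S(4) unfolding Q_def by blast
  qed (use QS S(2) in auto)
  then have SQ: "vs.span Q = S"
    using vs.dim_strict_mono[OF vs.subspace_span S(1) _ _ fin(2)] QS min Sc fin(1)
    by (meson leD order_trans psubsetI)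
  have "\<exists>x. x \<in> S \<and> mult A x ` S \<noteq> {0}"
  proof (rule ccontr)
    assume "\<not> ?thesis"
    then have "Q \<subseteq> {0}"
      by (auto simp: Q_def)
    then have "S \<subseteq> {0}"
      using SQ vs.span_minimal[of Q "{0}"] by simp
    then have "word_prod A xs = 0" if "length xs = 1" "set xs \<subseteq> S" for xs
      using that by (cases xs) auto
    then show False
      using S(4) unfolding nil_set_def by blast
  qed
  then obtain x0 where "x0 \<in> S \<and> mult A x0 ` S \<noteq> {0}"
    by blast
  then obtain x where x: "x \<in> S" "mult A x ` S \<noteq> {0}"
    and xmin: "\<And>y. y \<in> S \<and> mult A y ` S \<noteq> {0} \<Longrightarrow> vs.dim (mult A x ` S) \<le> vs.dim (mult A y ` S)"
    using ex_has_least_nat[of "\<lambda>x. x \<in> S \<and> mult A x ` S \<noteq> {0}" x0 "\<lambda>x. vs.dim (mult A x ` S)"]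
    by blast
  have xc: "x \<in> carrier A"
    using x(1) Sc by blast
  \<comment> \<open>Otherwise x annihilates all products of elements of S, hence S^2 = S itself,
    contrary to the choice of x.\<close>
  have "\<exists>a\<in>S. mult A (mult A x a) ` S \<noteq> {0}"
  proof (rule ccontr)
    assume neg: "\<not> ?thesis"
    have 0: "mult A x (mult A a c) = 0" if "a \<in> S" "c \<in> S" for a c
    proof -
      have "mult A (mult A x a) c = 0"
        using neg that by blast
      then show ?thesis
        using that xc Sc mult_assoc by (metis subsetD)
    qed
    then have "Q \<subseteq> {y \<in> carrier A. mult A x y \<in> {0}}"
      using Sc by (auto simp: Q_def subset_iff)
    then have "S \<subseteq> {y \<in> carrier A. mult A x y \<in> {0}}"
      using SQ vs.span_minimal[OF _ subspace_mult_left_preimage[OF xc vs.subspace_single_0]] by blast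
    moreover have "S \<noteq> {}"
      using x(1) by blast
    ultimately have "mult A x ` S = {0}"
      by force
    then show False
      using x(2) by simp
  qed
  then obtain a where a: "a \<in> S" "mult A (mult A x a) ` S \<noteq> {0}"
    by blast
  define y where "y = mult A x a"
  have yS: "y \<in> S" and yc: "y \<in> carrier A"
    using x(1) a(1) S(3) Sc by (auto simp: y_def)
  have sub: "mult A y ` S \<subseteq> mult A x ` S"
  proof
    fix z assume "z \<in> mult A y ` S"
    then obtain s where s: "s \<in> S" "z = mult A y s"
      by blast
    then have "z = mult A x (mult A a s)"
      using xc a(1) Sc by (auto simp: y_def intro: mult_assoc)
    then show "z \<in> mult A x ` S"
      using S(3) a(1) s(1) by blast
  qed
  have "mult A x ` S \<subseteq> vs.span T"
    using S(3)[OF x(1)] Sc fin(1) by blast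
  then have "mult A y ` S = mult A x ` S"
    using vs.dim_strict_mono[OF subspace_mult_image[OF yc S(1) Sc] subspace_mult_image[OF xc S(1) Sc]
        _ _ fin(2)] sub xmin[of y] yS a(2)
    by (metis y_def leD psubsetI)
  \<comment> \<open>The element y = x a lies in x S, which equals y S by minimality.\<close>
  then obtain b where b: "b \<in> S" "mult A y b = y"
    using a(1) unfolding y_def by (metis imageE image_eqI)
  have bc: "b \<in> carrier A"
    using b(1) Sc by blast
  have "y \<noteq> 0"
  proof
    assume "y = 0"
    then have "mult A y ` S = {0}"
      using x(1) Sc by force
    then show False
      using a(2) by (simp add: y_def)
  qed
  then have "pw b n \<noteq> 0" if "n \<noteq> 0" for n
    using mult_nilpotent_eq_0[OF yc bc, of 1 n] b(2) that by auto
  then show ?thesis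
    using that b(1) S(2) by blast
qed

text \<open>A Fitting argument in the non-unital algebra spanned by the powers of b: the spans
  \<open>W m\<close> of the powers from b^m on decrease and stabilize, and where they are stable
  some c acts as a right unit.\<close>

lemma idempotent_in_powers:
  assumes fin: "carrier A \<subseteq> vs.span T" "finite T"
    and b: "b \<in> carrier A" "\<And>n. n \<noteq> 0 \<Longrightarrow> pw b n \<noteq> 0"
  obtains e where "e \<in> vs.span (pw b ` {1..})" "e \<noteq> 0" "mult A e e = e"
proof -
  define W where "W m = vs.span (pw b ` {m..})" for m
  have Wc: "W m \<subseteq> carrier A" for m
    unfolding W_def using b(1) pw_closed by (intro vs.span_minimal subspace_carrier) auto
  have W_mult: "mult A x y \<in> W (i + j)" if "x \<in> W i" "y \<in> W j" "i \<noteq> 0" "j \<noteq> 0" for x y i j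
  proof -
    have gen: "mult A x (pw b l) \<in> W (i + j)" if "l \<ge> j" for l
    proof -
      have "pw b ` {i..} \<subseteq> {x \<in> carrier A. mult A x (pw b l) \<in> W (i + j)}"
      proof clarify
        fix k :: nat
        assume "k \<ge> i"
        then have "mult A (pw b k) (pw b l) = pw b (k + l)"
          using \<open>l \<ge> j\<close> \<open>i \<noteq> 0\<close> \<open>j \<noteq> 0\<close> b(1) by (subst pw_add) auto
        moreover have "pw b (k + l) \<in> W (i + j)"
          unfolding W_def using \<open>k \<ge> i\<close> \<open>l \<ge> j\<close> by (intro vs.span_base) auto
        ultimately show "pw b k \<in> carrier A \<and> mult A (pw b k) (pw b l) \<in> W (i + j)"
          using b(1) pw_closed by auto
      qed
      then have "W i \<subseteq> {x \<in> carrier A. mult A x (pw b l) \<in> W (i + j)}"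
        unfolding W_def[of i] using b(1) pw_closed
        by (intro vs.span_minimal subspace_mult_right_preimage) (auto simp: W_def)
      then show ?thesis
        using \<open>x \<in> W i\<close> by blast
    qed
    have "x \<in> carrier A"
      using \<open>x \<in> W i\<close> Wc by blast
    then have "W j \<subseteq> {y \<in> carrier A. mult A x y \<in> W (i + j)}"
      unfolding W_def[of j] using b(1) pw_closed gen
      by (intro vs.span_minimal subspace_mult_left_preimage) (auto simp: W_def[of "i + j"])
    then show ?thesis
      using \<open>y \<in> W j\<close> by blast
  qed
  obtain m where m: "m \<noteq> 0" and min: "\<And>i. i \<noteq> 0 \<Longrightarrow> vs.dim (W m) \<le> vs.dim (W i)"
    using ex_has_least_nat[of "\<lambda>i. i \<noteq> 0" 1 "\<lambda>i. vs.dim (W i)"] by auto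
  have "W (Suc m) \<subseteq> W m"
    unfolding W_def by (intro vs.span_mono image_mono) auto
  moreover have "\<not> W (Suc m) \<subset> W m"
    using vs.dim_strict_mono[of "W (Suc m)" "W m" T] min[of "Suc m"] Wc[of m] fin
    by (force simp: W_def)
  ultimately have WSuc: "W (Suc m) = W m"
    by blast
  have "pw b m \<in> W m"
    unfolding W_def by (intro vs.span_base) auto
  \<comment> \<open>Passing from \<open>W m\<close> to the equal space \<open>W (Suc m)\<close>
    leaves a positive exponent after b^m is split off; an exponent 0 would call for a unit.\<close>
  also have "W m \<subseteq> mult A (pw b m) ` W 1"
    unfolding WSuc[symmetric] W_def[of "Suc m"]
  proof (rule vs.span_minimal)
    show "vs.subspace (mult A (pw b m) ` W 1)"
      using b(1) Wc by (intro subspace_mult_image pw_closed) (auto simp: W_def)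
    show "pw b ` {Suc m..} \<subseteq> mult A (pw b m) ` W 1"
    proof clarify
      fix k assume "Suc m \<le> k"
      then have "pw b k = mult A (pw b m) (pw b (k - m))"
        using b(1) m by (subst pw_add[symmetric]) auto
      moreover have "pw b (k - m) \<in> W 1"
        unfolding W_def using \<open>Suc m \<le> k\<close> by (intro vs.span_base) auto
      ultimately show "pw b k \<in> mult A (pw b m) ` W 1"
        by blast
    qed
  qed
  finally obtain c where c: "c \<in> W 1" "mult A (pw b m) c = pw b m"
    by fastforce
  have cc: "c \<in> carrier A"
    using c(1) Wc by blast
  \<comment> \<open>The exponent m puts e into \<open>W m\<close>, where right multiplication by c
    is the identity; so e e = e c^m = e.\<close>
  define e where "e = pw c m"
  have cn: "pw c n \<in> W n" if "n \<noteq> 0" for n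
    using that
  proof (induction n)
    case (Suc n)
    show ?case
    proof (cases "n = 0")
      case False
      then show ?thesis
        using c(1) W_mult[of c 1 "pw c n" n] Suc.IH by (simp add: word_prod_Cons)
    qed (use c(1) in simp)
  qed simp
  have e: "e \<in> W m" "e \<in> carrier A"
    using cn[OF m] Wc by (auto simp: e_def)
  have "W m \<subseteq> {x \<in> carrier A. mult A x c = x}"
    unfolding W_def
  proof (rule vs.span_minimal[OF _ subspace_mult_right_fixed[OF cc]], clarify)
    fix k assume "k \<ge> m"
    have "mult A (pw b k) c = pw b k"
    proof (cases "k = m")
      case False
      then have k: "pw b k = mult A (pw b (k - m)) (pw b m)"
        using b(1) m \<open>k \<ge> m\<close> by (subst pw_add[symmetric]) auto
      then show ?thesis
        using b(1) cc c(2) by (simp only: k mult_assoc pw_closed)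
    qed (use c(2) in simp)
    then show "pw b k \<in> carrier A \<and> mult A (pw b k) c = pw b k"
      using b(1) pw_closed by simp
  qed
  then have "mult A e c = smul A 1 e"
    using e(1) by auto
  then have "mult A e e = e"
    using mult_pw[OF e(2) cc _ m, of 1] by (simp add: e_def)
  moreover have "mult A (pw b m) e = pw b m"
    using mult_pw[OF pw_closed[OF b(1)] cc _ m, of _ 1] c(2) by (simp add: e_def)
  then have "e \<noteq> 0"
    using b(1) b(2)[OF m] pw_closed by auto
  moreover have "W m \<subseteq> vs.span (pw b ` {1..})"
    unfolding W_def using m by (intro vs.span_mono image_mono) auto
  ultimately show ?thesis
    using that e(1) by blast
qed

lemma symmetric_idempotent_exists:
  assumes fin: "carrier A \<subseteq> vs.span T" "finite T" and "\<not> nil_set (homog A 0)"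
  obtains e where "e \<in> homog A 0" "star A e = e" "e \<noteq> 0" "mult A e e = e"
proof -
  have pw_homog: "pw x n \<in> homog A 0" if "x \<in> homog A 0" for x n
  proof -
    have "sum_list (replicate n (0::'g)) = 0"
      by (induction n) auto
    then show ?thesis
      using word_prod_homog[of "replicate n x" "replicate n 0"] that
      by (simp add: list_all2_conv_all_nth)
  qed
  obtain b where b: "b \<in> homog A 0" "\<And>n. n \<noteq> 0 \<Longrightarrow> pw b n \<noteq> 0"
    using non_nilpotent_element[OF fin subspace_homog homog_subset _ assms(3)] homog_mult[of _ 0 _ 0]
    by auto
  obtain e where e: "e \<in> vs.span (pw b ` {1..})" "e \<noteq> 0" "mult A e e = e"
    using idempotent_in_powers[OF fin homog_closed[OF b(1)] b(2)] by blast
  have "vs.span (pw b ` {1..}) \<subseteq> homog A 0"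
    using b(1) pw_homog by (intro vs.span_minimal subspace_homog) auto
  then have e0: "e \<in> homog A 0" and ec: "e \<in> carrier A"
    using e(1) homog_closed by auto
  define t where "t = e + star A e"
  have t: "t \<in> homog A 0" "star A t = t"
    using e0 ec by (auto simp: t_def add_homog star_in_homog star_add star_star add.commute)
  have "pw t n \<noteq> 0" if "n \<noteq> 0" for n
    using idempotent_eq_0_if_nilpotent_trace[OF ec e(3) that] e(2) by (auto simp: t_def)
  then obtain f where f: "f \<in> vs.span (pw t ` {1..})" "f \<noteq> 0" "mult A f f = f"
    using idempotent_in_powers[OF fin homog_closed[OF t(1)]] by blast
  \<comment> \<open>The involution reverses products, which is harmless for powers of a single
    symmetric element.\<close>
  have star_pw: "star A (pw t n) = pw t n" for n
  proof (induction n)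
    case (Suc n)
    show ?case
    proof (cases "n = 0")
      case False
      have tc: "t \<in> carrier A"
        using t(1) by (rule homog_closed)
      have "star A (pw t (Suc n)) = mult A (pw t n) (pw t 1)"
        unfolding pw_Suc[OF False] using t(2) tc Suc.IH by (simp add: star_mult pw_closed)
      also have "\<dots> = pw t (Suc n)"
        using pw_add[OF tc False one_neq_zero] by simp
      finally show ?thesis .
    qed (use t in simp)
  qed simp
  have "vs.span (pw t ` {1..}) \<subseteq> {x \<in> homog A 0. star A x = x}"
    using t(1) pw_homog star_pw by (intro vs.span_minimal subspace_homog_symmetric) auto
  then show ?thesis
    using that f by blast
qed

end

section \<open>Prefix sums of words in a finite group\<close>

definition prefix_count :: "'g::monoid_add \<Rightarrow> 'g list \<Rightarrow> nat" where
  "prefix_count h gs = card {i. i \<le> length gs \<and> sum_list (take i gs) = h}"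

lemma prefix_count_snoc:
  "prefix_count h (gs @ [g]) = prefix_count h gs + (if sum_list (gs @ [g]) = h then 1 else 0)"
proof -
  let ?S = "{i. i \<le> length gs \<and> sum_list (take i gs) = h}"
  have "{i. i \<le> length (gs @ [g]) \<and> sum_list (take i (gs @ [g])) = h} =
      (if sum_list (gs @ [g]) = h then insert (Suc (length gs)) ?S else ?S)"
    by (auto simp: le_Suc_eq)
  then show ?thesis
    by (auto simp: prefix_count_def)
qed

text \<open>Cut positions run from 0 to the length, both included. This one extra position is why
  length d |G| already forces more than d equal prefix sums, hence at least d blocks between
  successive cuts.\<close>

lemma prefix_count_pigeonhole:
  fixes gs :: "'g::{finite,monoid_add} list"
  assumes "length gs \<ge> d * CARD('g)"
  obtains h where "prefix_count h gs > d"
proof -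
  have "(\<Union>h. {i. i \<le> length gs \<and> sum_list (take i gs) = h}) = {..length gs}"
    by auto
  then have "Suc (length gs) \<le> (\<Sum>h\<in>UNIV. prefix_count h gs)"
    using card_UN_le[of UNIV "\<lambda>h. {i. i \<le> length gs \<and> sum_list (take i gs) = h}"]
    by (simp add: prefix_count_def)
  moreover have "(\<Sum>h\<in>UNIV. prefix_count h gs) \<le> d * CARD('g)" if "\<And>h. prefix_count h gs \<le> d"
    using sum_bounded_above[of UNIV "\<lambda>h. prefix_count h gs" d] that by (simp add: mult.commute)
  ultimately show ?thesis
    using that assms by (metis Suc_n_not_le_n le_trans not_le)
qed

text \<open>Between two cuts with the same prefix sum the letters add up to 0. The induction appends
  letters on the right; \<open>rs\<close> is the unfinished block after the last cut, and it is
  closed as soon as the prefix sum returns to \<open>h\<close>.\<close>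

lemma split_at_prefix_sum:
  fixes zs :: "('a \<times> 'g::group_add) list"
  assumes "prefix_count h (map snd zs) = Suc m"
  shows "\<exists>us bs rs. zs = us @ concat bs @ rs \<and> length bs = m \<and> sum_list (map snd us) = h \<and>
    (\<forall>b\<in>set bs. b \<noteq> [] \<and> sum_list (map snd b) = 0)"
  using assms
proof (induction zs arbitrary: m rule: rev_induct)
  case Nil
  then have "h = 0 \<and> m = 0"
    by (cases "h = 0") (auto simp: prefix_count_def)
  then show ?case
    by (intro exI[of _ "[]"]) auto
next
  case (snoc z zs)
  let ?s = "sum_list (map snd (zs @ [z]))"
  have split: "prefix_count h (map snd (zs @ [z])) =
      prefix_count h (map snd zs) + (if ?s = h then 1 else 0)"
    using prefix_count_snoc[of h "map snd zs" "snd z"] by simp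
  show ?case
  proof (cases "?s = h")
    case False
    then have "prefix_count h (map snd zs) = Suc m"
      using split snoc.prems by simp
    from snoc.IH[OF this] obtain us bs rs where "zs = us @ concat bs @ rs" "length bs = m"
        "sum_list (map snd us) = h" "\<forall>b\<in>set bs. b \<noteq> [] \<and> sum_list (map snd b) = 0"
      by blast
    then show ?thesis
      by (intro exI[of _ us] exI[of _ bs] exI[of _ "rs @ [z]"]) simp
  next
    case True
    then have cnt: "prefix_count h (map snd zs) = m"
      using split snoc.prems by simp
    show ?thesis
    proof (cases m)
      case 0
      then show ?thesis
        using True by (intro exI[of _ "zs @ [z]"] exI[of _ "[]"]) simp
    next
      case (Suc k)
      with cnt snoc.IH[of k] obtain us bs rs where IH: "zs = us @ concat bs @ rs" "length bs = k"
          "sum_list (map snd us) = h" "\<forall>b\<in>set bs. b \<noteq> [] \<and> sum_list (map snd b) = 0"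
        by blast
      have "sum_list (map snd (concat bs)) = 0"
        using IH(4) by (induction bs) auto
      then have "sum_list (map snd (rs @ [z])) = 0"
        using True IH(1,3) add_left_cancel[of h _ 0] by (simp add: add.assoc)
      then show ?thesis
        using IH Suc by (intro exI[of _ us] exI[of _ "bs @ [rs @ [z]]"] exI[of _ "[]"]) auto
    qed
  qed
qed

context gs_algebra
begin

text \<open>Among the prefixes of a long word of homogeneous elements, many have the same degree; they
  cut out consecutive factors of degree \<open>0\<close>.\<close>

lemma nilpotent_if_homog_0_nil:
  assumes "nil_set (homog A 0)"
  shows "nilpotent_alg A"
proof -
  obtain d where d: "d \<ge> 1" and zero: "\<And>xs. \<lbrakk>length xs \<ge> d; set xs \<subseteq> homog A 0\<rbrakk> \<Longrightarrow> word_prod A xs = 0"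
    using nil_set_word_prod[OF assms homog_subset] by blast
  define n where "n = d * CARD('g)"
  have homog_zero: "word_prod A (map fst zs) = 0"
    if zs: "\<And>x g. (x, g) \<in> set zs \<Longrightarrow> x \<in> homog A g" and len: "length zs = n" for zs
  proof -
    obtain h where "prefix_count h (map snd zs) > d"
      using prefix_count_pigeonhole[of d "map snd zs"] len by (auto simp: n_def)
    then obtain m where m: "prefix_count h (map snd zs) = Suc m" "m \<ge> d"
      by (cases "prefix_count h (map snd zs)") auto
    obtain us bs rs where split: "zs = us @ concat bs @ rs" "length bs = m"
        "\<forall>b\<in>set bs. b \<noteq> [] \<and> sum_list (map snd b) = 0"
      using split_at_prefix_sum[OF m(1)] by blast
    have c: "x \<in> carrier A" if "(x, g) \<in> set zs" for x g
      using zs[OF that] by (rule homog_closed)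
    have sub: "set b \<subseteq> set zs" if "b \<in> set bs" for b
      using that split(1) by auto
    have "word_prod A (map fst b) \<in> homog A 0" if b: "b \<in> set bs" for b
    proof -
      have "list_all2 (\<lambda>x g. x \<in> homog A g) (map fst b) (map snd b)"
        using zs sub[OF b] by (auto simp: list_all2_conv_all_nth intro!: zs subsetD[OF sub[OF b] nth_mem])
      then show ?thesis
        using word_prod_homog split(3) b by fastforce
    qed
    then have "word_prod A (map (word_prod A) (map (map fst) bs)) = 0"
      using split(2) m(2) by (intro zero) auto
    moreover have "word_prod A (concat (map (map fst) bs)) =
        word_prod A (map (word_prod A) (map (map fst) bs))"
      using split(3) sub c by (intro word_prod_concat) fastforce
    ultimately have "word_prod A (map fst (concat bs)) = 0"
      by (simp add: map_concat)
    moreover have "bs \<noteq> []"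
      using split(2) m(2) d by auto
    then have "concat bs \<noteq> []"
      using split(3) by (cases bs) auto
    moreover have "set (map fst us) \<subseteq> carrier A" "set (map fst (concat bs)) \<subseteq> carrier A"
        "set (map fst rs) \<subseteq> carrier A"
      using c by (fastforce simp: split(1))+
    ultimately show ?thesis
      using word_prod_infix_zero[of "map fst us" "map fst (concat bs)" "map fst rs"]
      by (simp add: split(1))
  qed
  \<comment> \<open>Arbitrary letters are resolved into homogeneous ones from right to left:
    \<open>us\<close> is the part still arbitrary, \<open>zs\<close> the part already
    homogeneous.\<close>
  have "word_prod A (us @ map fst zs) = 0"
    if "set us \<subseteq> carrier A" "\<And>x g. (x, g) \<in> set zs \<Longrightarrow> x \<in> homog A g" "length us + length zs = n" for us zs
    using that
  proof (induction us arbitrary: zs rule: rev_induct)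
    case (snoc x us)
    obtain c where c: "\<And>g. c g \<in> homog A g" "x = (\<Sum>g\<in>UNIV. c g)"
      using homog_decomp[of x] snoc.prems(1) by auto
    have "word_prod A (us @ map fst ((c g, g) # zs)) = 0" for g
      using snoc.prems c(1) by (intro snoc.IH) auto
    then have "(\<Sum>g\<in>UNIV. word_prod A (us @ c g # map fst zs)) = 0"
      by simp
    moreover have "set (map fst zs) \<subseteq> carrier A"
      using homog_closed[OF snoc.prems(2)] by auto
    ultimately show ?case
      using snoc.prems(1) c homog_closed[OF c(1)] word_prod_sum_slot[of us "map fst zs" UNIV c] by simp
  qed (use homog_zero in simp)
  from this[of _ "[]"] have "word_prod A xs = 0" if "length xs = n" "set xs \<subseteq> carrier A" for xs
    using that by simp
  moreover have "n \<ge> 1"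
    using d by (simp add: n_def Suc_leI)
  ultimately show ?thesis
    unfolding nilpotent_alg_def by blast
qed

end

section \<open>First-order embeddings\<close>

context gs_algebra
begin

text \<open>A polynomial function of a scalar with coefficient sequence \<open>v\<close>. The
  expansion is required for every \<open>m \<ge> n\<close>, so that the bounds of several functions
  can be raised to a common one.\<close>

definition poly_fun :: "('f \<Rightarrow> 'a) \<Rightarrow> (nat \<Rightarrow> 'a) \<Rightarrow> bool" where
  "poly_fun h v \<longleftrightarrow> (\<forall>k. v k \<in> carrier A) \<and>
     (\<exists>n. \<forall>m\<ge>n. \<forall>s. h s = (\<Sum>k\<le>m. smul A (s ^ k) (v k)))"

text \<open>In place of a Vandermonde determinant: h(2s) - 2^(n+1) h(s) loses its top coefficient
  and multiplies the k-th one by 2^k - 2^(n+1), which is nonzero in characteristic 0.\<close>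

lemma poly_coeffs_eq_0:
  assumes "\<And>s. (\<Sum>k\<le>n. smul A (s ^ k) (v k)) = 0" "k \<le> n"
  shows "v k = 0"
  using assms
proof (induction n arbitrary: v k)
  case 0
  then show ?case
    by simp
next
  case (Suc n)
  have low: "v k = 0" if "k \<le> n" for k
  proof -
    have "(\<Sum>k\<le>n. smul A (s ^ k) (smul A (2 ^ k - 2 ^ Suc n) (v k))) = 0" for s
    proof -
      have "(\<Sum>k\<le>n. smul A (s ^ k) (smul A (2 ^ k - 2 ^ Suc n) (v k))) =
          (\<Sum>k\<le>Suc n. smul A (s ^ k) (smul A (2 ^ k - 2 ^ Suc n) (v k)))"
        by simp
      also have "\<dots> = (\<Sum>k\<le>Suc n. smul A ((2 * s) ^ k) (v k) - smul A (2 ^ Suc n) (smul A (s ^ k) (v k)))"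
        by (intro sum.cong) (simp_all add: power_mult_distrib algebra_simps vs.scale_left_diff_distrib)
      also have "\<dots> = (\<Sum>k\<le>Suc n. smul A ((2 * s) ^ k) (v k)) -
          smul A (2 ^ Suc n) (\<Sum>k\<le>Suc n. smul A (s ^ k) (v k))"
        by (simp only: sum_subtractf vs.scale_sum_right)
      also have "\<dots> = 0"
        unfolding Suc.prems(1) by simp
      finally show ?thesis .
    qed
    then have "smul A (2 ^ k - 2 ^ Suc n) (v k) = 0"
      using Suc.IH[of "\<lambda>k. smul A (2 ^ k - 2 ^ Suc n) (v k)" k] that by simp
    moreover have "(2::'f) ^ k \<noteq> 2 ^ Suc n"
    proof
      assume "(2::'f) ^ k = 2 ^ Suc n"
      then have "of_nat (2 ^ k) = (of_nat (2 ^ Suc n) :: 'f)"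
        by simp
      then have "(2::nat) ^ k = 2 ^ Suc n"
        by (simp only: of_nat_eq_iff)
      then show False
        using that by (simp del: power_Suc)
    qed
    ultimately show ?thesis
      by simp
  qed
  then have "(\<Sum>k\<le>n. smul A (1 ^ k) (v k)) = 0"
    by simp
  then have "v (Suc n) = 0"
    using Suc.prems(1)[of 1] by simp
  then show ?case
    using low Suc.prems(2) by (cases "k = Suc n") auto
qed

lemma poly_fun_eq_0:
  assumes "poly_fun h v" "\<And>s. h s = 0"
  shows "v k = 0"
proof -
  obtain n where n: "\<And>m s. m \<ge> n \<Longrightarrow> h s = (\<Sum>k\<le>m. smul A (s ^ k) (v k))"
    using assms(1) by (auto simp: poly_fun_def)
  have "(\<Sum>k\<le>n + k. smul A (s ^ k) (v k)) = 0" for s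
    using n[of "n + k" s] assms(2) by simp
  then show ?thesis
    by (rule poly_coeffs_eq_0) simp
qed

lemma poly_fun_zero: "poly_fun (\<lambda>s. 0) (\<lambda>k. 0)"
  by (simp add: poly_fun_def)

lemma poly_fun_add:
  assumes "poly_fun h v" "poly_fun h' v'"
  shows "poly_fun (\<lambda>s. h s + h' s) (\<lambda>k. v k + v' k)"
proof -
  obtain n n' where "\<forall>m\<ge>n. \<forall>s. h s = (\<Sum>k\<le>m. smul A (s ^ k) (v k))"
      "\<forall>m\<ge>n'. \<forall>s. h' s = (\<Sum>k\<le>m. smul A (s ^ k) (v' k))"
    using assms unfolding poly_fun_def by blast
  then have "\<forall>m\<ge>max n n'. \<forall>s. h s + h' s = (\<Sum>k\<le>m. smul A (s ^ k) (v k + v' k))"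
    by (auto simp: vs.scale_right_distrib sum.distrib)
  then show ?thesis
    using assms unfolding poly_fun_def by (intro conjI exI[of _ "max n n'"]) auto
qed

lemma poly_fun_scale:
  assumes "poly_fun h v"
  shows "poly_fun (\<lambda>s. smul A c (h s)) (\<lambda>k. smul A c (v k))"
proof -
  obtain n where n: "\<forall>m\<ge>n. \<forall>s. h s = (\<Sum>k\<le>m. smul A (s ^ k) (v k))"
    using assms unfolding poly_fun_def by blast
  have "\<forall>m\<ge>n. \<forall>s. smul A c (h s) = (\<Sum>k\<le>m. smul A (s ^ k) (smul A c (v k)))"
    using n by (metis (no_types, lifting) vs.scale_sum_right vs.scale_left_commute sum.cong)
  then show ?thesis
    using assms unfolding poly_fun_def by auto
qed

lemma poly_fun_sum:
  assumes "finite I" "\<And>i. i \<in> I \<Longrightarrow> poly_fun (h i) (v i)"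
  shows "poly_fun (\<lambda>s. \<Sum>i\<in>I. h i s) (\<lambda>k. \<Sum>i\<in>I. v i k)"
  using assms by (induction I rule: finite_induct) (simp_all add: poly_fun_zero poly_fun_add)

lemma poly_fun_linear:
  assumes "p \<in> carrier A" "q \<in> carrier A"
  shows "poly_fun (\<lambda>s. p + smul A s q) (\<lambda>k. if k = 0 then p else if k = 1 then q else 0)"
proof -
  have "p + smul A s q = (\<Sum>k\<le>m. smul A (s ^ k) (if k = 0 then p else if k = 1 then q else 0))"
    if m: "m \<ge> 1" for m s
  proof -
    have "(\<Sum>k\<le>m. smul A (s ^ k) (if k = 0 then p else if k = 1 then q else 0)) =
        (\<Sum>k\<in>{0, 1}. smul A (s ^ k) (if k = 0 then p else q))"
      using m by (intro sum.mono_neutral_cong_right) auto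
    then show ?thesis
      by simp
  qed
  then show ?thesis
    using assms unfolding poly_fun_def by (intro conjI exI[of _ 1]) auto
qed

lemma poly_fun_mult_linear:
  assumes "poly_fun h v" "p \<in> carrier A" "q \<in> carrier A"
  shows "poly_fun (\<lambda>s. mult A (p + smul A s q) (h s))
    (\<lambda>k. mult A p (v k) + (if k = 0 then 0 else mult A q (v (k - 1))))"
    (is "poly_fun ?h ?v")
proof -
  obtain n where n: "\<And>m s. m \<ge> n \<Longrightarrow> h s = (\<Sum>k\<le>m. smul A (s ^ k) (v k))"
    using assms(1) unfolding poly_fun_def by blast
  have v: "v k \<in> carrier A" for k
    using assms(1) by (simp add: poly_fun_def)
  have "?h s = (\<Sum>k\<le>m. smul A (s ^ k) (?v k))" if m: "m \<ge> Suc n" for m s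
  proof -
    \<comment> \<open>The linear factor raises the degree by one, so \<open>h\<close> is expanded up
      to \<open>Suc l\<close> for \<open>p\<close> but only up to \<open>l\<close> for
      \<open>q\<close>.\<close>
    obtain l where l: "m = Suc l" "l \<ge> n"
      using m by (cases m) auto
    have c: "(\<Sum>k\<le>j. smul A (s ^ k) (v k)) \<in> carrier A" for j
      using v by (intro sum_closed smul_closed)
    have "h s \<in> carrier A"
      using n[of n s] c by simp
    then have "?h s = mult A p (h s) + smul A s (mult A q (h s))"
      using assms(2,3) by (simp add: mult_add_left mult_smul_left)
    also have "mult A p (h s) = (\<Sum>k\<le>Suc l. smul A (s ^ k) (mult A p (v k)))"
      using l assms(2) v by (subst n[of "Suc l"]) (simp_all add: mult_sum_right mult_smul_right del: sum.atMost_Suc)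
    also have "mult A q (h s) = (\<Sum>k\<le>l. smul A (s ^ k) (mult A q (v k)))"
      using l assms(3) v by (subst n[of l]) (simp_all add: mult_sum_right mult_smul_right)
    also have "smul A s (\<Sum>k\<le>l. smul A (s ^ k) (mult A q (v k))) =
        (\<Sum>k\<le>l. smul A (s ^ Suc k) (mult A q (v k)))"
      by (simp add: vs.scale_sum_right)
    finally show ?thesis
      unfolding l(1) sum.atMost_Suc_shift
      by (simp add: vs.scale_right_distrib sum.distrib add.assoc)
  qed
  then show ?thesis
    using v assms(2,3) unfolding poly_fun_def by (intro conjI) auto
qed

end

text \<open>Every element is a sum of homogeneous ones, so a degree-preserving additive map has its
  values in the carrier. Embeddings therefore need to be checked on homogeneous elements
  only.\<close>

lemma graded_additive_closed:
  fixes A :: "('f::field_char_0, 'g::{finite,ab_group_add}, 'a::ab_group_add) gs_alg"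
    and X :: "('f, 'g, 'b::ab_group_add) gs_alg"
  assumes "gs_algebra A" "gs_algebra X"
    and add: "\<And>x y. \<lbrakk>x \<in> carrier X; y \<in> carrier X\<rbrakk> \<Longrightarrow> \<Phi> (x + y) = \<Phi> x + \<Phi> y"
    and homog: "\<And>g x. x \<in> homog X g \<Longrightarrow> \<Phi> x \<in> homog A g"
    and x: "x \<in> carrier X"
  shows "\<Phi> x \<in> carrier A"
proof -
  interpret A: gs_algebra A by fact
  interpret X: gs_algebra X by fact
  obtain c where c: "\<And>g. c g \<in> homog X g" "x = (\<Sum>g\<in>UNIV. c g)"
    using X.homog_decomp[OF x] by blast
  have zero: "\<Phi> 0 = 0"
    using add[of 0 0] by simp
  have "\<Phi> (\<Sum>g\<in>I. c g) = (\<Sum>g\<in>I. \<Phi> (c g))" if "finite I" for I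
    using that
  proof (induction I rule: finite_induct)
    case (insert g I)
    have "(\<Sum>g\<in>I. c g) \<in> carrier X"
      using c(1) by (intro X.sum_closed X.homog_closed)
    then show ?case
      using insert add[OF X.homog_closed[OF c(1)]] by simp
  qed (simp add: zero)
  moreover have "(\<Sum>g\<in>UNIV. \<Phi> (c g)) \<in> carrier A"
    using homog[OF c(1)] by (intro A.sum_closed A.homog_closed)
  ultimately show ?thesis
    by (simp add: c(2))
qed

text \<open>The pair \<open>(\<Phi>\<^sub>0, \<Phi>\<^sub>1)\<close> encodes an embedding \<open>\<Phi>\<^sub>0 + s \<Phi>\<^sub>1\<close> of \<open>X\<close> into \<open>A[s]/(s\<^sup>2)\<close>.\<close>

locale first_order_embedding = A: gs_algebra A + X: gs_algebra X
  for A :: "('f::field_char_0, 'g::{finite,ab_group_add}, 'a::ab_group_add) gs_alg"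
    and X :: "('f, 'g, 'b::ab_group_add) gs_alg" +
  fixes \<Phi>\<^sub>0 \<Phi>\<^sub>1 :: "'b \<Rightarrow> 'a"
  assumes add0: "\<lbrakk>x \<in> carrier X; y \<in> carrier X\<rbrakk> \<Longrightarrow> \<Phi>\<^sub>0 (x + y) = \<Phi>\<^sub>0 x + \<Phi>\<^sub>0 y"
    and add1: "\<lbrakk>x \<in> carrier X; y \<in> carrier X\<rbrakk> \<Longrightarrow> \<Phi>\<^sub>1 (x + y) = \<Phi>\<^sub>1 x + \<Phi>\<^sub>1 y"
    and smul0: "x \<in> carrier X \<Longrightarrow> \<Phi>\<^sub>0 (smul X c x) = smul A c (\<Phi>\<^sub>0 x)"
    and smul1: "x \<in> carrier X \<Longrightarrow> \<Phi>\<^sub>1 (smul X c x) = smul A c (\<Phi>\<^sub>1 x)"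
    and mult0: "\<lbrakk>x \<in> carrier X; y \<in> carrier X\<rbrakk> \<Longrightarrow> \<Phi>\<^sub>0 (mult X x y) = mult A (\<Phi>\<^sub>0 x) (\<Phi>\<^sub>0 y)"
    and mult1: "\<lbrakk>x \<in> carrier X; y \<in> carrier X\<rbrakk>
      \<Longrightarrow> \<Phi>\<^sub>1 (mult X x y) = mult A (\<Phi>\<^sub>0 x) (\<Phi>\<^sub>1 y) + mult A (\<Phi>\<^sub>1 x) (\<Phi>\<^sub>0 y)"
    and star0: "x \<in> carrier X \<Longrightarrow> \<Phi>\<^sub>0 (star X x) = star A (\<Phi>\<^sub>0 x)"
    and star1: "x \<in> carrier X \<Longrightarrow> \<Phi>\<^sub>1 (star X x) = star A (\<Phi>\<^sub>1 x)"
    and homog0: "x \<in> homog X g \<Longrightarrow> \<Phi>\<^sub>0 x \<in> homog A g"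
    and homog1: "x \<in> homog X g \<Longrightarrow> \<Phi>\<^sub>1 x \<in> homog A g"
    and kernel: "\<lbrakk>x \<in> carrier X; \<Phi>\<^sub>0 x = 0; \<Phi>\<^sub>1 x = 0\<rbrakk> \<Longrightarrow> x = 0"
begin

lemma closed0: "x \<in> carrier X \<Longrightarrow> \<Phi>\<^sub>0 x \<in> carrier A"
  by (rule graded_additive_closed[OF A.gs_algebra_axioms X.gs_algebra_axioms add0 homog0])

lemma closed1: "x \<in> carrier X \<Longrightarrow> \<Phi>\<^sub>1 x \<in> carrier A"
  by (rule graded_additive_closed[OF A.gs_algebra_axioms X.gs_algebra_axioms add1 homog1])

lemma zero0: "\<Phi>\<^sub>0 0 = 0" and zero1: "\<Phi>\<^sub>1 0 = 0"
  using add0[of 0 0] add1[of 0 0] by simp_all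

text \<open>Degree and parity are preserved, so \<open>\<Phi>\<^sub>0 x + s \<Phi>\<^sub>1 x\<close>
  is an admissible value for a variable in \<open>A\<close>, for every scalar s.\<close>

lemma homog_part_image:
  assumes "x \<in> homog_part X v"
  shows "\<Phi>\<^sub>0 x \<in> homog_part A v" "\<Phi>\<^sub>1 x \<in> homog_part A v"
proof -
  have neg: "\<Phi>\<^sub>0 (- x) = - \<Phi>\<^sub>0 x" "\<Phi>\<^sub>1 (- x) = - \<Phi>\<^sub>1 x" if "x \<in> carrier X" for x
    using add0[of x "- x"] add1[of x "- x"] that
    by (simp_all add: zero0 zero1 eq_neg_iff_add_eq_0 add.commute)
  obtain g p where v: "v = (g, p)"
    by (cases v)
  have "x \<in> homog X g" "x \<in> carrier X"
    using assms X.homog_closed by (cases p; force simp: v homog_part_def)+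
  then show "\<Phi>\<^sub>0 x \<in> homog_part A v" "\<Phi>\<^sub>1 x \<in> homog_part A v"
    using assms homog0 homog1 star0[of x] star1[of x] neg[of x]
    by (cases p; auto simp: v homog_part_def)+
qed

text \<open>Multiplicativity modulo s^2. The coefficients from s^2 on stay unspecified; they hold
  the products of radical elements, which need not vanish in \<open>A\<close>.\<close>

lemma word_prod_first_order:
  assumes "set xs \<subseteq> carrier X"
  shows "\<exists>v. A.poly_fun (\<lambda>s. word_prod A (map (\<lambda>x. \<Phi>\<^sub>0 x + smul A s (\<Phi>\<^sub>1 x)) xs)) v \<and>
    v 0 = \<Phi>\<^sub>0 (word_prod X xs) \<and> v 1 = \<Phi>\<^sub>1 (word_prod X xs)"
  using assms
proof (induction xs)
  case Nil
  show ?case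
    using A.poly_fun_zero by (auto simp: zero0 zero1 intro!: exI[of _ "\<lambda>_. 0"])
next
  case (Cons x xs)
  have x: "\<Phi>\<^sub>0 x \<in> carrier A" "\<Phi>\<^sub>1 x \<in> carrier A" "x \<in> carrier X" "word_prod X xs \<in> carrier X"
    using Cons.prems closed0 closed1 by auto
  show ?case
  proof (cases "xs = []")
    case True
    then show ?thesis
      using A.poly_fun_linear[OF x(1,2)] by fastforce
  next
    case False
    obtain v where v: "A.poly_fun (\<lambda>s. word_prod A (map (\<lambda>x. \<Phi>\<^sub>0 x + smul A s (\<Phi>\<^sub>1 x)) xs)) v"
        "v 0 = \<Phi>\<^sub>0 (word_prod X xs)" "v 1 = \<Phi>\<^sub>1 (word_prod X xs)"
      using Cons by auto
    show ?thesis
      using A.poly_fun_mult_linear[OF v(1) x(1,2)] v(2,3) False x(3,4)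
      by (auto simp: word_prod_Cons mult0 mult1 intro!: exI)
  qed
qed

theorem identities_subset: "identities A \<subseteq> identities X"
proof
  fix p assume p: "p \<in> identities A"
  show "p \<in> identities X"
  proof (rule identitiesI[OF identities_no_empty_word[OF p]])
    fix \<phi> :: "'g var \<Rightarrow> 'b"
    assume \<phi>: "\<And>i v. \<phi> (i, v) \<in> homog_part X v"
    have c: "\<phi> x \<in> carrier X" for x
      using X.homog_part_closed[OF \<phi>] by (cases x) blast
    define \<psi> where "\<psi> s x = \<Phi>\<^sub>0 (\<phi> x) + smul A s (\<Phi>\<^sub>1 (\<phi> x))" for s x
    have zero: "poly_eval A (\<psi> s) p = 0" for s
      using p \<phi> by (intro identitiesD[OF p])
        (auto simp: \<psi>_def intro!: A.add_homog_part A.smul_homog_part homog_part_image)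
    have "\<exists>v. A.poly_fun (\<lambda>s. word_prod A (map (\<psi> s) w)) v \<and>
        v 0 = \<Phi>\<^sub>0 (word_prod X (map \<phi> w)) \<and> v 1 = \<Phi>\<^sub>1 (word_prod X (map \<phi> w))" for w
    proof -
      have "set (map \<phi> w) \<subseteq> carrier X"
        using c by auto
      from word_prod_first_order[OF this] show ?thesis
        by (simp add: \<psi>_def[abs_def] comp_def)
    qed
    then obtain v where v: "\<And>w. A.poly_fun (\<lambda>s. word_prod A (map (\<psi> s) w)) (v w)"
        "\<And>w. v w 0 = \<Phi>\<^sub>0 (word_prod X (map \<phi> w))" "\<And>w. v w 1 = \<Phi>\<^sub>1 (word_prod X (map \<phi> w))"
      by metis
    have "A.poly_fun (\<lambda>s. poly_eval A (\<psi> s) p)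
        (\<lambda>k. \<Sum>w\<in>Poly_Mapping.keys p. smul A (Poly_Mapping.lookup p w) (v w k))"
      unfolding poly_eval_def by (intro A.poly_fun_sum A.poly_fun_scale v(1)) simp
    then have 0: "(\<Sum>w\<in>Poly_Mapping.keys p. smul A (Poly_Mapping.lookup p w) (v w k)) = 0" for k
      using zero by (rule A.poly_fun_eq_0)
    have wc: "word_prod X (map \<phi> w) \<in> carrier X" for w
      using c by (intro X.word_prod_closed) auto
    have "\<Phi>\<^sub>0 (\<Sum>w\<in>I. smul X (r w) (word_prod X (map \<phi> w))) = (\<Sum>w\<in>I. smul A (r w) (v w 0)) \<and>
        \<Phi>\<^sub>1 (\<Sum>w\<in>I. smul X (r w) (word_prod X (map \<phi> w))) = (\<Sum>w\<in>I. smul A (r w) (v w 1))"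
      if "finite I" for I r
      using that
    proof (induction I rule: finite_induct)
      case (insert w I)
      have "(\<Sum>w\<in>I. smul X (r w) (word_prod X (map \<phi> w))) \<in> carrier X"
        using wc by (intro X.sum_closed X.smul_closed)
      then show ?case
        using insert wc v(2,3) by (simp add: add0 add1 smul0 smul1)
    qed (simp add: zero0 zero1)
    then have "\<Phi>\<^sub>0 (poly_eval X \<phi> p) = 0" "\<Phi>\<^sub>1 (poly_eval X \<phi> p) = 0"
      using 0 by (simp_all add: poly_eval_def)
    then show "poly_eval X \<phi> p = 0"
      using kernel[OF X.poly_eval_closed[of \<phi> p, OF c]] by simp
  qed
qed

end

section \<open>The algebras \<open>A\<^sub>2\<close> and \<open>C\<^sub>2\<close>\<close>

lemma mat_scale_component [simp]: "mat_scale c M $ i $ j = c * M $ i $ j"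
  by (simp add: mat_scale_def)

lemma vector_space_mat_scale: "vector_space (mat_scale :: 'f::field \<Rightarrow> 'f^'n^'m \<Rightarrow> 'f^'n^'m)"
  by standard (simp_all add: vec_eq_iff algebra_simps)

interpretation MS: vector_space "mat_scale :: 'f::field \<Rightarrow> 'f^'n^'m \<Rightarrow> 'f^'n^'m"
  by (rule vector_space_mat_scale)

lemma matrix_add_rdistrib_field:
  fixes M N :: "'f::field^'n^'m"
  shows "(M + N) ** B = M ** B + N ** B"
  by (simp add: vec_eq_iff matrix_matrix_mult_def distrib_right sum.distrib)

lemma mat_scale_mult:
  fixes M :: "'f::field^'n^'m" and N :: "'f^'k^'n"
  shows "mat_scale c M ** N = mat_scale c (M ** N)" "M ** mat_scale c N = mat_scale c (M ** N)"
  by (simp_all add: vec_eq_iff matrix_matrix_mult_def sum_distrib_left mult.assoc mult.left_commute)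

definition a2 :: "'f::field \<Rightarrow> 'f \<Rightarrow> 'f \<Rightarrow> 'f^4^4" where
  "a2 a b c = mat_scale a (mat_unit 1 1 + mat_unit 4 4) + mat_scale b (mat_unit 1 2) +
     mat_scale c (mat_unit 3 4)"

definition c2 :: "'f::field \<Rightarrow> 'f \<Rightarrow> 'f^2^2" where
  "c2 a b = mat_scale a (mat 1) + mat_scale b (mat_unit 1 2)"

lemma a2_component:
  "a2 a b c $ i $ j = (if i = 1 \<and> j = 1 \<or> i = 4 \<and> j = 4 then a
     else if i = 1 \<and> j = 2 then b else if i = 3 \<and> j = 4 then c else 0)"
  by (auto simp: a2_def mat_unit_def)

lemma c2_component:
  "c2 a b $ i $ j = (if i = j then a else if i = 1 \<and> j = 2 then b else 0)"
  by (auto simp: c2_def mat_unit_def mat_def)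

text \<open>With e = \<open>a2 1 0 0\<close> this is the multiplication table of e, y and its mirror
  image: e is a left unit and right annihilator for e12, and the reverse for e34.\<close>

lemma a2_mult: "a2 a b c ** a2 a' b' c' = a2 (a * a') (a * b') (c * a')"
  by (simp add: vec_eq_iff matrix_matrix_mult_def sum_4 forall_4 a2_component)

lemma a2_reflection: "reflection (a2 a b c) = a2 a c b"
  by (simp add: vec_eq_iff reflection_def forall_4 a2_component)

lemma c2_mult: "c2 a b ** c2 a' b' = c2 (a * a') (a * b' + b * a')"
  by (simp add: vec_eq_iff matrix_matrix_mult_def sum_2 forall_2 c2_component)

lemma c2_invol: "C2_invol (c2 a b) = c2 a (- b)"
  by (simp add: vec_eq_iff C2_invol_def forall_2 c2_component)

lemma a2_add: "a2 a b c + a2 a' b' c' = a2 (a + a') (b + b') (c + c')"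
  by (simp add: vec_eq_iff a2_component)

lemma a2_scale: "mat_scale k (a2 a b c) = a2 (k * a) (k * b) (k * c)"
  by (simp add: vec_eq_iff a2_component)

lemma c2_add: "c2 a b + c2 a' b' = c2 (a + a') (b + b')"
  by (simp add: vec_eq_iff c2_component)

lemma c2_scale: "mat_scale k (c2 a b) = c2 (k * a) (k * b)"
  by (simp add: vec_eq_iff c2_component)

lemma a2_0 [simp]: "a2 0 0 0 = 0"
  by (simp add: a2_def)

lemma c2_0 [simp]: "c2 0 0 = 0"
  by (simp add: c2_def)

lemma a2_entries: "a2 a b c $ 1 $ 1 = a" "a2 a b c $ 1 $ 2 = b" "a2 a b c $ 3 $ 4 = c"
  by (simp_all add: a2_component)

lemma c2_entries: "c2 a b $ 1 $ 1 = a" "c2 a b $ 1 $ 2 = b"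
  by (simp_all add: c2_component)

lemma a2_eq_iff: "a2 a b c = a2 a' b' c' \<longleftrightarrow> a = a' \<and> b = b' \<and> c = c'"
  by (metis a2_entries)

lemma c2_eq_iff: "c2 a b = c2 a' b' \<longleftrightarrow> a = a' \<and> b = b'"
  by (metis c2_entries)

lemma A2_space_eq: "A2_space = {a2 a b c | a b c. True}"
  unfolding A2_space_def MS.span_insert MS.span_empty
  by (auto simp: a2_def algebra_simps)

lemma A2_span_unit: "MS.span {mat_unit 1 1 + mat_unit 4 4} = {a2 a 0 0 | a. True}"
  unfolding MS.span_insert MS.span_empty by (auto simp: a2_def)

lemma A2_span_radical: "MS.span {mat_unit 1 2, mat_unit 3 4} = {a2 0 b c | b c. True}"
  unfolding MS.span_insert MS.span_empty by (auto simp: a2_def algebra_simps)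

lemma C2_space_eq: "C2_space = {c2 a b | a b. True}"
  unfolding C2_space_def MS.span_insert MS.span_empty by (auto simp: c2_def algebra_simps)

lemma C2_span_unit: "MS.span {mat 1} = {c2 a 0 | a. True}"
  unfolding MS.span_insert MS.span_empty by (auto simp: c2_def)

lemma C2_span_radical: "MS.span {mat_unit 1 2} = {c2 0 b | b. True}"
  unfolding MS.span_insert MS.span_empty by (auto simp: c2_def)

text \<open>The five algebras have at most two nonzero homogeneous components. For the trivial grading
  we take \<open>Q = 0\<close> and \<open>g = 0\<close>.\<close>

lemma gs_algebra_two_components:
  fixes M :: "('f::field_char_0, 'g::{finite,ab_group_add}, 'f^'n^'n) gs_alg"
  assumes [simp]: "smul M = mat_scale" "mult M = (**)"
    and PQ: "MS.subspace P" "MS.subspace Q" "P \<inter> Q \<subseteq> {0}" "carrier M = {p + q | p q. p \<in> P \<and> q \<in> Q}"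
    and homog: "\<And>h. homog M h = (if h = 0 then P else if h = g then Q else {0})" "g \<noteq> 0 \<or> Q = {0}"
    and PP: "\<And>x y. \<lbrakk>x \<in> P; y \<in> P\<rbrakk> \<Longrightarrow> x ** y \<in> P"
    and PQ': "\<And>x y. \<lbrakk>x \<in> P; y \<in> Q\<rbrakk> \<Longrightarrow> x ** y \<in> Q"
    and QP: "\<And>x y. \<lbrakk>x \<in> Q; y \<in> P\<rbrakk> \<Longrightarrow> x ** y \<in> Q"
    and QQ: "\<And>x y. \<lbrakk>x \<in> Q; y \<in> Q\<rbrakk> \<Longrightarrow> x ** y = 0"
    and star: "\<And>x y. star M (x + y) = star M x + star M y"
      "\<And>c x. star M (mat_scale c x) = mat_scale c (star M x)" "\<And>x. star M (star M x) = x"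
      "\<And>x y. \<lbrakk>x \<in> carrier M; y \<in> carrier M\<rbrakk> \<Longrightarrow> star M (x ** y) = star M y ** star M x"
      "\<And>x. x \<in> P \<Longrightarrow> star M x \<in> P" "\<And>x. x \<in> Q \<Longrightarrow> star M x \<in> Q"
  shows "gs_algebra M"
proof -
  have sub: "MS.subspace (carrier M)"
    unfolding PQ(4) by (rule MS.subspace_sums[OF PQ(1,2)])
  have 0: "0 \<in> P" "0 \<in> Q"
    using PQ(1,2) by (auto simp: MS.subspace_0)
  have PQc: "P \<subseteq> carrier M" "Q \<subseteq> carrier M"
    using 0 unfolding PQ(4) by force+
  have uniq: "p = p' \<and> q = q'" if "p \<in> P" "q \<in> Q" "p' \<in> P" "q' \<in> Q" "p + q = p' + q'" for p q p' q'
  proof -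
    have "p - p' = q' - q"
      using that(5) by (simp add: algebra_simps)
    moreover have "p - p' \<in> P" "q' - q \<in> Q"
      using that PQ(1,2) by (auto intro: MS.subspace_diff)
    ultimately have "p - p' \<in> P \<inter> Q"
      by simp
    then have "p - p' = 0"
      using PQ(3) by blast
    with \<open>p - p' = q' - q\<close> show ?thesis
      by simp
  qed
  \<comment> \<open>For g = 0 the two indices coincide, and the component must be counted
    once.\<close>
  have sum_c: "(\<Sum>h\<in>UNIV. c h) = c 0 + (if g = 0 then 0 else c g)"
    if c: "\<And>h. c h \<in> homog M h" for c :: "'g \<Rightarrow> _"
  proof -
    have "c h = 0" if "h \<noteq> 0" "h \<noteq> g" for h
      using c[of h] that by (simp add: homog(1))
    then have "(\<Sum>h\<in>UNIV. c h) = (\<Sum>h\<in>{0, g}. c h)"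
      by (intro sum.mono_neutral_right) auto
    then show ?thesis
      by simp
  qed
  have star_homog: "star M ` homog M h = homog M h" for h
  proof -
    have *: "star M x \<in> homog M h" if "x \<in> homog M h" for x
      using that star(1)[of 0 0] star(5,6) by (auto simp: homog(1) split: if_splits)
    show ?thesis
    proof
      show "homog M h \<subseteq> star M ` homog M h"
      proof
        fix x assume "x \<in> homog M h"
        then show "x \<in> star M ` homog M h"
          using *[of x] star(3)[of x] by (metis image_eqI)
      qed
    qed (use * in blast)
  qed
  have star_c: "star M x \<in> carrier M" if "x \<in> carrier M" for x
    using that star(1,5,6) unfolding PQ(4) by blast
  show ?thesis
  proof (rule gs_algebra.intro, goal_cases)
    case (3 x y)
    then obtain p q p' q' where xy: "x = p + q" "y = p' + q'" "p \<in> P" "q \<in> Q" "p' \<in> P" "q' \<in> Q"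
      unfolding PQ(4) by blast
    have "x ** y = p ** p' + (p ** q' + q ** p')"
      using QQ[OF xy(4,6)] by (simp add: xy(1,2) matrix_add_ldistrib matrix_add_rdistrib_field)
    moreover have "p ** q' + q ** p' \<in> Q"
      using xy PQ(2) PQ' QP by (intro MS.subspace_add)
    ultimately show ?case
      using PP[OF xy(3,5)] unfolding PQ(4) by auto
  next
    case (11 x)
    then obtain p q where x: "x = p + q" "p \<in> P" "q \<in> Q"
      unfolding PQ(4) by blast
    show ?case
    proof (rule ex1I[of _ "\<lambda>h. if h = 0 then p else if h = g then q else 0"])
      let ?c = "\<lambda>h. if h = 0 then p else if h = g then q else 0"
      have "\<forall>h. ?c h \<in> homog M h"
        using x homog by auto
      moreover have "x = (\<Sum>h\<in>UNIV. ?c h)"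
        using sum_c[of ?c] calculation homog(2) x by auto
      ultimately show "(\<forall>h. ?c h \<in> homog M h) \<and> x = (\<Sum>h\<in>UNIV. ?c h)"
        by blast
      fix c assume c: "(\<forall>h. c h \<in> homog M h) \<and> x = (\<Sum>h\<in>UNIV. c h)"
      then have c': "c h \<in> homog M h" for h
        by blast
      have "p + q = c 0 + (if g = 0 then 0 else c g)"
        using c sum_c[OF c'] x(1) by simp
      moreover have "c 0 \<in> P" "(if g = 0 then 0 else c g) \<in> Q"
        using c'[of 0] c'[of g] 0 by (auto simp: homog(1))
      ultimately have "p = c 0 \<and> q = (if g = 0 then 0 else c g)"
        using uniq x(2,3) by blast
      moreover have "c h = 0" if "h \<noteq> 0" "h \<noteq> g" for h
        using c'[of h] that by (simp add: homog(1))
      ultimately show "c = ?c"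
        by (auto simp: fun_eq_iff)
    qed
  next
    case (12 x g' y h)
    then show ?case
      using PP PQ' QP QQ 0 homog(2) by (auto simp: homog(1) split: if_splits)
  qed (use star sub PQ(1,2) PQc 0 star_c star_homog vector_space_mat_scale in
      \<open>auto simp: homog(1) matrix_mul_assoc matrix_add_ldistrib matrix_add_rdistrib_field mat_scale_mult\<close>)
qed

lemma reflection_linear:
  "reflection (x + y) = reflection x + reflection y"
  "reflection (mat_scale c x) = mat_scale c (reflection x)"
  "reflection (reflection x) = x"
proof -
  have "5 - (5 - i) = i" for i :: 4
    by simp
  then show "reflection (reflection x) = x"
    by (simp add: vec_eq_iff reflection_def)
qed (simp_all add: vec_eq_iff reflection_def)

lemma C2_invol_linear:
  "C2_invol (x + y) = C2_invol x + C2_invol y"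
  "C2_invol (mat_scale c x) = mat_scale c (C2_invol x)"
  "C2_invol (C2_invol x) = x"
  by (simp_all add: vec_eq_iff C2_invol_def)

lemma subspace_a2:
  "MS.subspace {a2 a 0 0 | a. True}" "MS.subspace {a2 0 b c | b c. True}"
  unfolding A2_span_unit[symmetric] A2_span_radical[symmetric] by (rule MS.subspace_span)+

lemma subspace_c2: "MS.subspace {c2 a 0 | a. True}" "MS.subspace {c2 0 b | b. True}"
  unfolding C2_span_unit[symmetric] C2_span_radical[symmetric] by (rule MS.subspace_span)+

lemma A2_space_sum:
  "A2_space = {p + q | p q. p \<in> {a2 a 0 0 | a. True} \<and> q \<in> {a2 0 b c | b c. True}}"
  unfolding A2_space_def A2_span_unit[symmetric] A2_span_radical[symmetric] MS.span_Un[symmetric]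
  by (simp add: insert_commute)

lemma C2_space_sum:
  "C2_space = {p + q | p q. p \<in> {c2 a 0 | a. True} \<and> q \<in> {c2 0 b | b. True}}"
  unfolding C2_space_def C2_span_unit[symmetric] C2_span_radical[symmetric] MS.span_Un[symmetric]
  by (simp add: insert_commute)

lemma subspace_A2_space: "MS.subspace A2_space" and subspace_C2_space: "MS.subspace C2_space"
  unfolding A2_space_def C2_space_def by (rule MS.subspace_span)+

lemma gs_algebra_A2_star: "gs_algebra (A2_star :: ('f::field_char_0, 'g::{finite,ab_group_add}, _) gs_alg)"
  by (rule gs_algebra_two_components[where P = A2_space and Q = "{0}" and g = 0])
    (auto simp: A2_star_def reflection_linear subspace_A2_space,
     use reflection_linear(1)[of 0 0] in
       \<open>auto simp: A2_space_eq a2_mult a2_reflection a2_eq_iff mult.commute\<close>)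

lemma gs_algebra_A2_gr:
  fixes g :: "'g::{finite,ab_group_add}"
  assumes "g \<noteq> 0"
  shows "gs_algebra (A2_gr g :: ('f::field_char_0, 'g, _) gs_alg)"
proof (rule gs_algebra_two_components[OF _ _ subspace_a2, where g = g])
  show "carrier (A2_gr g :: ('f, 'g, _) gs_alg) =
      {p + q | p q. p \<in> {a2 a 0 0 | a. True} \<and> q \<in> {a2 0 b c | b c. True}}"
    using A2_space_sum by (simp add: A2_gr_def)
qed (use assms in \<open>auto simp: A2_gr_def reflection_linear A2_span_unit A2_span_radical
      A2_space_eq a2_mult a2_reflection a2_add a2_eq_iff mult.commute\<close>)

lemma gs_algebra_C2_star: "gs_algebra (C2_star :: ('f::field_char_0, 'g::{finite,ab_group_add}, _) gs_alg)"
  by (rule gs_algebra_two_components[where P = C2_space and Q = "{0}" and g = 0])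
    (auto simp: C2_star_def C2_invol_linear subspace_C2_space,
     use C2_invol_linear(1)[of 0 0] in
       \<open>auto simp: C2_space_eq c2_mult c2_invol c2_eq_iff mult.commute\<close>)

lemma gs_algebra_C2_gr:
  fixes g :: "'g::{finite,ab_group_add}"
  assumes "g \<noteq> 0"
  shows "gs_algebra (C2_gr g :: ('f::field_char_0, 'g, _) gs_alg)"
proof (rule gs_algebra_two_components[OF _ _ subspace_c2, where g = g])
  show "carrier (C2_gr g :: ('f, 'g, _) gs_alg) =
      {p + q | p q. p \<in> {c2 a 0 | a. True} \<and> q \<in> {c2 0 b | b. True}}"
    using C2_space_sum by (simp add: C2_gr_def)
qed (use assms in \<open>auto simp: C2_gr_def C2_homog_def C2_span_unit C2_span_radical
      C2_space_eq c2_mult c2_add c2_eq_iff algebra_simps\<close>)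

lemma gs_algebra_C2_star_gr:
  fixes g :: "'g::{finite,ab_group_add}"
  assumes "g \<noteq> 0"
  shows "gs_algebra (C2_star_gr g :: ('f::field_char_0, 'g, _) gs_alg)"
proof (rule gs_algebra_two_components[OF _ _ subspace_c2, where g = g])
  show "carrier (C2_star_gr g :: ('f, 'g, _) gs_alg) =
      {p + q | p q. p \<in> {c2 a 0 | a. True} \<and> q \<in> {c2 0 b | b. True}}"
    using C2_space_sum by (simp add: C2_star_gr_def)
qed (use assms in \<open>auto simp: C2_star_gr_def C2_homog_def C2_span_unit C2_span_radical
      C2_space_eq c2_mult c2_add c2_eq_iff C2_invol_linear c2_invol algebra_simps\<close>)

context gs_algebra
begin

text \<open>The embedding sends e11 + e44 to e, e12 to s y and e34 to s z, where z is the image of y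
  under the involution; products of y and z carry s^2 and drop out. The condition
  \<open>homogX\<close> is loose enough to cover both the trivial and the nontrivial
  grading.\<close>

lemma in_var_A2:
  fixes X :: "('f, 'g, 'f^4^4) gs_alg"
  assumes e: "e \<in> homog A 0" "star A e = e" "mult A e e = e" "e \<noteq> 0"
    and y: "y \<in> homog A g" "mult A e y = y" "mult A y e = 0" "y \<noteq> 0"
    and X: "gs_algebra X" "carrier X = A2_space" "smul X = mat_scale" "mult X = (**)" "star X = reflection"
    and homogX: "\<And>h a b c. a2 a b c \<in> homog X h \<Longrightarrow> (h = 0 \<or> a = 0) \<and> (h = g \<or> b = 0 \<and> c = 0)"
  shows "in_var X A"
proof -
  have ec: "e \<in> carrier A" and yc: "y \<in> carrier A"
    using e y homog_closed by auto
  define z where "z = star A y"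
  have z: "z \<in> homog A g" "z \<in> carrier A" "star A z = y" "star A y = z"
      "mult A e z = 0" "mult A z e = z" "z \<noteq> 0"
    using star_mult[OF yc ec] star_mult[OF ec yc] y e yc star_star[OF yc]
    by (auto simp: z_def star_in_homog)
  define \<Phi>\<^sub>0 where "\<Phi>\<^sub>0 M = smul A (M $ 1 $ 1) e" for M :: "'f^4^4"
  define \<Phi>\<^sub>1 where "\<Phi>\<^sub>1 M = smul A (M $ 1 $ 2) y + smul A (M $ 3 $ 4) z" for M :: "'f^4^4"
  have \<Phi>: "\<Phi>\<^sub>0 (a2 a b c) = smul A a e" "\<Phi>\<^sub>1 (a2 a b c) = smul A b y + smul A c z" for a b c
    by (simp_all add: \<Phi>\<^sub>0_def \<Phi>\<^sub>1_def a2_entries)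
  \<comment> \<open>Left multiplication by e keeps y and kills z, which separates the two
    coefficients.\<close>
  have kernel: "b = 0 \<and> c = 0" if bc: "smul A b y + smul A c z = 0" for b c
  proof -
    have "mult A e (smul A b y + smul A c z) = smul A b y"
      using ec yc y z by (simp add: mult_add_right mult_smul_right)
    then have "smul A b y = 0"
      using bc ec by simp
    then show ?thesis
      using bc y z by simp
  qed
  interpret X: gs_algebra X by fact
  have "first_order_embedding A X \<Phi>\<^sub>0 \<Phi>\<^sub>1"
  proof (intro first_order_embedding.intro first_order_embedding_axioms.intro, goal_cases)
    case (11 x h)
    then obtain a b c where "x = a2 a b c"
      using X.homog_closed[OF 11] by (auto simp: X(2) A2_space_eq)
    then show ?case
      using 11 homogX[of a b c h] e by (auto simp: \<Phi> intro: smul_homog)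
  next
    case (12 x h)
    then obtain a b c where "x = a2 a b c"
      using X.homog_closed[OF 12] by (auto simp: X(2) A2_space_eq)
    then show ?case
      using 12 homogX[of a b c h] y(1) z(1) by (cases "h = g") (auto simp: \<Phi> smul_homog add_homog)
  next
    case (13 x)
    then obtain a b c where "x = a2 a b c"
      by (auto simp: X(2) A2_space_eq)
    then show ?case
      using 13 kernel[of b c] e(4) by (simp add: \<Phi>)
  qed (use e y ec yc z X(1) gs_algebra_axioms in
      \<open>auto simp: X A2_space_eq a2_add a2_scale a2_mult a2_reflection \<Phi> star_add star_smul
        mult_add_left mult_add_right mult_smul_left mult_smul_right
        vs.scale_left_distrib vs.scale_right_distrib vs.scale_scale algebra_simps\<close>)
  then show ?thesis
    using first_order_embedding.identities_subset X(1) unfolding in_var_def by blast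
qed

text \<open>The scalar \<open>r\<close> is the sign with which the involution acts on z, so the
  three variants of C_2 are handled together; z z is pushed into s^2.\<close>

lemma in_var_C2:
  fixes X :: "('f, 'g, 'f^2^2) gs_alg"
  assumes e: "e \<in> homog A 0" "star A e = e" "mult A e e = e" "e \<noteq> 0"
    and z: "z \<in> homog A g" "mult A e z = z" "mult A z e = z" "z \<noteq> 0" "star A z = smul A r z"
    and X: "gs_algebra X" "carrier X = C2_space" "smul X = mat_scale" "mult X = (**)"
      "\<And>a b. star X (c2 a b) = c2 a (r * b)"
    and homogX: "\<And>h a b. c2 a b \<in> homog X h \<Longrightarrow> (h = 0 \<or> a = 0) \<and> (h = g \<or> b = 0)"
  shows "in_var X A"
proof -
  have ec: "e \<in> carrier A" and zc: "z \<in> carrier A"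
    using e z homog_closed by auto
  define \<Phi>\<^sub>0 where "\<Phi>\<^sub>0 M = smul A (M $ 1 $ 1) e" for M :: "'f^2^2"
  define \<Phi>\<^sub>1 where "\<Phi>\<^sub>1 M = smul A (M $ 1 $ 2) z" for M :: "'f^2^2"
  have \<Phi>: "\<Phi>\<^sub>0 (c2 a b) = smul A a e" "\<Phi>\<^sub>1 (c2 a b) = smul A b z" for a b
    by (simp_all add: \<Phi>\<^sub>0_def \<Phi>\<^sub>1_def c2_entries)
  interpret X: gs_algebra X by fact
  have "first_order_embedding A X \<Phi>\<^sub>0 \<Phi>\<^sub>1"
  proof (intro first_order_embedding.intro first_order_embedding_axioms.intro, goal_cases)
    case (11 x h)
    then obtain a b where "x = c2 a b"
      using X.homog_closed[OF 11] by (auto simp: X(2) C2_space_eq)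
    then show ?case
      using 11 homogX[of a b h] e by (auto simp: \<Phi> intro: smul_homog)
  next
    case (12 x h)
    then obtain a b where "x = c2 a b"
      using X.homog_closed[OF 12] by (auto simp: X(2) C2_space_eq)
    then show ?case
      using 12 homogX[of a b h] z(1) by (cases "h = g") (auto simp: \<Phi> smul_homog)
  qed (use assms ec zc gs_algebra_axioms in
      \<open>auto simp: X C2_space_eq c2_add c2_scale c2_mult \<Phi> star_smul
        mult_smul_left mult_smul_right vs.scale_left_distrib mult.commute\<close>)
  then show ?thesis
    using first_order_embedding.identities_subset X(1) unfolding in_var_def by blast
qed

end

section \<open>Algebras without the five obstructions\<close>

definition excludes_A2_C2 :: "('f::field_char_0, 'g::{finite,ab_group_add}, 'a::ab_group_add) gs_alg \<Rightarrow> bool" where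
  "excludes_A2_C2 A \<longleftrightarrow> \<not> in_var A2_star A \<and> \<not> in_var C2_star A \<and>
     (\<forall>g. g \<noteq> 0 \<longrightarrow> \<not> in_var (A2_gr g) A \<and> \<not> in_var (C2_gr g) A \<and> \<not> in_var (C2_star_gr g) A)"

lemma word_prod_sub_alg [simp]: "word_prod (sub_alg A S) xs = word_prod A xs"
  by (induction xs rule: induct_list012) (simp_all add: sub_alg_def)

lemma sub_alg_simps [simp]:
  "carrier (sub_alg A S) = S" "smul (sub_alg A S) = smul A" "mult (sub_alg A S) = mult A"
  "star (sub_alg A S) = star A" "homog (sub_alg A S) g = homog A g \<inter> S"
  by (simp_all add: sub_alg_def)

context gs_algebra
begin

definition sym_idempotent :: "'a \<Rightarrow> bool" where
  "sym_idempotent e \<longleftrightarrow> e \<in> homog A 0 \<and> star A e = e \<and> mult A e e = e"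

definition annihilator :: "'a \<Rightarrow> 'a set" where
  "annihilator e = {x \<in> carrier A. mult A e x = 0}"

lemma A2_corner_zero:
  assumes ex: "excludes_A2_C2 A" and e: "sym_idempotent e" "e \<noteq> 0"
    and y: "y \<in> homog A g" "mult A e y = y" "mult A y e = 0"
  shows "y = 0"
proof (rule ccontr)
  assume "y \<noteq> 0"
  note in_var = in_var_A2[OF _ _ _ e(2) y \<open>y \<noteq> 0\<close>]
  have e': "e \<in> homog A 0" "star A e = e" "mult A e e = e"
    using e by (auto simp: sym_idempotent_def)
  show False
  proof (cases "g = 0")
    case True
    have "in_var A2_star A"
    proof (rule in_var[OF e' gs_algebra_A2_star])
      fix h a b c
      assume "a2 a b c \<in> homog (A2_star :: ('f, 'g, _) gs_alg) h"
      then show "(h = 0 \<or> a = 0) \<and> (h = g \<or> b = 0 \<and> c = 0)"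
        using True a2_eq_iff[of a b c 0 0 0] by (auto simp: A2_star_def split: if_splits)
    qed (simp_all add: A2_star_def)
    then show False
      using ex by (simp add: excludes_A2_C2_def)
  next
    case False
    have "in_var (A2_gr g) A"
    proof (rule in_var[OF e' gs_algebra_A2_gr[OF False]])
      fix h a b c
      assume "a2 a b c \<in> homog (A2_gr g :: ('f, 'g, _) gs_alg) h"
      then show "(h = 0 \<or> a = 0) \<and> (h = g \<or> b = 0 \<and> c = 0)"
        using a2_eq_iff[of a b c 0 0 0]
        by (auto simp: A2_gr_def A2_span_unit A2_span_radical a2_eq_iff split: if_splits)
    qed (simp_all add: A2_gr_def)
    then show False
      using ex False by (simp add: excludes_A2_C2_def)
  qed
qed

text \<open>The type left out by \<open>gp\<close>, symmetric of degree 0, is the one that survives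
  in the corner and makes up the commutative summand.\<close>

lemma C2_corner_zero:
  assumes ex: "excludes_A2_C2 A" and e: "sym_idempotent e" "e \<noteq> 0"
    and z: "z \<in> homog_part A (g, p)" "mult A e z = z" "mult A z e = z" and gp: "g \<noteq> 0 \<or> p = Skew"
  shows "z = 0"
proof (rule ccontr)
  assume "z \<noteq> 0"
  have e': "e \<in> homog A 0" "star A e = e" "mult A e e = e"
    using e by (auto simp: sym_idempotent_def)
  have zg: "z \<in> homog A g"
    using z(1) by (cases p) (auto simp: homog_part_def)
  note in_var = in_var_C2[OF e' e(2) zg z(2,3) \<open>z \<noteq> 0\<close>]
  show False
  proof (cases p)
    case Sym
    then have g: "g \<noteq> 0" and star: "star A z = smul A 1 z"
      using gp z(1) by (auto simp: homog_part_def)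
    have "in_var (C2_gr g) A"
    proof (rule in_var[OF star gs_algebra_C2_gr[OF g]])
      fix h a b
      assume "c2 a b \<in> homog (C2_gr g :: ('f, 'g, _) gs_alg) h"
      then show "(h = 0 \<or> a = 0) \<and> (h = g \<or> b = 0)"
        using c2_eq_iff[of a b 0 0]
        by (auto simp: C2_gr_def C2_homog_def C2_span_unit C2_span_radical c2_eq_iff split: if_splits)
    qed (simp_all add: C2_gr_def)
    then show False
      using ex g by (simp add: excludes_A2_C2_def)
  next
    case Skew
    then have star: "star A z = smul A (- 1) z"
      using z(1) by (auto simp: homog_part_def vs.scale_minus_left)
    show False
    proof (cases "g = 0")
      case True
      have "in_var C2_star A"
      proof (rule in_var[OF star gs_algebra_C2_star])
        fix h a b
        assume "c2 a b \<in> homog (C2_star :: ('f, 'g, _) gs_alg) h"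
        then show "(h = 0 \<or> a = 0) \<and> (h = g \<or> b = 0)"
          using True c2_eq_iff[of a b 0 0] by (auto simp: C2_star_def split: if_splits)
      qed (simp_all add: C2_star_def c2_invol)
      then show False
        using ex by (simp add: excludes_A2_C2_def)
    next
      case False
      have "in_var (C2_star_gr g) A"
      proof (rule in_var[OF star gs_algebra_C2_star_gr[OF False]])
        fix h a b
        assume "c2 a b \<in> homog (C2_star_gr g :: ('f, 'g, _) gs_alg) h"
        then show "(h = 0 \<or> a = 0) \<and> (h = g \<or> b = 0)"
          using c2_eq_iff[of a b 0 0]
          by (auto simp: C2_star_gr_def C2_homog_def C2_span_unit C2_span_radical c2_eq_iff split: if_splits)
      qed (simp_all add: C2_star_gr_def c2_invol)
      then show False
        using ex False by (simp add: excludes_A2_C2_def)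
    qed
  qed
qed

section \<open>The Peirce decomposition at a symmetric idempotent of degree 0\<close>

context
  fixes e
  assumes ex: "excludes_A2_C2 A" and e: "sym_idempotent e"
begin

lemma e_props: "e \<in> homog A 0" "e \<in> carrier A" "star A e = e" "mult A e e = e"
  using e homog_closed by (auto simp: sym_idempotent_def)

text \<open>The difference e x - e x e is homogeneous, fixed by e on the left and killed by e on the
  right, hence 0. Applying the involution to the same statement for the image of x gives x e = e x
  e.\<close>

lemma idempotent_central_homog:
  assumes x: "x \<in> homog A g"
  shows "mult A e x = mult A x e"
proof (cases "e = 0")
  case True
  then show ?thesis
    using x homog_closed by simp
next
  case False
  have corner: "mult A e x = mult A (mult A e x) e" if x: "x \<in> homog A g" for x
  proof -
    have xc: "x \<in> carrier A"
      using x by (rule homog_closed)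
    have "mult A e x \<in> homog A g" "mult A (mult A e x) e \<in> homog A g"
      using homog_mult[OF e_props(1) x] homog_mult[OF homog_mult[OF e_props(1) x] e_props(1)] by simp_all
    then have "mult A e x - mult A (mult A e x) e \<in> homog A g"
      by (rule diff_homog)
    moreover have "mult A e (mult A e x - mult A (mult A e x) e) = mult A e x - mult A (mult A e x) e"
      using e_props xc by (simp add: mult_diff_right mult_assoc[symmetric])
    moreover have "mult A (mult A e x - mult A (mult A e x) e) e = 0"
      using e_props xc by (simp add: mult_diff_left mult_assoc)
    ultimately have "mult A e x - mult A (mult A e x) e = 0"
      using A2_corner_zero[OF ex e False] by blast
    then show ?thesis
      by simp
  qed
  have xc: "x \<in> carrier A"
    using x by (rule homog_closed)
  have "mult A e (star A x) = mult A (mult A e (star A x)) e"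
    using corner[OF star_in_homog[OF x]] .
  then have "star A (mult A e (star A x)) = star A (mult A (mult A e (star A x)) e)"
    by simp
  then have "mult A x e = mult A e (mult A x e)"
    using e_props xc by (simp add: star_mult star_star)
  then show ?thesis
    using corner[OF x] e_props xc by (simp add: mult_assoc)
qed

lemma idempotent_central:
  assumes x: "x \<in> carrier A"
  shows "mult A e x = mult A x e"
proof -
  obtain c where c: "\<And>g. c g \<in> homog A g" "x = (\<Sum>g\<in>UNIV. c g)"
    using homog_decomp[OF x] by blast
  show ?thesis
    unfolding c(2) using homog_closed[OF c(1)] e_props(2)
    by (simp add: mult_sum_left mult_sum_right idempotent_central_homog[OF c(1)])
qed

text \<open>For z = e x, the skew part vanishes in every degree, so z is symmetric; in degree g
  other than 0 the symmetric part vanishes as well, and then 2 z = 0.\<close>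

lemma idempotent_mult_homog:
  assumes x: "x \<in> homog A g"
  shows "g \<noteq> 0 \<Longrightarrow> mult A e x = 0" "star A (mult A e x) = mult A e x"
proof -
  define z where "z = mult A e x"
  have xc: "x \<in> carrier A"
    using x by (rule homog_closed)
  have z: "z \<in> homog A g" "z \<in> carrier A" "mult A e z = z" "mult A z e = z"
    using homog_mult[OF e_props(1) x] e_props xc idempotent_central[of z]
    by (simp_all add: z_def mult_assoc[symmetric])
  have zs: "mult A e (star A z) = star A z" "mult A (star A z) e = star A z"
    using star_mult[OF z(2) e_props(2)] star_mult[OF e_props(2) z(2)] e_props z(3,4) by simp_all
  have plus: "z + star A z \<in> homog_part A (g, Sym)" and minus: "z - star A z \<in> homog_part A (g, Skew)"
    using z star_in_homog[OF z(1)]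
    by (auto simp: homog_part_def add_homog diff_homog star_add star_diff star_star add.commute)
  have skew: "z = star A z"
  proof (cases "e = 0")
    case True
    then show ?thesis
      using xc by (simp add: z_def)
  next
    case False
    have "z - star A z = 0"
      using e_props z zs by (intro C2_corner_zero[OF ex e False minus]) (simp_all add: mult_diff_left mult_diff_right)
    then show ?thesis
      by simp
  qed
  then show "star A (mult A e x) = mult A e x"
    by (simp add: z_def)
  show "mult A e x = 0" if "g \<noteq> 0"
  proof (cases "e = 0")
    case True
    then show ?thesis
      using xc by simp
  next
    case False
    have "z + star A z = 0"
      using e_props z zs that
      by (intro C2_corner_zero[OF ex e False plus]) (simp_all add: mult_add_left mult_add_right)
    then have "smul A 2 z = 0"
      using skew by (metis one_add_one vs.scale_left_distrib vs.scale_one)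
    then show ?thesis
      by (simp add: z_def)
  qed
qed

lemma idempotent_mult:
  assumes x: "x \<in> carrier A"
  shows "mult A e x \<in> homog A 0" "star A (mult A e x) = mult A e x"
proof -
  obtain c where c: "\<And>g. c g \<in> homog A g" "x = (\<Sum>g\<in>UNIV. c g)"
    using homog_decomp[OF x] by blast
  have "mult A e x = (\<Sum>g\<in>UNIV. mult A e (c g))"
    unfolding c(2) using homog_closed[OF c(1)] e_props(2) by (simp add: mult_sum_right)
  also have "\<dots> = (\<Sum>g\<in>{0}. mult A e (c g))"
    using idempotent_mult_homog(1)[OF c(1)] by (intro sum.mono_neutral_right) auto
  finally have 0: "mult A e x = mult A e (c 0)"
    by simp
  then show "mult A e x \<in> homog A 0"
    using homog_mult[OF e_props(1) c(1)[of 0]] by simp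
  show "star A (mult A e x) = mult A e x"
    unfolding 0 by (rule idempotent_mult_homog(2)[OF c(1)])
qed

lemma idempotent_star:
  assumes x: "x \<in> carrier A"
  shows "mult A e (star A x) = mult A e x"
proof -
  have "mult A e (star A x) = mult A (star A x) e"
    using x by (intro idempotent_central) simp
  also have "\<dots> = star A (mult A e x)"
    using x e_props by (simp add: star_mult)
  finally show ?thesis
    using idempotent_mult(2)[OF x] by simp
qed

lemma gs_algebra_annihilator: "gs_algebra (sub_alg A (annihilator e))"
proof (rule gs_algebra_sub_alg)
  show "vs.subspace (annihilator e)"
    using subspace_mult_left_preimage[OF e_props(2) vs.subspace_single_0] by (simp add: annihilator_def)
  show "annihilator e \<subseteq> carrier A"
    by (auto simp: annihilator_def)
  show "mult A x y \<in> annihilator e" if "x \<in> annihilator e" "y \<in> annihilator e" for x y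
    using that e_props mult_assoc[of e x y] by (auto simp: annihilator_def)
  show "star A x \<in> annihilator e" if "x \<in> annihilator e" for x
    using that idempotent_star by (auto simp: annihilator_def)
  fix x assume x: "x \<in> annihilator e"
  then obtain c where c: "\<And>g. c g \<in> homog A g" "x = (\<Sum>g\<in>UNIV. c g)"
    using homog_decomp[of x] by (auto simp: annihilator_def)
  \<comment> \<open>As e has degree 0, these products are the homogeneous components of e x = 0, so
    each of them vanishes.\<close>
  have "(\<Sum>g\<in>UNIV. mult A e (c g)) = 0"
    using x homog_closed[OF c(1)] e_props(2) by (simp add: annihilator_def c(2) mult_sum_right)
  moreover have "mult A e (c g) \<in> homog A g" for g
    using homog_mult[OF e_props(1) c(1)[of g]] by simp
  ultimately have "mult A e (c g) = 0" for g
    using homog_sum_zero[of "\<lambda>g. mult A e (c g)" g] by blast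
  then show "\<exists>c. (\<forall>g. c g \<in> homog A g \<inter> annihilator e) \<and> x = (\<Sum>g\<in>UNIV. c g)"
    using c homog_closed[OF c(1)] by (intro exI[of _ c]) (auto simp: annihilator_def)
qed

definition corner :: "'a set" where
  "corner = {x \<in> carrier A. mult A e x = x}"

lemma corner_props:
  assumes "x \<in> corner"
  shows "x \<in> carrier A" "x \<in> homog A 0" "star A x = x" "mult A e x = x"
  using assms idempotent_mult[of x] by (auto simp: corner_def)

lemma corner_mult: "\<lbrakk>x \<in> corner; y \<in> corner\<rbrakk> \<Longrightarrow> mult A x y \<in> corner"
  using e_props mult_assoc[of e x y] by (auto simp: corner_def)

lemma corner_alg:
  "gs_algebra (sub_alg A corner)" "commutative_alg (sub_alg A corner)"
  "trivial_involution (sub_alg A corner)" "trivial_grading (sub_alg A corner)"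
  "e \<noteq> 0 \<Longrightarrow> \<not> nilpotent_alg (sub_alg A corner)"
proof -
  show "gs_algebra (sub_alg A corner)"
  proof (rule gs_algebra_sub_alg)
    show "vs.subspace corner"
      unfolding vs.subspace_def corner_def using e_props(2) by (auto simp: mult_add_right mult_smul_right)
    show "corner \<subseteq> carrier A"
      by (auto simp: corner_def)
    show "mult A x y \<in> corner" if "x \<in> corner" "y \<in> corner" for x y
      using that by (rule corner_mult)
    show "star A x \<in> corner" if "x \<in> corner" for x
      using corner_props(3)[OF that] that by simp
    fix x assume x: "x \<in> corner"
    have "0 \<in> corner"
      using e_props(2) by (simp add: corner_def)
    then show "\<exists>c. (\<forall>g. c g \<in> homog A g \<inter> corner) \<and> x = (\<Sum>g\<in>UNIV. c g)"
      using x corner_props(2)[OF x] by (intro exI[of _ "\<lambda>g. if g = 0 then x else 0"]) auto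
  qed
  \<comment> \<open>Products in the corner are symmetric like their factors, and the involution
    reverses them; so x y = y x.\<close>
  show "commutative_alg (sub_alg A corner)"
    unfolding commutative_alg_def
    using corner_props(3)[OF corner_mult] star_mult corner_props(1,3) by (metis sub_alg_simps(1,3))
  show "trivial_involution (sub_alg A corner)"
    by (simp add: trivial_involution_def corner_props(3))
  show "trivial_grading (sub_alg A corner)"
    using corner_props(2) by (auto simp: trivial_grading_def)
  assume "e \<noteq> 0"
  moreover have "pw e (Suc n) = e" for n
    using e_props(4) by (induction n) (auto simp: word_prod_Cons)
  then have "pw e k = e" if "k \<ge> 1" for k
    using that by (cases k) auto
  moreover have "e \<in> corner"
    using e_props by (simp add: corner_def)
  then have "length (replicate k e) = k \<and> set (replicate k e) \<subseteq> carrier (sub_alg A corner)" for k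
    by auto
  ultimately show "\<not> nilpotent_alg (sub_alg A corner)"
    unfolding nilpotent_alg_def word_prod_sub_alg by metis
qed

text \<open>\<open>A\<close> may lack a unit, so multiplication by 1 - e is written as
  \<open>x - mult A e x\<close>; centrality of e makes it multiplicative.\<close>

lemma gs_iso_Peirce:
  "gs_iso A (alg_sum (sub_alg A corner) (sub_alg A (annihilator e))) (\<lambda>x. (mult A e x, x - mult A e x))"
proof (unfold_locales, goal_cases)
  case (1 x y)
  then show ?case
    using e_props by (simp add: mult_add_right)
next
  case (2 x c)
  then show ?case
    using e_props by (simp add: mult_smul_right alg_sum_def vs.scale_right_diff_distrib)
next
  case (3 x y)
  have exey: "mult A (mult A e x) (mult A e y) = mult A e (mult A x y)"
  proof -
    have "mult A (mult A e x) (mult A e y) = mult A e (mult A (mult A x e) y)"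
      using 3 e_props by (simp add: mult_assoc)
    also have "\<dots> = mult A e (mult A (mult A e x) y)"
      using 3 by (simp add: idempotent_central)
    also have "\<dots> = mult A (mult A e e) (mult A x y)"
      using 3 e_props(2) by (simp only: mult_assoc mult_closed)
    finally show ?thesis
      using e_props by simp
  qed
  have "mult A x (mult A e y) = mult A (mult A x e) y"
    using 3 e_props by (simp add: mult_assoc)
  also have "\<dots> = mult A (mult A e x) y"
    using 3 by (simp add: idempotent_central)
  also have "\<dots> = mult A e (mult A x y)"
    using 3 e_props by (simp add: mult_assoc)
  finally have xey: "mult A x (mult A e y) = mult A e (mult A x y)" .
  have exy: "mult A (mult A e x) y = mult A e (mult A x y)"
    using 3 e_props by (simp add: mult_assoc)
  have "mult A (x - mult A e x) (y - mult A e y) = mult A x y - mult A e (mult A x y)"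
    using 3 e_props by (simp add: mult_diff_left mult_diff_right exey xey exy)
  then show ?case
    using exey by (simp add: alg_sum_def)
next
  case (4 x)
  then show ?case
    using e_props idempotent_mult(2)[OF 4] idempotent_star[OF 4] by (simp add: alg_sum_def star_diff)
next
  case 5
  show ?case
    by (rule inj_onI) auto
next
  case (6 g)
  show ?case
  proof
    show "(\<lambda>x. (mult A e x, x - mult A e x)) ` homog A g
        \<subseteq> homog (alg_sum (sub_alg A corner) (sub_alg A (annihilator e))) g"
    proof clarify
      fix x assume x: "x \<in> homog A g"
      have "mult A e x \<in> homog A g"
        using homog_mult[OF e_props(1) x] by simp
      moreover have "mult A e (mult A e x) = mult A e x"
        using e_props homog_closed[OF x] by (simp add: mult_assoc[symmetric])
      ultimately show "(mult A e x, x - mult A e x)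
          \<in> homog (alg_sum (sub_alg A corner) (sub_alg A (annihilator e))) g"
        using x homog_closed[OF x] e_props
        by (simp add: alg_sum_def corner_def annihilator_def diff_homog mult_diff_right)
    qed
    show "homog (alg_sum (sub_alg A corner) (sub_alg A (annihilator e))) g
        \<subseteq> (\<lambda>x. (mult A e x, x - mult A e x)) ` homog A g"
    proof clarify
      fix a b assume "(a, b) \<in> homog (alg_sum (sub_alg A corner) (sub_alg A (annihilator e))) g"
      then have ab: "a \<in> homog A g" "b \<in> homog A g" "a \<in> carrier A" "b \<in> carrier A"
          "mult A e a = a" "mult A e b = 0"
        by (auto simp: alg_sum_def corner_def annihilator_def)
      have "mult A e (a + b) = a"
        using ab e_props by (simp add: mult_add_right)
      then show "(a, b) \<in> (\<lambda>x. (mult A e x, x - mult A e x)) ` homog A g"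
        using ab add_homog by (intro image_eqI[of _ _ "a + b"]) auto
    qed
  qed
qed

end

lemma maximal_sym_idempotent:
  assumes ex: "excludes_A2_C2 A" and fin: "carrier A \<subseteq> vs.span T" "finite T"
  obtains e where "sym_idempotent e" "nilpotent_alg (sub_alg A (annihilator e))"
proof -
  \<comment> \<open>The element 0 gives the minimization a starting point; its annihilator is all of
    \<open>A\<close>. The outcome e = 0 means that \<open>A\<close> is nilpotent.\<close>
  have "sym_idempotent 0"
    by (simp add: sym_idempotent_def)
  then obtain e where e: "sym_idempotent e"
    and min: "\<And>f. sym_idempotent f \<Longrightarrow> vs.dim (annihilator e) \<le> vs.dim (annihilator f)"
    using ex_has_least_nat[of sym_idempotent 0 "\<lambda>e. vs.dim (annihilator e)"] by blast
  have sub: "vs.subspace (annihilator f)" if "f \<in> carrier A" for f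
    using subspace_mult_left_preimage[OF that vs.subspace_single_0] by (simp add: annihilator_def)
  interpret N: gs_algebra "sub_alg A (annihilator e)"
    by (rule gs_algebra_annihilator[OF ex e])
  have ec: "e \<in> carrier A"
    using e homog_closed by (auto simp: sym_idempotent_def)
  have Nfin: "annihilator e \<subseteq> vs.span T"
    using fin(1) by (auto simp: annihilator_def)
  have "nilpotent_alg (sub_alg A (annihilator e))"
  proof (rule ccontr)
    assume "\<not> nilpotent_alg (sub_alg A (annihilator e))"
    then have "\<not> N.nil_set (homog (sub_alg A (annihilator e)) 0)"
      using N.nilpotent_if_homog_0_nil by blast
    then obtain f where f: "f \<in> homog A 0" "f \<in> annihilator e" "star A f = f" "f \<noteq> 0" "mult A f f = f"
      using N.symmetric_idempotent_exists[of T] Nfin fin(2) by auto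
    have fc: "f \<in> carrier A" "mult A e f = 0" "mult A f e = 0"
      using f(2) idempotent_central[OF ex e, of f] by (auto simp: annihilator_def)
    \<comment> \<open>Membership in the annihilator and centrality of e give e f = f e = 0. The
      orthogonal sum has a smaller annihilator, as f itself is no longer in it.\<close>
    have ef: "sym_idempotent (e + f)"
      using e f fc ec by (auto simp: sym_idempotent_def add_homog star_add mult_add_left mult_add_right)
    have "annihilator (e + f) \<subset> annihilator e"
    proof
      show "annihilator (e + f) \<subseteq> annihilator e"
      proof
        fix x assume x: "x \<in> annihilator (e + f)"
        then have xc: "x \<in> carrier A" and "mult A (e + f) x = 0"
          by (auto simp: annihilator_def)
        then have "0 = mult A e (mult A (e + f) x)"
          using ec by simp
        also have "\<dots> = mult A (mult A e e) x + mult A (mult A e f) x"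
          using xc ec fc(1) by (simp add: mult_add_left mult_add_right mult_assoc)
        also have "\<dots> = mult A e x"
          using e fc xc by (simp add: sym_idempotent_def)
        finally show "x \<in> annihilator e"
          using xc by (simp add: annihilator_def)
      qed
      have "mult A (e + f) f = f"
        using ec fc f(5) by (simp add: mult_add_left)
      then have "f \<notin> annihilator (e + f)"
        using f(4) by (simp add: annihilator_def)
      then show "annihilator (e + f) \<noteq> annihilator e"
        using f(2) by blast
    qed
    then have "vs.dim (annihilator (e + f)) < vs.dim (annihilator e)"
      using ec fc(1) Nfin fin(2) by (intro vs.dim_strict_mono[OF sub sub]) auto
    then show False
      using min[OF ef] by simp
  qed
  then show ?thesis
    using that e by blast
qed

end

theorem decomposition:
  fixes A :: "('f::field_char_0, 'g::{finite,ab_group_add}, 'a::ab_group_add) gs_alg"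
  assumes "gs_algebra A" "finite_dimensional A" "excludes_A2_C2 A"
  shows "\<exists>N :: ('f, 'g, 'a) gs_alg. gs_algebra N \<and> nilpotent_alg N \<and>
    ((\<exists>C :: ('f, 'g, 'a) gs_alg. gs_algebra C \<and> commutative_alg C \<and> \<not> nilpotent_alg C \<and>
        trivial_involution C \<and> trivial_grading C \<and> T_equivalent A (alg_sum C N)) \<or> T_equivalent A N)"
proof -
  interpret gs_algebra A by fact
  obtain T where T: "finite T" "carrier A \<subseteq> vs.span T"
    using assms(2) by (auto simp: finite_dimensional_def)
  obtain e where e: "sym_idempotent e" "nilpotent_alg (sub_alg A (annihilator e))"
    using maximal_sym_idempotent[OF assms(3) T(2,1)] by blast
  have N: "gs_algebra (sub_alg A (annihilator e))"
    using gs_algebra_annihilator[OF assms(3) e(1)] .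
  show ?thesis
  proof (cases "e = 0")
    case True
    then have "annihilator e = carrier A"
      by (auto simp: annihilator_def)
    moreover have "sub_alg A (carrier A) = A"
      using homog_subset by (simp add: sub_alg_def Int_absorb2)
    ultimately show ?thesis
      using e(2) N by (intro exI[of _ A]) (simp add: T_equivalent_def)
  next
    case False
    have "T_equivalent A (alg_sum (sub_alg A (corner e)) (sub_alg A (annihilator e)))"
      unfolding T_equivalent_def
      by (rule gs_iso.iso_identities[OF gs_iso_Peirce[OF assms(3) e(1)]])
    then show ?thesis
      using N e(2) corner_alg[OF assms(3) e(1)] False by blast
  qed
qed

section \<open>Algebras whose long words are commutative\<close>

abbreviation triv :: "'g::zero \<times> parity" where
  "triv \<equiv> (0, Sym)"

text \<open>The property that C and N share for long words, that passes to direct sums and to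
  T-equivalent algebras, and from which both upper bounds are read off. The threshold
  \<open>k\<close> is there for the nilpotent summand.\<close>

definition long_words_trivial :: "('f::field_char_0, 'g::zero, 'a::ab_group_add) gs_alg \<Rightarrow> nat \<Rightarrow> bool" where
  "long_words_trivial A k \<longleftrightarrow>
     (\<forall>w. length w \<ge> k \<and> (\<exists>x\<in>set w. snd x \<noteq> triv) \<longrightarrow> Poly_Mapping.single w 1 \<in> identities A) \<and>
     (\<forall>w w'. length w \<ge> k \<and> mset w = mset w' \<longrightarrow>
        Poly_Mapping.single w 1 - Poly_Mapping.single w' 1 \<in> identities A)"

lemma alg_sum_identities:
  fixes C :: "('f::zero, 'g, 'a::ab_group_add) gs_alg" and N :: "('f, 'g, 'b::ab_group_add) gs_alg"
  shows "identities C \<inter> identities N \<subseteq> identities (alg_sum C N)"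
proof
  fix p assume p: "p \<in> identities C \<inter> identities N"
  have word: "word_prod (alg_sum C N) ps = (word_prod C (map fst ps), word_prod N (map snd ps))" for ps
    by (induction ps rule: induct_list012) (auto simp: alg_sum_def zero_prod_def)
  have eval: "poly_eval (alg_sum C N) \<phi> p = (poly_eval C (\<lambda>x. fst (\<phi> x)) p, poly_eval N (\<lambda>x. snd (\<phi> x)) p)" for \<phi>
    unfolding poly_eval_def
    by (rule prod_eqI) (simp_all add: fst_sum snd_sum word comp_def, simp_all add: alg_sum_def)
  show "p \<in> identities (alg_sum C N)"
  proof (rule identitiesI)
    show "Poly_Mapping.lookup p [] = 0"
      using p identities_no_empty_word by blast
    fix \<phi> :: "'g var \<Rightarrow> 'a \<times> 'b"
    assume \<phi>: "\<And>i v. \<phi> (i, v) \<in> homog_part (alg_sum C N) v"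
    have "homog_part (alg_sum C N) v \<subseteq> homog_part C v \<times> homog_part N v" for v
      by (cases v; cases "snd v") (auto simp: homog_part_def alg_sum_def)
    then have "fst (\<phi> (i, v)) \<in> homog_part C v" "snd (\<phi> (i, v)) \<in> homog_part N v" for i v
      using subsetD[OF _ \<phi>[of i v]] by (metis mem_Times_iff)+
    then show "poly_eval (alg_sum C N) \<phi> p = 0"
      using p identitiesD[of p C "\<lambda>x. fst (\<phi> x)"] identitiesD[of p N "\<lambda>x. snd (\<phi> x)"]
      by (simp add: eval zero_prod_def)
  qed
qed

context gs_algebra
begin

lemma long_words_trivial_if_nilpotent:
  assumes "nilpotent_alg A"
  obtains k where "k \<ge> 1" "\<And>j. j \<ge> k \<Longrightarrow> long_words_trivial A j"
proof -
  obtain k where k: "k \<ge> 1" "\<And>xs. \<lbrakk>length xs \<ge> k; set xs \<subseteq> carrier A\<rbrakk> \<Longrightarrow> word_prod A xs = 0"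
    using assms nil_set_word_prod[of "carrier A"] by (auto simp: nilpotent_alg_iff)
  have single: "Poly_Mapping.single w 1 \<in> identities A" if "length w \<ge> k" for w
  proof (rule identitiesI)
    show "Poly_Mapping.lookup (Poly_Mapping.single w 1) [] = (0::'f)"
      using that k(1) by (auto simp: lookup_single when_def)
    fix \<phi> :: "'g var \<Rightarrow> 'a"
    assume "\<And>i v. \<phi> (i, v) \<in> homog_part A v"
    then have "set (map \<phi> w) \<subseteq> carrier A"
      using homog_part_closed by fastforce
    then show "poly_eval A \<phi> (Poly_Mapping.single w 1) = 0"
      using that k(2)[of "map \<phi> w"] by simp
  qed
  have "long_words_trivial A j" if "j \<ge> k" for j
    unfolding long_words_trivial_def
    using single that vs.subspace_0 PM.subspace_diff[OF subspace_identities]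
    by (metis (no_types, lifting) le_trans mset_eq_length)
  then show ?thesis
    using that k(1) by blast
qed

lemma commutative_word_prod:
  assumes "commutative_alg A"
  shows "\<lbrakk>mset xs = mset ys; set xs \<subseteq> carrier A\<rbrakk> \<Longrightarrow> word_prod A xs = word_prod A ys"
proof (induction xs arbitrary: ys)
  case (Cons x xs)
  have comm: "mult A y z = mult A z y" if "y \<in> carrier A" "z \<in> carrier A" for y z
    using assms that by (simp add: commutative_alg_def)
  have "x \<in> set ys"
    using Cons.prems(1) by (metis list.set_intros(1) mset_eq_setD)
  then obtain as bs where ys: "ys = as @ x # bs"
    by (meson split_list)
  have ms: "mset xs = mset (as @ bs)"
    using Cons.prems(1) by (simp add: ys)
  have c: "x \<in> carrier A" "set as \<subseteq> carrier A" "set bs \<subseteq> carrier A"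
    using Cons.prems mset_eq_setD[OF ms] by auto
  have IH: "word_prod A xs = word_prod A (as @ bs)"
    using Cons.IH[OF ms] Cons.prems(2) by simp
  show ?case
  proof (cases "as = []")
    case True
    then have "xs = [] \<longleftrightarrow> bs = []"
      using ms by (metis append_Nil mset_zero_iff)
    then show ?thesis
      using True IH by (cases "bs = []") (simp_all add: ys word_prod_Cons)
  next
    case False
    have "word_prod A ys = mult A (word_prod A as) (word_prod A (x # bs))"
      using False c by (simp add: ys word_prod_append)
    also have "\<dots> = mult A x (word_prod A (as @ bs))"
    proof (cases "bs = []")
      case True
      then show ?thesis
        using c comm by simp
    next
      case bs: False
      have "mult A (word_prod A as) (word_prod A (x # bs)) =
          mult A (mult A (word_prod A as) x) (word_prod A bs)"
        using bs c by (simp add: word_prod_Cons mult_assoc)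
      also have "\<dots> = mult A (mult A x (word_prod A as)) (word_prod A bs)"
        using c comm by simp
      also have "\<dots> = mult A x (word_prod A (as @ bs))"
        using bs False c by (simp add: word_prod_append mult_assoc)
      finally show ?thesis .
    qed
    finally show ?thesis
      using ms IH False by (cases "xs = []") (auto simp: word_prod_Cons)
  qed
qed simp

lemma long_words_trivial_if_commutative:
  assumes "commutative_alg A" "trivial_involution A" "trivial_grading A" "k \<ge> 1"
  shows "long_words_trivial A k"
  unfolding long_words_trivial_def
proof (intro conjI allI impI; elim conjE)
  have zero: "x = 0" if "x \<in> homog_part A v" "v \<noteq> triv" for x v
  proof (cases "fst v = 0")
    case True
    then have v: "v = (0, Skew)"
      using that(2) by (cases v; cases "snd v") auto
    then have "star A x = - x" "x \<in> carrier A"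
      using that(1) homog_closed by (auto simp: homog_part_def)
    then have "x = - x"
      using assms(2) by (simp add: trivial_involution_def)
    then have "smul A 2 x = 0"
      by (metis one_add_one vs.scale_left_distrib vs.scale_one add.right_inverse)
    then show ?thesis
      by simp
  next
    case False
    have "x \<in> homog A (fst v)" "x \<in> homog A 0"
      using that(1) homog_part_closed[OF that(1)] assms(3)
      by (cases v; cases "snd v"; auto simp: homog_part_def trivial_grading_def)+
    then show ?thesis
      using homog_disjoint False by blast
  qed
  have closed: "set (map \<phi> w) \<subseteq> carrier A" if "\<And>i v. \<phi> (i, v) \<in> homog_part A v"
    for \<phi> :: "'g var \<Rightarrow> 'a" and w
    using that homog_part_closed by fastforce
  show "Poly_Mapping.single w 1 \<in> identities A"
    if w: "k \<le> length w" "\<exists>x\<in>set w. snd x \<noteq> triv" for w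
  proof (rule identitiesI)
    show "Poly_Mapping.lookup (Poly_Mapping.single w 1) [] = (0::'f)"
      using w(1) assms(4) by (auto simp: lookup_single when_def)
    fix \<phi> :: "'g var \<Rightarrow> 'a"
    assume \<phi>: "\<And>i v. \<phi> (i, v) \<in> homog_part A v"
    obtain x where x: "x \<in> set w" "snd x \<noteq> triv"
      using w(2) by blast
    have "\<phi> x = 0"
      using zero[of "\<phi> x" "snd x"] \<phi>[of "fst x" "snd x"] x(2) by simp
    then have "0 \<in> set (map \<phi> w)"
      using x(1) by force
    then show "poly_eval A \<phi> (Poly_Mapping.single w 1) = 0"
      using word_prod_eq_0[OF closed[OF \<phi>]] by simp
  qed
  show "Poly_Mapping.single w 1 - Poly_Mapping.single w' 1 \<in> identities A"
    if w: "k \<le> length w" "mset w = mset w'" for w w'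
  proof (rule identitiesI)
    have "w \<noteq> []" "w' \<noteq> []"
      using w assms(4) mset_eq_length[OF w(2)] by auto
    then show "Poly_Mapping.lookup (Poly_Mapping.single w 1 - Poly_Mapping.single w' 1) [] = (0::'f)"
      by (simp add: lookup_minus lookup_single when_def)
    fix \<phi> :: "'g var \<Rightarrow> 'a"
    assume \<phi>: "\<And>i v. \<phi> (i, v) \<in> homog_part A v"
    have "mset (map \<phi> w) = mset (map \<phi> w')"
      using w(2) by simp
    then have "word_prod A (map \<phi> w) = word_prod A (map \<phi> w')"
      using commutative_word_prod[OF assms(1)] closed[OF \<phi>] by blast
    then show "poly_eval A \<phi> (Poly_Mapping.single w 1 - Poly_Mapping.single w' 1) = 0"
      by (simp add: poly_eval_diff)
  qed
qed

end

lemma long_words_trivial_mono: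
  "\<lbrakk>long_words_trivial A k; identities A \<subseteq> identities B\<rbrakk> \<Longrightarrow> long_words_trivial B k"
  unfolding long_words_trivial_def by blast

section \<open>Codimensions\<close>

lemma finite_multilinear_words:
  "finite {w :: ('g::finite) var list. distinct (map fst w) \<and> set (map fst w) = {..<n}}"
proof (rule finite_subset)
  show "{w :: 'g var list. distinct (map fst w) \<and> set (map fst w) = {..<n}} \<subseteq>
      {w. set w \<subseteq> {..<n} \<times> UNIV \<and> length w = n}"
  proof clarify
    fix w :: "'g var list"
    assume w: "distinct (map fst w)" "set (map fst w) = {..<n}"
    have "length w = n"
      using distinct_card[OF w(1)] w(2) by simp
    moreover have "set w \<subseteq> {..<n} \<times> UNIV"
    proof
      fix x assume "x \<in> set w"
      then have "fst x \<in> {..<n}"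
        unfolding w(2)[symmetric] by simp
      then show "x \<in> {..<n} \<times> UNIV"
        by (cases x) simp
    qed
    ultimately show "set w \<subseteq> {..<n} \<times> UNIV \<and> length w = n"
      by blast
  qed
qed (intro finite_lists_length_eq finite_cartesian_product; simp)

lemma finite_multihomog_words:
  "finite {w :: ('g::finite) var list. distinct w \<and> set w = {(i, v) | i v. i < ns v}}"
proof (rule finite_subset)
  let ?S = "{(i, v) | i v. i < ns v} :: 'g var set"
  have "?S = (\<Union>v. (\<lambda>i. (i, v)) ` {..<ns v})"
    by auto
  then have "finite ?S"
    by simp
  then show "finite {w. set w \<subseteq> ?S \<and> length w = card ?S}"
    by (rule finite_lists_length_eq)
  show "{w. distinct w \<and> set w = ?S} \<subseteq> {w. set w \<subseteq> ?S \<and> length w = card ?S}"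
    using distinct_card by fastforce
qed

lemma word_span_quotient:
  fixes W :: "'w set" and I :: "('w \<Rightarrow>\<^sub>0 'f::field) set"
  assumes "finite W" "PM.subspace I"
  shows "PM.subspace (word_span W \<inter> I)"
    "word_span W \<subseteq> PM.span ((\<lambda>w. Poly_Mapping.single w (1::'f)) ` W)"
    "finite ((\<lambda>w. Poly_Mapping.single w (1::'f)) ` W)"
  using assms word_span_eq_span[of W] subspace_word_span by (auto intro: PM.subspace_inter)

lemma single_mem_word_span: "w \<in> W \<Longrightarrow> Poly_Mapping.single w 1 \<in> word_span W"
  by (simp add: word_span_def)

text \<open>The common form of both upper bounds: modulo \<open>I\<close> every admissible word is 0
  or equal to one fixed word.\<close>

lemma quot_dim_word_span_le_1:
  fixes W :: "'w set" and I :: "('w \<Rightarrow>\<^sub>0 'f::field) set"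
  assumes W: "finite W" "PM.subspace I" "w0 \<in> W"
    and red: "\<And>w. w \<in> W \<Longrightarrow> Poly_Mapping.single w 1 \<in> I \<or>
      Poly_Mapping.single w 1 - Poly_Mapping.single w0 1 \<in> I"
  shows "quot_dim (word_span W) (word_span W \<inter> I) \<le> 1"
proof (rule quot_dim_le_1[OF subspace_word_span _ _ word_span_quotient(2,3)[OF W(1,2)]])
  let ?w0 = "Poly_Mapping.single w0 1 :: 'w \<Rightarrow>\<^sub>0 'f"
  have "Poly_Mapping.single w 1 \<in> PM.span (insert ?w0 (word_span W \<inter> I))" if w: "w \<in> W" for w
    using red[OF w]
  proof
    assume "Poly_Mapping.single w 1 \<in> I"
    moreover have "Poly_Mapping.single w (1::'f) \<in> word_span W"
      by (rule single_mem_word_span[OF w])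
    ultimately show ?thesis
      by (intro PM.span_base) simp
  next
    assume "Poly_Mapping.single w 1 - ?w0 \<in> I"
    moreover have "Poly_Mapping.single w 1 - ?w0 \<in> word_span W"
      using single_mem_word_span w W(3) by (intro PM.subspace_diff[OF subspace_word_span])
    ultimately have "(Poly_Mapping.single w 1 - ?w0) + ?w0 \<in> PM.span (insert ?w0 (word_span W \<inter> I))"
      by (intro PM.span_add PM.span_base) auto
    then show ?thesis
      by simp
  qed
  then show "word_span W \<subseteq> PM.span (insert ?w0 (word_span W \<inter> I))"
    unfolding word_span_eq_span[of W] by (intro PM.span_minimal PM.subspace_span) blast
qed (use word_span_quotient(1)[OF W(1,2)] in auto)

definition triv_word :: "nat \<Rightarrow> ('g::zero) var list" where
  "triv_word n = map (\<lambda>i. (i, triv)) [0..<n]"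

lemma triv_word_props:
  "distinct (triv_word n)" "set (triv_word n) = {..<n} \<times> {triv}" "length (triv_word n) = n"
  "map fst (triv_word n) = [0..<n]"
  by (auto simp: triv_word_def distinct_map inj_on_def comp_def)

lemma (in gs_algebra) codim_le_1:
  assumes "long_words_trivial A k" "n \<ge> k"
  shows "codim A n \<le> 1"
  unfolding codim_def multilinear_polys_def
proof (rule quot_dim_word_span_le_1[OF finite_multilinear_words subspace_identities])
  let ?W = "{w :: 'g var list. distinct (map fst w) \<and> set (map fst w) = {..<n}}"
  show "triv_word n \<in> ?W"
    by (simp only: mem_Collect_eq triv_word_props) auto
  fix w :: "'g var list"
  assume "w \<in> ?W"
  then have w: "distinct (map fst w)" "set (map fst w) = {..<n}"
    by auto
  have len: "length w = n"
    using distinct_card[OF w(1)] w(2) by simp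
  show "Poly_Mapping.single w 1 \<in> identities A \<or>
      Poly_Mapping.single w 1 - Poly_Mapping.single (triv_word n) 1 \<in> identities A"
  proof (cases "\<exists>x\<in>set w. snd x \<noteq> triv")
    case True
    then show ?thesis
      using assms len by (simp add: long_words_trivial_def)
  next
    case False
    have "set w = {..<n} \<times> {triv}"
    proof
      show "set w \<subseteq> {..<n} \<times> {triv}"
        using False w(2) by force
      show "{..<n} \<times> {triv} \<subseteq> set w"
      proof
        fix y :: "'g var"
        assume "y \<in> {..<n} \<times> {triv}"
        then have y: "fst y \<in> fst ` set w" "snd y = triv"
          using w(2) by auto
        then obtain x where "x \<in> set w" "fst x = fst y"
          by fastforce
        then show "y \<in> set w"
          using False y(2) by (metis prod_eqI)
      qed
    qed
    then have "mset w = mset (triv_word n)"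
      using w(1) triv_word_props(1,2) by (metis distinct_map set_eq_iff_mset_eq_distinct)
    then show ?thesis
      using assms len by (simp add: long_words_trivial_def)
  qed
qed

section \<open>Lower bounds for algebras containing \<open>A\<^sub>2\<close> or \<open>C\<^sub>2\<close>\<close>

text \<open>The left unit is required to reproduce e z, not z: in A_2 the symmetric and skew radical
  elements are multiples of e12 + e34 and e12 - e34, and e turns both of these into e12, which it
  then fixes.\<close>

locale left_unit_pair = gs_algebra X
  for X :: "('f::field_char_0, 'g::{finite,ab_group_add}, 'a::ab_group_add) gs_alg" +
  fixes e z :: 'a and v :: "'g \<times> parity"
  assumes e_part: "e \<in> homog_part X triv" and z_part: "z \<in> homog_part X v" and v: "v \<noteq> triv"
    and ez: "mult X e z \<noteq> 0" "mult X e (mult X e z) = mult X e z"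
begin

lemma word_prod_left_unit: "word_prod X (replicate (Suc n) e @ [z]) = mult X e z"
  by (induction n) (simp_all add: word_prod_Cons ez)

lemma pw_left_unit_neq_0: "n \<noteq> 0 \<Longrightarrow> word_prod X (replicate n e) \<noteq> 0"
proof
  assume "n \<noteq> 0" "word_prod X (replicate n e) = 0"
  moreover have "e \<in> carrier X" "z \<in> carrier X"
    using e_part z_part homog_part_closed by auto
  moreover obtain m where "n = Suc m"
    using \<open>n \<noteq> 0\<close> by (cases n) auto
  ultimately have "word_prod X (replicate (Suc m) e @ [z]) = 0"
    by (subst word_prod_append) auto
  then show False
    using word_prod_left_unit ez(1) by simp
qed

definition subst :: "nat \<Rightarrow> 'g var \<Rightarrow> 'a" where
  "subst j x = (if snd x = triv then e else if snd x = v \<and> fst x = j then z else 0)"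

lemma subst_homog_part: "subst j (i, u) \<in> homog_part X u"
  using e_part z_part by (simp add: subst_def)

lemma subst_closed: "subst j x \<in> carrier X"
  using homog_part_closed[OF subst_homog_part[of j "fst x" "snd x"]] by simp

text \<open>These words are linearly independent modulo the identities of \<open>X\<close>: \<open>subst j\<close> kills all but
  one of them.\<close>

definition last_word :: "nat \<Rightarrow> nat \<Rightarrow> 'g var list" where
  "last_word n j = map (\<lambda>i. (i, triv)) (filter (\<lambda>i. i \<noteq> j) [0..<n]) @ [(j, v)]"

text \<open>The bound \<open>2 \<le> n\<close> guarantees at least one letter e before z; a lone
  letter would evaluate to z instead of e z.\<close>

lemma last_word_eval:
  assumes "2 \<le> n" "i < n" "j < n"
  shows "word_prod X (map (subst j) (last_word n i)) = (if i = j then mult X e z else 0)"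
proof (cases "i = j")
  case True
  have "length (filter (\<lambda>i. i \<noteq> j) [0..<n]) = card {i. i \<noteq> j \<and> i < n}"
    using distinct_card[of "filter (\<lambda>i. i \<noteq> j) [0..<n]"] by (simp add: conj_commute Int_def)
  also have "{i. i \<noteq> j \<and> i < n} = {..<n} - {j}"
    by auto
  finally have "length (filter (\<lambda>i. i \<noteq> j) [0..<n]) = n - 1"
    using assms(3) by simp
  moreover obtain m where "n - 1 = Suc m"
    using assms(1) by (cases "n - 1") auto
  moreover have "map (subst j) (last_word n i) = replicate (length (filter (\<lambda>i. i \<noteq> j) [0..<n])) e @ [z]"
    using v True by (simp add: last_word_def subst_def comp_def map_replicate_const)
  ultimately show ?thesis
    using word_prod_left_unit True by simp
next
  case False
  have "subst j (i, v) = 0"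
    using v False by (simp add: subst_def)
  then have "0 \<in> set (map (subst j) (last_word n i))"
    by (simp add: last_word_def)
  moreover have "set (map (subst j) (last_word n i)) \<subseteq> carrier X"
    using subst_closed by auto
  ultimately show ?thesis
    using word_prod_eq_0 False by simp
qed

lemma codim_ge:
  fixes A :: "('f, 'g, 'c::ab_group_add) gs_alg"
  assumes "gs_algebra A" "identities A \<subseteq> identities X" "2 \<le> n"
  shows "n \<le> codim A n"
  unfolding codim_def multilinear_polys_def
proof (rule quot_dim_ge[OF subspace_word_span _ _ word_span_quotient(2,3)[OF finite_multilinear_words
        gs_algebra.subspace_identities[OF assms(1)]]])
  interpret A: gs_algebra A by fact
  let ?W = "{w :: 'g var list. distinct (map fst w) \<and> set (map fst w) = {..<n}}"
  show "PM.subspace (word_span ?W \<inter> identities A)"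
    by (rule word_span_quotient(1)[OF finite_multilinear_words A.subspace_identities])
  show "Poly_Mapping.single (last_word n j) 1 \<in> word_span ?W" if "j < n" for j
  proof (rule single_mem_word_span)
    have fst: "map fst (last_word n j) = filter (\<lambda>i. i \<noteq> j) [0..<n] @ [j]"
      by (simp add: last_word_def comp_def)
    show "last_word n j \<in> ?W"
      by (simp only: mem_Collect_eq fst) (use that in auto)
  qed
  fix c j
  assume "(\<Sum>j<n. pm_scale (c j) (Poly_Mapping.single (last_word n j) 1)) \<in> word_span ?W \<inter> identities A"
    and j: "j < n"
  then have "(\<Sum>j<n. pm_scale (c j) (Poly_Mapping.single (last_word n j) 1)) \<in> identities X"
    using assms(2) by blast
  from identitiesD[OF this subst_homog_part]
  have "0 = (\<Sum>i<n. smul X (c i) (word_prod X (map (subst j) (last_word n i))))"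
    by (simp add: poly_eval_sum poly_eval_scale)
  also have "\<dots> = (\<Sum>i\<in>{j}. smul X (c i) (mult X e z))"
    using assms(3) j by (intro sum.mono_neutral_cong_right) (auto simp: last_word_eval)
  finally show "c j = 0"
    using ez(1) by simp
qed simp

text \<open>Witnesses for two nonzero cocharacters in different multidegrees. In a multihomogeneous
  component each type numbers its variables from 0, hence the index 0 of the last letter besides the
  variable 0 of type \<open>triv\<close>.\<close>

lemma words_not_identities:
  assumes "2 \<le> n"
  shows "Poly_Mapping.single (triv_word n) 1 \<notin> identities X"
    "Poly_Mapping.single (triv_word (n - 1) @ [(0, v)]) 1 \<notin> identities X"
proof -
  have triv: "map (subst 0) (triv_word m) = replicate m e" for m
    by (simp add: triv_word_def subst_def comp_def map_replicate_const)
  show "Poly_Mapping.single (triv_word n) 1 \<notin> identities X"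
  proof
    assume "Poly_Mapping.single (triv_word n) 1 \<in> identities X"
    from identitiesD[OF this subst_homog_part[of 0]] show False
      using pw_left_unit_neq_0[of n] assms by (simp add: triv)
  qed
  obtain m where m: "n - 1 = Suc m"
    using assms by (cases "n - 1") auto
  show "Poly_Mapping.single (triv_word (n - 1) @ [(0, v)]) 1 \<notin> identities X"
  proof
    assume "Poly_Mapping.single (triv_word (n - 1) @ [(0, v)]) 1 \<in> identities X"
    moreover have "subst 0 (0, v) = z"
      using v by (simp add: subst_def)
    ultimately have "word_prod X (replicate (Suc m) e @ [z]) = 0"
      using identitiesD[OF _ subst_homog_part[of 0], of "Poly_Mapping.single (triv_word (n - 1) @ [(0, v)]) 1"]
      unfolding m by (simp add: triv del: replicate_Suc)
    then show False
      using word_prod_left_unit ez(1) by simp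
  qed
qed

end

lemma not_excludes_A2_C2:
  fixes A :: "('f::field_char_0, 'g::{finite,ab_group_add}, 'a::ab_group_add) gs_alg"
  assumes A: "gs_algebra A" and ex: "\<not> excludes_A2_C2 A"
  shows "\<exists>v. v \<noteq> triv \<and> (\<forall>n\<ge>2. n \<le> codim A n \<and> Poly_Mapping.single (triv_word n) 1 \<notin> identities A \<and>
    Poly_Mapping.single (triv_word (n - 1) @ [(0, v)]) 1 \<notin> identities A)"
proof -
  have *: ?thesis if "left_unit_pair X e z v" "in_var X A"
    for X :: "('f, 'g, 'x::ab_group_add) gs_alg" and e z v
  proof -
    interpret left_unit_pair X e z v by fact
    show ?thesis
      using codim_ge[OF A] words_not_identities v that(2) unfolding in_var_def by blast
  qed
  have a2: "a2 1 0 0 \<in> {a2 a 0 0 | a. True}" "a2 0 1 c \<in> {a2 0 b c | b c. True}" for c :: 'f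
    by blast+
  have c2: "c2 1 0 \<in> {c2 a 0 | a. True}" "(c2 0 1 :: 'f^2^2) \<in> {c2 0 b | b. True}"
    by blast+
  have A2_space: "a2 a b c \<in> A2_space" and C2_space: "c2 a b \<in> C2_space" for a b c :: 'f
    unfolding A2_space_eq C2_space_eq by blast+
  have neg: "- a2 0 1 (- 1) = (a2 0 (- 1) 1 :: 'f^4^4)" "- c2 0 1 = (c2 0 (- 1) :: 'f^2^2)"
    using a2_scale[of "- 1" 0 1 "- 1 :: 'f"] c2_scale[of "- 1" 0 "1 :: 'f"]
    by (simp_all add: MS.scale_minus_left)
  have neq: "a2 0 1 0 \<noteq> (0 :: 'f^4^4)" "c2 0 1 \<noteq> (0 :: 'f^2^2)"
    using a2_eq_iff[of 0 1 0 0 0 "0 :: 'f"] c2_eq_iff[of 0 1 0 "0 :: 'f"] by simp_all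
  consider "in_var A2_star A" | "in_var C2_star A" | g where "g \<noteq> 0" "in_var (A2_gr g) A"
    | g where "g \<noteq> 0" "in_var (C2_gr g) A" | g where "g \<noteq> 0" "in_var (C2_star_gr g) A"
    using ex unfolding excludes_A2_C2_def by blast
  then show ?thesis
  proof cases
    case 1
    \<comment> \<open>Under the trivial grading e12 + e34 would have the excluded type
      \<open>triv\<close>, so the skew combination e12 - e34 is taken.\<close>
    have "left_unit_pair (A2_star :: ('f, 'g, 'f^4^4) gs_alg) (a2 1 0 0) (a2 0 1 (- 1)) (0, Skew)"
      by (intro left_unit_pair.intro left_unit_pair_axioms.intro gs_algebra_A2_star)
        (auto simp: homog_part_def A2_star_def A2_space a2_mult a2_reflection neg neq)
    then show ?thesis
      using 1 by (rule *)
  next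
    case 2
    have "left_unit_pair (C2_star :: ('f, 'g, 'f^2^2) gs_alg) (c2 1 0) (c2 0 1) (0, Skew)"
      by (intro left_unit_pair.intro left_unit_pair_axioms.intro gs_algebra_C2_star)
        (auto simp: homog_part_def C2_star_def C2_space c2_mult c2_invol neg neq)
    then show ?thesis
      using 2 by (rule *)
  next
    case (3 g)
    have "left_unit_pair (A2_gr g :: ('f, 'g, 'f^4^4) gs_alg) (a2 1 0 0) (a2 0 1 1) (g, Sym)"
      using 3 a2 by (intro left_unit_pair.intro left_unit_pair_axioms.intro gs_algebra_A2_gr)
        (auto simp: homog_part_def A2_gr_def A2_span_unit A2_span_radical a2_mult a2_reflection neq)
    then show ?thesis
      using 3(2) by (rule *)
  next
    case (4 g)
    have "left_unit_pair (C2_gr g :: ('f, 'g, 'f^2^2) gs_alg) (c2 1 0) (c2 0 1) (g, Sym)"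
      using 4 c2 by (intro left_unit_pair.intro left_unit_pair_axioms.intro gs_algebra_C2_gr)
        (auto simp: homog_part_def C2_gr_def C2_homog_def C2_span_unit C2_span_radical c2_mult neq)
    then show ?thesis
      using 4(2) by (rule *)
  next
    case (5 g)
    have "left_unit_pair (C2_star_gr g :: ('f, 'g, 'f^2^2) gs_alg) (c2 1 0) (c2 0 1) (g, Skew)"
      using 5 c2 by (intro left_unit_pair.intro left_unit_pair_axioms.intro gs_algebra_C2_star_gr)
        (auto simp: homog_part_def C2_star_gr_def C2_homog_def C2_span_unit C2_span_radical
          c2_mult c2_invol neg neq)
    then show ?thesis
      using 5(2) by (rule *)
  qed
qed

section \<open>Colengths\<close>

lemma pm_push_superset:
  assumes "finite S" "Poly_Mapping.keys p \<subseteq> S"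
  shows "pm_push h p = (\<Sum>w\<in>S. Poly_Mapping.single (h w) (Poly_Mapping.lookup p w))"
  unfolding pm_push_def using assms by (intro sum.mono_neutral_left) (auto simp: in_keys_iff)

lemma single_eq_pm_scale: "Poly_Mapping.single w c = pm_scale c (Poly_Mapping.single w 1)"
  by (rule poly_mapping_eqI) (simp add: lookup_single when_def)

lemma pm_push_minus_self:
  fixes p :: "'w \<Rightarrow>\<^sub>0 'f::field"
  shows "pm_push h p - p =
    (\<Sum>w\<in>Poly_Mapping.keys p. pm_scale (Poly_Mapping.lookup p w)
      (Poly_Mapping.single (h w) 1 - Poly_Mapping.single w 1))"
proof -
  have "pm_push h p - p = (\<Sum>w\<in>Poly_Mapping.keys p. pm_scale (Poly_Mapping.lookup p w) (Poly_Mapping.single (h w) 1)) -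
      (\<Sum>w\<in>Poly_Mapping.keys p. pm_scale (Poly_Mapping.lookup p w) (Poly_Mapping.single w 1))"
    unfolding pm_push_def using poly_mapping_eq_sum_single[of p] single_eq_pm_scale
    by (metis (no_types, lifting) sum.cong)
  then show ?thesis
    by (simp add: PM.scale_right_diff_distrib sum_subtractf)
qed

text \<open>The Young symmetrizer is the sum of all permutations, and left translation permutes its
  terms; so the left ideal is a line with trivial action. Hypotheses on the stabilizers let the
  partitions \<open>[n]\<close> and \<open>[]\<close> share the argument.\<close>

lemma irr_char_one_row:
  assumes row: "row_stabilizer lam = {\<sigma>. \<sigma> permutes {..<n}}" and col: "col_stabilizer lam = {id}"
    and n: "sum_list lam = n" and \<sigma>: "\<sigma> permutes {..<n}"
  shows "(irr_char lam \<sigma> :: 'f::field) = 1"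
proof -
  define P where "P = {\<sigma>. \<sigma> permutes {..<n}}"
  define s :: "(nat \<Rightarrow> nat) \<Rightarrow>\<^sub>0 'f" where "s = (\<Sum>\<rho>\<in>P. Poly_Mapping.single \<rho> 1)"
  have finP: "finite P"
    by (simp add: P_def finite_permutations)
  have ys: "young_symmetrizer lam = s"
    by (simp add: young_symmetrizer_def row col s_def P_def sign_id)
  have lookup_s: "Poly_Mapping.lookup s \<tau> = (if \<tau> \<in> P then 1 else 0)" for \<tau>
    using finP by (simp add: s_def lookup_sum lookup_single when_def)
  have keys_s: "Poly_Mapping.keys s = P"
    by (auto simp: in_keys_iff lookup_s split: if_splits)
  have idP: "id \<in> P"
    by (simp add: P_def permutes_id)
  have shift: "(\<Sum>\<tau>\<in>P. Poly_Mapping.single (\<rho> \<circ> \<tau>) c) = pm_scale c s" if \<rho>: "\<rho> \<in> P" for \<rho> c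
  proof -
    have bij: "bij_betw ((\<circ>) \<rho>) P P"
      unfolding P_def
    proof (rule bij_betwI[of _ _ _ "(\<circ>) (inv \<rho>)"])
      have \<rho>': "\<rho> permutes {..<n}"
        using \<rho> by (simp add: P_def)
      show "(\<circ>) \<rho> \<in> {\<sigma>. \<sigma> permutes {..<n}} \<rightarrow> {\<sigma>. \<sigma> permutes {..<n}}"
        using \<rho>' by (auto intro: permutes_compose)
      show "(\<circ>) (inv \<rho>) \<in> {\<sigma>. \<sigma> permutes {..<n}} \<rightarrow> {\<sigma>. \<sigma> permutes {..<n}}"
        using permutes_inv[OF \<rho>'] by (auto intro: permutes_compose)
      show "inv \<rho> \<circ> (\<rho> \<circ> \<tau>) = \<tau>" "\<rho> \<circ> (inv \<rho> \<circ> \<tau>) = \<tau>" for \<tau>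
        using permutes_inv_o[OF \<rho>'] by (simp_all add: o_assoc)
    qed
    have "(\<Sum>\<tau>\<in>P. Poly_Mapping.single (\<rho> \<circ> \<tau>) c) = (\<Sum>\<tau>\<in>P. Poly_Mapping.single \<tau> c)"
      using sum.reindex_bij_betw[OF bij, of "\<lambda>\<tau>. Poly_Mapping.single \<tau> c"] by simp
    also have "\<dots> = pm_scale c s"
      unfolding s_def PM.scale_sum_right using single_eq_pm_scale by (metis (no_types, lifting) sum.cong)
    finally show ?thesis .
  qed
  have ideal: "young_ideal lam = PM.span {s}"
  proof
    show "young_ideal lam \<subseteq> PM.span {s}"
    proof
      fix x :: "(nat \<Rightarrow> nat) \<Rightarrow>\<^sub>0 'f"
      assume "x \<in> young_ideal lam"
      then obtain a where a: "a \<in> word_span P" "x = ga_mult a s"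
        by (auto simp: young_ideal_def ys P_def n)
      have "x = (\<Sum>\<rho>\<in>Poly_Mapping.keys a. pm_scale (Poly_Mapping.lookup a \<rho>) s)"
        unfolding a(2) ga_mult_def keys_s
      proof (intro sum.cong refl)
        fix \<rho> assume "\<rho> \<in> Poly_Mapping.keys a"
        then have "\<rho> \<in> P"
          using a(1) by (auto simp: word_span_def)
        then show "(\<Sum>\<tau>\<in>P. Poly_Mapping.single (\<rho> \<circ> \<tau>) (Poly_Mapping.lookup a \<rho> * Poly_Mapping.lookup s \<tau>)) =
            pm_scale (Poly_Mapping.lookup a \<rho>) s"
          by (subst shift[symmetric]) (auto simp: lookup_s)
      qed
      also have "\<dots> \<in> PM.span {s}"
        by (intro PM.span_sum PM.span_scale PM.span_base) simp
      finally show "x \<in> PM.span {s}" .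
    qed
    show "PM.span {s} \<subseteq> young_ideal lam"
    proof
      fix x assume "x \<in> PM.span {s}"
      then obtain c where x: "x = pm_scale c s"
        unfolding PM.span_singleton by blast
      have "ga_mult (Poly_Mapping.single id c) s = pm_scale c s"
      proof (cases "c = 0")
        case False
        then have "ga_mult (Poly_Mapping.single id c) s = (\<Sum>\<tau>\<in>P. Poly_Mapping.single (id \<circ> \<tau>) c)"
          by (simp add: ga_mult_def keys_s lookup_s)
        then show ?thesis
          using shift[OF idP] by simp
      qed (simp add: ga_mult_def)
      moreover have "Poly_Mapping.single id c \<in> word_span P"
        using idP by (simp add: word_span_def)
      ultimately show "x \<in> young_ideal lam"
        unfolding young_ideal_def ys n P_def[symmetric] x by (metis image_eqI)
    qed
  qed
  have "s \<noteq> 0"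
    using lookup_s[of id] idP by auto
  then have ind: "PM.independent {s}"
    by simp
  have "PM.subspace (PM.span {s})" "PM.subspace {0 :: (nat \<Rightarrow> nat) \<Rightarrow>\<^sub>0 'f}" "{0} \<subseteq> PM.span {s}"
      "PM.span {s} \<subseteq> PM.span {s}" "finite {s}"
    by (auto simp: PM.span_zero)
  note quot = this
  have "PM.dim {0 :: (nat \<Rightarrow> nat) \<Rightarrow>\<^sub>0 'f} = 0"
    using PM.dim_span_eq_card_independent[OF PM.independent_empty] by simp
  moreover have "PM.dim (PM.span {s}) = 1"
    using PM.dim_span_eq_card_independent[OF ind] by simp
  ultimately have dim: "quot_dim (PM.span {s}) {0} = 1"
    using quot_dim_add_dim[OF quot] by simp
  have "quot_trace (PM.span {s}) {0} (pm_push ((\<circ>) \<sigma>)) = of_nat (quot_dim (PM.span {s}) {0})"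
  proof (rule quot_trace_trivial[OF quot])
    fix b assume "b \<in> PM.span {s}"
    then obtain c where b: "b = pm_scale c s"
      unfolding PM.span_singleton by blast
    have "Poly_Mapping.keys b \<subseteq> P"
      by (auto simp: b in_keys_iff lookup_s split: if_splits)
    then have "pm_push ((\<circ>) \<sigma>) b = (\<Sum>\<tau>\<in>P. Poly_Mapping.single (\<sigma> \<circ> \<tau>) (Poly_Mapping.lookup b \<tau>))"
      by (rule pm_push_superset[OF finP])
    also have "\<dots> = (\<Sum>\<tau>\<in>P. Poly_Mapping.single (\<sigma> \<circ> \<tau>) c)"
      by (intro sum.cong) (auto simp: b lookup_s)
    also have "\<dots> = b"
      using shift[of \<sigma> c] \<sigma> by (simp add: P_def b)
    finally show "pm_push ((\<circ>) \<sigma>) b - b \<in> {0}"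
      by simp
  qed
  then show ?thesis
    by (simp add: irr_char_def ideal dim)
qed

lemma irr_char_row: "n \<noteq> 0 \<Longrightarrow> \<sigma> permutes {..<n} \<Longrightarrow> (irr_char [n] \<sigma> :: 'f::field) = 1"
proof (rule irr_char_one_row)
  have row: "tab_row [n] k = 0" if "k < n" for k
    unfolding tab_row_def using that by (intro Least_eq_0) simp
  then show "row_stabilizer [n] = {\<sigma>. \<sigma> permutes {..<n}}"
    by (auto simp: row_stabilizer_def dest: permutes_in_image[where x = "_::nat"])
  have col: "tab_col [n] k = k" if "k < n" for k
    using row[OF that] by (simp add: tab_col_def)
  show "col_stabilizer [n] = {id}"
  proof
    show "col_stabilizer [n] \<subseteq> {id}"
    proof
      fix \<sigma> assume "\<sigma> \<in> col_stabilizer [n]"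
      then have p: "\<sigma> permutes {..<n}" and c: "\<And>k. k < n \<Longrightarrow> tab_col [n] (\<sigma> k) = tab_col [n] k"
        by (auto simp: col_stabilizer_def)
      have "\<sigma> k = k" for k
      proof (cases "k < n")
        case True
        then have "\<sigma> k < n"
          using permutes_in_image[OF p, of k] by simp
        then show ?thesis
          using c[OF True] True col by simp
      next
        case False
        then show ?thesis
          using permutes_not_in[OF p, of k] by simp
      qed
      then show "\<sigma> \<in> {id}"
        by auto
    qed
  qed (simp add: col_stabilizer_def permutes_id)
qed simp_all

text \<open>Types without variables carry the empty partition and must contribute the factor 1 to
  the product of characters.\<close>

lemma irr_char_Nil: "\<sigma> permutes {..<0::nat} \<Longrightarrow> (irr_char [] \<sigma> :: 'f::field) = 1"
  by (rule irr_char_one_row[where n = 0]) (auto simp: row_stabilizer_def col_stabilizer_def)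

text \<open>A sum over an infinite set is 0 by convention, so the index sets of the colength have to
  be known finite before single summands can be isolated.\<close>

lemma finite_multidegrees: "finite (multidegrees n :: ('g::finite) multidegree set)"
proof (rule finite_subset)
  show "multidegrees n \<subseteq> (Pi UNIV (\<lambda>_. {..n}) :: 'g multidegree set)"
  proof
    fix ns :: "'g multidegree"
    assume ns: "ns \<in> multidegrees n"
    have "ns v \<le> n" for v
      using member_le_sum[of v UNIV ns] ns by (simp add: multidegrees_def)
    then show "ns \<in> Pi UNIV (\<lambda>_. {..n})"
      by simp
  qed
  have "finite (PiE UNIV (\<lambda>_. {..n}) :: 'g multidegree set)"
    by (rule finite_PiE) simp_all
  then show "finite (Pi UNIV (\<lambda>_. {..n}) :: 'g multidegree set)"
    by (simp add: PiE_UNIV_domain)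
qed

lemma finite_partitions: "finite {lam. is_partition lam n}"
proof (rule finite_subset)
  have "length lam \<le> sum_list lam" if "0 \<notin> set lam" for lam :: "nat list"
    using that by (induction lam) auto
  moreover have "x \<le> sum_list lam" if "x \<in> set lam" for x and lam :: "nat list"
    using that by (induction lam) auto
  ultimately show "{lam. is_partition lam n} \<subseteq> {xs. set xs \<subseteq> {..n} \<and> length xs \<le> n}"
    by (auto simp: is_partition_def)
qed (simp add: finite_lists_length_le)

lemma finite_multipartitions: "finite (multipartitions (ns :: ('g::finite) multidegree))"
proof -
  have "finite (PiE UNIV (\<lambda>v. {lam. is_partition lam (ns v)}))"
    by (rule finite_PiE) (simp_all add: finite_partitions)
  moreover have "multipartitions ns = Pi UNIV (\<lambda>v. {lam. is_partition lam (ns v)})"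
    by (auto simp: multipartitions_def)
  ultimately show ?thesis
    by (simp add: PiE_UNIV_domain)
qed

lemma card_multihomog:
  fixes ns :: "('g::finite) multidegree"
  shows "card {(i, v) | i v. i < ns v} = (\<Sum>v\<in>UNIV. ns v)"
proof -
  have "{(i, v) | i v. i < ns v} = (\<lambda>(v, i). (i, v)) ` (SIGMA v:UNIV. {..<ns v})"
    by (auto simp: image_iff)
  then have "card {(i, v) | i v. i < ns v} = card (SIGMA v:UNIV. {..<ns v})"
    by (simp add: card_image inj_on_def)
  then show ?thesis
    by simp
qed

context gs_algebra
begin

abbreviation hom_words :: "'g multidegree \<Rightarrow> 'g var list set" where
  "hom_words ns \<equiv> {w. distinct w \<and> set w = {(i, v) | i v. i < ns v}}"

lemmas multihomog_quotient =
  subspace_word_span word_span_quotient(1)[OF finite_multihomog_words subspace_identities] Int_lower1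
  word_span_quotient(2,3)[OF finite_multihomog_words subspace_identities]

text \<open>At the identity permutation the cocharacter is the dimension of the quotient, nonzero in
  characteristic 0 if some word survives; with all multiplicities 0 it would vanish.\<close>

lemma multiplicity_exists:
  assumes m: "multiplicities A ns m" and w: "w \<in> hom_words ns" "Poly_Mapping.single w 1 \<notin> identities A"
  shows "\<exists>lam\<in>multipartitions ns. m lam \<noteq> 0"
proof (rule ccontr)
  let ?V = "word_span (hom_words ns) :: ('f, 'g) gs_poly set"
  assume "\<not> ?thesis"
  moreover have "(\<lambda>v. id) \<in> young_group ns"
    by (simp add: young_group_def permutes_id)
  ultimately have "cocharacter A ns (\<lambda>v. id) = 0"
    using m by (simp add: multiplicities_def)
  moreover have "cocharacter A ns (\<lambda>v. id) = of_nat (quot_dim ?V (?V \<inter> identities A))"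
    unfolding cocharacter_def multihomog_polys_def
  proof (rule quot_trace_trivial[OF multihomog_quotient])
    fix b assume "b \<in> ?V"
    have "(\<lambda>(i, v). (id i, v)) = (\<lambda>x :: 'g var. x)"
      by auto
    then have "pm_push (map (\<lambda>(i, v). (id i, v))) b - b = 0"
      by (simp add: pm_push_minus_self)
    then show "pm_push (map (\<lambda>(i, v). (id i, v))) b - b \<in> ?V \<inter> identities A"
      using PM.subspace_0[OF multihomog_quotient(2)] by simp
  qed
  ultimately have "quot_dim ?V (?V \<inter> identities A) = 0"
    by simp
  then have "?V \<subseteq> identities A"
    using quot_dim_eq_0_iff[OF multihomog_quotient, of ns] by blast
  then show False
    using w single_mem_word_span[OF w(1)] by blast
qed

lemma colength_ge_2:
  assumes v: "v \<noteq> triv" and n: "2 \<le> n"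
    and w: "Poly_Mapping.single (triv_word n) 1 \<notin> identities A"
      "Poly_Mapping.single (triv_word (n - 1) @ [(0, v)]) 1 \<notin> identities A"
    and l: "has_colength A n l"
  shows "2 \<le> l"
proof -
  obtain m where m: "\<And>ns. ns \<in> multidegrees n \<Longrightarrow> multiplicities A ns (m ns)"
      "l = (\<Sum>ns\<in>multidegrees n. \<Sum>lam\<in>multipartitions ns. m ns lam)"
    using l by (auto simp: has_colength_def)
  define ns1 :: "'g multidegree" where "ns1 = (\<lambda>u. if u = triv then n else 0)"
  define ns2 :: "'g multidegree" where "ns2 = (\<lambda>u. if u = triv then n - 1 else if u = v then 1 else 0)"
  have "(\<Sum>u\<in>UNIV. ns2 u) = (\<Sum>u\<in>{triv, v}. ns2 u)"
    by (intro sum.mono_neutral_right) (auto simp: ns2_def)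
  then have deg: "ns1 \<in> multidegrees n" "ns2 \<in> multidegrees n"
    using v n by (auto simp: multidegrees_def ns1_def ns2_def)
  have w1: "triv_word n \<in> hom_words ns1"
    by (auto simp: triv_word_props ns1_def split: if_splits)
  have w2: "triv_word (n - 1) @ [(0, v)] \<in> hom_words ns2"
    using v by (auto simp: triv_word_props ns2_def split: if_splits)
  have ge: "1 \<le> (\<Sum>lam\<in>multipartitions ns. m ns lam)" if "\<exists>lam\<in>multipartitions ns. m ns lam \<noteq> 0" for ns
    using that finite_multipartitions[of ns] by (simp add: Suc_le_eq) (meson sum_pos2 neq0_conv zero_le)
  have "ns1 triv \<noteq> ns2 triv"
    using n by (simp add: ns1_def ns2_def)
  then have neq: "ns1 \<noteq> ns2"
    by metis
  have "2 \<le> (\<Sum>lam\<in>multipartitions ns1. m ns1 lam) + (\<Sum>lam\<in>multipartitions ns2. m ns2 lam)"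
    using ge[OF multiplicity_exists[OF m(1)[OF deg(1)] w1 w(1)]]
      ge[OF multiplicity_exists[OF m(1)[OF deg(2)] w2 w(2)]] by simp
  also have "\<dots> = (\<Sum>ns\<in>{ns1, ns2}. \<Sum>lam\<in>multipartitions ns. m ns lam)"
    using neq by simp
  also have "\<dots> \<le> l"
    unfolding m(2) using deg finite_multidegrees by (intro sum_mono2) auto
  finally show ?thesis .
qed

text \<open>Only the multidegree with all variables of type \<open>triv\<close> can survive. There
  the quotient has dimension \<open>q\<close> at most 1 with trivial action, so multiplicity
  \<open>q\<close> at the one-row partition and 0 elsewhere solves all character equations.\<close>

lemma colength_le_1:
  assumes lw: "long_words_trivial A k" and n: "n \<ge> k" "n \<noteq> 0"
  shows "\<exists>l. has_colength A n l \<and> l \<le> 1"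
proof -
  define ns1 :: "'g multidegree" where "ns1 = (\<lambda>u. if u = triv then n else 0)"
  define lam1 :: "'g \<times> parity \<Rightarrow> nat list" where "lam1 = (\<lambda>u. if u = triv then [n] else [])"
  let ?V = "\<lambda>ns. word_span (hom_words ns) :: ('f, 'g) gs_poly set"
  define q where "q = quot_dim (?V ns1) (?V ns1 \<inter> identities A)"
  define m where "m ns lam = (if ns = ns1 \<and> lam = lam1 then q else 0)" for ns lam
  have ns1: "ns1 \<in> multidegrees n"
    by (simp add: multidegrees_def ns1_def)
  have lam1: "lam1 \<in> multipartitions ns1"
    using n(2) by (simp add: multipartitions_def lam1_def ns1_def is_partition_def)
  have len: "length w = n" if "w \<in> hom_words ns" "ns \<in> multidegrees n" for w ns
    using that distinct_card[of w] card_multihomog[of ns] by (simp add: multidegrees_def)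
  have same: "Poly_Mapping.single w' 1 - Poly_Mapping.single w 1 \<in> identities A"
    if "w \<in> hom_words ns1" "w' \<in> hom_words ns1" for w w'
  proof -
    have "mset w' = mset w"
      using that by (metis (mono_tags, lifting) mem_Collect_eq set_eq_iff_mset_eq_distinct)
    then show ?thesis
      using lw n(1) len[OF that(2) ns1] by (simp add: long_words_trivial_def)
  qed
  have w1: "triv_word n \<in> hom_words ns1"
    by (auto simp: triv_word_props ns1_def split: if_splits)
  have q: "q \<le> 1"
    unfolding q_def
    using same[OF w1] by (intro quot_dim_word_span_le_1[OF finite_multihomog_words subspace_identities w1]) blast
  have "multiplicities A ns (m ns)" if ns: "ns \<in> multidegrees n" for ns
    unfolding multiplicities_def
  proof
    fix \<sigma> assume \<sigma>: "\<sigma> \<in> young_group ns"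
    show "cocharacter A ns \<sigma> =
        (\<Sum>lam\<in>multipartitions ns. of_nat (m ns lam) * (\<Prod>v\<in>UNIV. irr_char (lam v) (\<sigma> v)))"
    proof (cases "ns = ns1")
      \<comment> \<open>Another multidegree of the same total involves a type different from
        \<open>triv\<close>, so all its words are identities.\<close>
      case False
      have "\<exists>u. u \<noteq> triv \<and> ns u \<noteq> 0"
      proof (rule ccontr)
        assume "\<not> ?thesis"
        then have zero: "ns u = 0" if "u \<noteq> triv" for u
          using that by blast
        have "(\<Sum>u\<in>UNIV. ns u) = (\<Sum>u\<in>{triv}. ns u)"
          by (rule sum.mono_neutral_right) (simp, simp, rule ballI, rule zero, simp)
        then have "ns triv = n"
          using ns by (simp add: multidegrees_def)
        then have "ns u = ns1 u" for u
          using zero by (cases "u = triv") (simp_all add: ns1_def)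
        then have "ns = ns1"
          by (rule ext)
        then show False
          using False by simp
      qed
      then obtain u where u: "u \<noteq> triv" "ns u \<noteq> 0"
        by blast
      have "Poly_Mapping.single w 1 \<in> identities A" if w: "w \<in> hom_words ns" for w
      proof -
        have "(0, u) \<in> set w"
          using w u(2) by (cases u) auto
        then show ?thesis
          using lw n(1) len[OF w ns] u(1) unfolding long_words_trivial_def by (metis snd_conv)
      qed
      then have "?V ns \<subseteq> identities A"
        unfolding word_span_eq_span by (intro PM.span_minimal subspace_identities) auto
      then have "?V ns \<inter> identities A = ?V ns"
        by blast
      then have "quot_dim (?V ns) (?V ns \<inter> identities A) = 0"
        using quot_dim_eq_0_iff[OF multihomog_quotient] by blast
      then have "cocharacter A ns \<sigma> = 0"
        unfolding cocharacter_def multihomog_polys_def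
        by (rule quot_trace_eq_0[OF multihomog_quotient])
      then show ?thesis
        using False by (simp add: m_def)
    next
      case True
      have perm: "\<sigma> v permutes {..<ns v}" for v
        using \<sigma> unfolding young_group_def by blast
      define h where "h = map (\<lambda>(i, v). (\<sigma> v i, v))"
      \<comment> \<open>Renaming the variables stays within the words of this multidegree, and any
        two such words agree modulo identities: the action on the quotient is trivial.\<close>
      have h: "h w \<in> hom_words ns1" if w: "w \<in> hom_words ns1" for w
      proof -
        let ?S = "{(i, v) | i v. i < ns1 v}"
        have "(\<lambda>(i, v). (\<sigma> v i, v)) ` ?S = ?S"
        proof
          show "(\<lambda>(i, v). (\<sigma> v i, v)) ` ?S \<subseteq> ?S"
            using permutes_in_image[OF perm] True by auto
          show "?S \<subseteq> (\<lambda>(i, v). (\<sigma> v i, v)) ` ?S"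
          proof clarify
            fix i :: nat and a b
            assume "i < ns1 (a, b)"
            then have "inv (\<sigma> (a, b)) i < ns1 (a, b)"
              using permutes_in_image[OF permutes_inv[OF perm], of "(a, b)" i] True by simp
            then show "(i, a, b) \<in> (\<lambda>(i, v). (\<sigma> v i, v)) ` ?S"
              using permutes_inverses(1)[OF perm, of "(a, b)" i]
              by (intro image_eqI[of _ _ "(inv (\<sigma> (a, b)) i, a, b)"]) auto
          qed
        qed
        moreover have "inj (\<lambda>(i, v). (\<sigma> v i, v))"
          using permutes_inj[OF perm] by (auto simp: inj_def)
        ultimately show ?thesis
          using w by (auto simp: h_def distinct_map intro: inj_on_subset)
      qed
      have "cocharacter A ns1 \<sigma> = of_nat q"
        unfolding cocharacter_def multihomog_polys_def q_def h_def[symmetric]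
      proof (rule quot_trace_trivial[OF multihomog_quotient])
        fix b assume b: "b \<in> ?V ns1"
        have diff: "Poly_Mapping.single (h w) 1 - Poly_Mapping.single w 1 \<in> ?V ns1 \<inter> identities A"
          if w: "w \<in> hom_words ns1" for w
          using same[OF w h[OF w]] single_mem_word_span[OF w] single_mem_word_span[OF h[OF w]]
          by (intro IntI PM.subspace_diff[OF subspace_word_span]) auto
        have "w \<in> hom_words ns1" if "w \<in> Poly_Mapping.keys b" for w
          using b that unfolding word_span_def by blast
        then show "pm_push h b - b \<in> ?V ns1 \<inter> identities A"
          unfolding pm_push_minus_self
          by (intro PM.subspace_sum[OF multihomog_quotient(2)] PM.subspace_scale[OF multihomog_quotient(2)] diff)
      qed
      also have "\<dots> = of_nat (m ns1 lam1) * (\<Prod>v\<in>UNIV. irr_char (lam1 v) (\<sigma> v))"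
      proof -
        have "irr_char (lam1 v) (\<sigma> v) = (1 :: 'f)" for v
          using perm[of v] n(2) irr_char_row[of n "\<sigma> v"] irr_char_Nil[of "\<sigma> v"] True
          by (auto simp: lam1_def ns1_def split: if_splits)
        then show ?thesis
          by (simp add: m_def)
      qed
      also have "\<dots> = (\<Sum>lam\<in>{lam1}. of_nat (m ns1 lam) * (\<Prod>v\<in>UNIV. irr_char (lam v) (\<sigma> v)))"
        by simp
      also have "\<dots> = (\<Sum>lam\<in>multipartitions ns1. of_nat (m ns1 lam) * (\<Prod>v\<in>UNIV. irr_char (lam v) (\<sigma> v)))"
        using lam1 finite_multipartitions by (intro sum.mono_neutral_left) (auto simp: m_def)
      finally show ?thesis
        using True by simp
    qed
  qed
  moreover have "(\<Sum>ns\<in>multidegrees n. \<Sum>lam\<in>multipartitions ns. m ns lam) = q"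
  proof -
    have "(\<Sum>ns\<in>multidegrees n. \<Sum>lam\<in>multipartitions ns. m ns lam) =
        (\<Sum>ns\<in>{ns1}. \<Sum>lam\<in>multipartitions ns. m ns lam)"
      using ns1 finite_multidegrees by (intro sum.mono_neutral_right) (auto simp: m_def)
    also have "\<dots> = (\<Sum>lam\<in>multipartitions ns1. m ns1 lam)"
      by simp
    also have "\<dots> = (\<Sum>lam\<in>{lam1}. m ns1 lam)"
      using lam1 finite_multipartitions by (intro sum.mono_neutral_right) (auto simp: m_def)
    finally show ?thesis
      by (simp add: m_def)
  qed
  ultimately have "has_colength A n q"
    unfolding has_colength_def by (intro exI[of _ m]) simp
  then show ?thesis
    using q by blast
qed

end

lemma long_words_trivial_if_decomposed:
  fixes A :: "('f::field_char_0, 'g::{finite,ab_group_add}, 'a::ab_group_add) gs_alg"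
    and N :: "('f, 'g, 'n::ab_group_add) gs_alg"
  assumes N: "gs_algebra N" "nilpotent_alg N"
    and "(\<exists>C :: ('f, 'g, 'c::ab_group_add) gs_alg. gs_algebra C \<and> commutative_alg C \<and>
          trivial_involution C \<and> trivial_grading C \<and> T_equivalent A (alg_sum C N)) \<or>
        T_equivalent A N"
  obtains k where "k \<noteq> 0" "long_words_trivial A k"
proof -
  \<comment> \<open>The threshold is dictated by \<open>N\<close>; the commutative summand accepts
    every \<open>k \<ge> 1\<close>.\<close>
  obtain k where k: "k \<ge> 1" "long_words_trivial N k"
    using gs_algebra.long_words_trivial_if_nilpotent[OF N] by blast
  from assms(3) have "long_words_trivial A k"
  proof
    assume "\<exists>C :: ('f, 'g, 'c) gs_alg. gs_algebra C \<and> commutative_alg C \<and>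
        trivial_involution C \<and> trivial_grading C \<and> T_equivalent A (alg_sum C N)"
    then obtain C :: "('f, 'g, 'c) gs_alg" where C: "gs_algebra C \<and> commutative_alg C \<and>
        trivial_involution C \<and> trivial_grading C \<and> T_equivalent A (alg_sum C N)"
      by blast
    then have "long_words_trivial C k"
      using gs_algebra.long_words_trivial_if_commutative[of C k] k(1) by blast
    then have "long_words_trivial (alg_sum C N) k"
      using k(2) alg_sum_identities[of C N] unfolding long_words_trivial_def by blast
    then show ?thesis
      using C by (auto simp: T_equivalent_def intro: long_words_trivial_mono)
  next
    assume "T_equivalent A N"
    then show ?thesis
      using k(2) by (auto simp: T_equivalent_def intro: long_words_trivial_mono)
  qed
  then show ?thesis
    using that[of k] k(1) by simp
qed

theorem theorem5p4:
  fixes A :: "('f::field_char_0, 'g::{finite,ab_group_add}, 'a::ab_group_add) gs_alg"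
  assumes "gs_algebra A" and "finite_dimensional A"
  defines "cond1 \<equiv>
      \<not> in_var A2_star A \<and> \<not> in_var C2_star A \<and>
      (\<forall>g. g \<noteq> 0 \<longrightarrow>
        \<not> in_var (A2_gr g) A \<and> \<not> in_var (C2_gr g) A \<and> \<not> in_var (C2_star_gr g) A)"
    and "cond2 \<equiv>
      (\<exists>N :: ('f, 'g, 'b) any_gs_alg. gs_algebra N \<and> nilpotent_alg N \<and>
        ((\<exists>C :: ('f, 'g, 'b) any_gs_alg.
            gs_algebra C \<and> commutative_alg C \<and> \<not> nilpotent_alg C \<and>
            trivial_involution C \<and> trivial_grading C \<and> T_equivalent A (alg_sum C N)) \<or>
         T_equivalent A N))"
    and "cond3 \<equiv> (\<exists>q. \<forall>n\<ge>1. codim A n \<le> q)"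
    and "cond4 \<equiv> (\<exists>n0. \<forall>n\<ge>n0. codim A n \<le> 1)"
    and "cond5 \<equiv> (\<exists>n0. \<forall>n\<ge>n0. \<exists>l. has_colength A n l \<and> l \<le> 1)"
  shows "(cond1 \<longleftrightarrow> cond2) \<and> (cond2 \<longleftrightarrow> cond3) \<and> (cond3 \<longleftrightarrow> cond4) \<and> (cond4 \<longleftrightarrow> cond5)"
proof -
  interpret gs_algebra A by fact
  have cond1: "cond1 \<longleftrightarrow> excludes_A2_C2 A"
    by (simp add: cond1_def excludes_A2_C2_def)
  have "cond2" if "cond1"
  proof -
    \<comment> \<open>The summands have to live on the type prescribed in \<open>cond2\<close>, so
      the decomposition is applied to a copy of \<open>A\<close> on that type.\<close>
    obtain B :: "('f, 'g, 'b) any_gs_alg"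
      where B: "gs_algebra B" "finite_dimensional B" "identities A = identities B"
      using finite_dimensional_copy[OF assms(1,2)] by blast
    have "excludes_A2_C2 B"
      using that unfolding cond1 by (simp add: excludes_A2_C2_def in_var_def B(3))
    then show ?thesis
      using decomposition[OF B(1,2)] unfolding cond2_def by (simp add: T_equivalent_def B(3))
  qed
  moreover have "cond4 \<and> cond5" if c2: "cond2"
  proof -
    obtain N :: "('f, 'g, 'b) any_gs_alg" where N: "gs_algebra N" "nilpotent_alg N"
      and "(\<exists>C :: ('f, 'g, 'b) any_gs_alg. gs_algebra C \<and> commutative_alg C \<and> \<not> nilpotent_alg C \<and>
          trivial_involution C \<and> trivial_grading C \<and> T_equivalent A (alg_sum C N)) \<or> T_equivalent A N"
      using c2 unfolding cond2_def by (elim exE conjE) (rule that)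
    then have dec: "(\<exists>C :: ('f, 'g, 'b) any_gs_alg. gs_algebra C \<and> commutative_alg C \<and>
          trivial_involution C \<and> trivial_grading C \<and> T_equivalent A (alg_sum C N)) \<or> T_equivalent A N"
      by blast
    obtain k where k: "k \<noteq> 0" "long_words_trivial A k"
      by (rule long_words_trivial_if_decomposed[OF N dec])
    have "codim A n \<le> 1" if "n \<ge> k" for n
      using codim_le_1[OF k(2) that] .
    moreover have "\<exists>l. has_colength A n l \<and> l \<le> 1" if "n \<ge> k" for n
      using colength_le_1[OF k(2) that] k(1) that by simp
    ultimately show ?thesis
      unfolding cond4_def cond5_def by blast
  qed
  moreover have "cond3" if c4: "cond4"
  proof -
    obtain n0 where n0: "\<And>n. n \<ge> n0 \<Longrightarrow> codim A n \<le> 1"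
      using c4 unfolding cond4_def by blast
    \<comment> \<open>The constant absorbs the finitely many codimensions below the
      threshold.\<close>
    have "codim A n \<le> 1 + (\<Sum>i<n0. codim A i)" for n
    proof (cases "n < n0")
      case True
      then have "codim A n \<le> (\<Sum>i<n0. codim A i)"
        by (intro member_le_sum) auto
      then show ?thesis
        by simp
    next
      case False
      then show ?thesis
        using n0[of n] by simp
    qed
    then show ?thesis
      unfolding cond3_def by blast
  qed
  \<comment> \<open>This closes the cycle: any one of the five algebras in the variety forces
    codimensions of at least n and colengths of at least 2 from degree 2 on.\<close>
  moreover have "cond1" if "cond3 \<or> cond5"
  proof (rule ccontr)
    assume "\<not> cond1"
    then obtain v where v: "v \<noteq> triv"
      and lower: "\<And>n. n \<ge> 2 \<Longrightarrow> n \<le> codim A n"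
        "\<And>n. n \<ge> 2 \<Longrightarrow> Poly_Mapping.single (triv_word n) 1 \<notin> identities A"
        "\<And>n. n \<ge> 2 \<Longrightarrow> Poly_Mapping.single (triv_word (n - 1) @ [(0, v)]) 1 \<notin> identities A"
      using not_excludes_A2_C2[OF assms(1)] unfolding cond1 by blast
    from that show False
    proof
      assume cond3
      then obtain q where "\<And>n. n \<ge> 1 \<Longrightarrow> codim A n \<le> q"
        unfolding cond3_def by blast
      \<comment> \<open>Degree q + 2 is at least 2, where the lower bound starts, and exceeds
        q.\<close>
      from this[of "q + 2"] lower(1)[of "q + 2"] show False
        by simp
    next
      assume cond5
      then obtain n0 where "\<And>n. n \<ge> n0 \<Longrightarrow> \<exists>l. has_colength A n l \<and> l \<le> 1"
        unfolding cond5_def by blast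
      then obtain l where l: "has_colength A (n0 + 2) l" "l \<le> 1"
        by (meson le_add1)
      have "2 \<le> l"
        using colength_ge_2[OF v _ lower(2,3) l(1)] by simp
      then show False
        using l(2) by simp
    qed
  qed
  ultimately show ?thesis
    by blast
qed

end
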